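(* Let $m$ be a positive integer, $p$ a prime number with $p\ge 5$, and $\alpha$ a positive integer. Let $F_m(z)=1+\sum_{\lambda\ge1}f_\lambda(m)z^\lambda$. Then $F_m(z)$, when its coefficients are reduced modulo $p^\alpha$, can be represented as a rational function, i.e. there exist polynomials $P(z),Q(z)\in\mathbb{Z}[z]$ with $Q(0)=1$ such that $Q(z)F_m(z)\equiv P(z)$ coefficientwise modulo $p^\alpha$. Equivalently, the sequence $(f_\lambda(m))_{\lambda\ge1}$ is ultimately periodic modulo $p^\alpha$.
   Context: For a positive integer $m$, let $\Gamma_m(3)=C_{2m}*_{C_m}C_{3m}=\langle x,y\mid x^{2m}=y^{3m}=1,\ x^2=y^3\rangle$ (for $m=1$ this is $\mathrm{PSL}_2(\mathbb{Z})$). For integers $\lambda\ge1$, $f_\lambda(m)$ denotes the number of free subgroups of index $6m\lambda$ in $\Gamma_m(3)$. *)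

theory Defs
  imports "HOL-Algebra.Coset" "HOL-Computational_Algebra.Computational_Algebra"
    "HOL-Number_Theory.Cong"
begin

(* A word is a list of letters; (a, True) stands for the generator a, (a, False) for its inverse. *)
type_synonym 'a word = "('a \<times> bool) list"

definition words :: "'a set \<Rightarrow> 'a word set" where
  "words S = lists (S \<times> UNIV)"

(* The least congruence on words over S that makes formal inverses inverse to each other and
   identifies u with v for each defining relation (u, v) in R. *)
inductive pres_eq :: "'a set \<Rightarrow> ('a word \<times> 'a word) set \<Rightarrow> 'a word \<Rightarrow> 'a word \<Rightarrow> bool"
  for S R where
  refl: "w \<in> words S \<Longrightarrow> pres_eq S R w w"
| sym: "pres_eq S R u v \<Longrightarrow> pres_eq S R v u"
| trans: "pres_eq S R u v \<Longrightarrow> pres_eq S R v w \<Longrightarrow> pres_eq S R u w"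
| append: "pres_eq S R u u' \<Longrightarrow> pres_eq S R v v' \<Longrightarrow> pres_eq S R (u @ v) (u' @ v')"
| cancel: "a \<in> S \<Longrightarrow> pres_eq S R [(a, e), (a, \<not> e)] []"
| rel: "(u, v) \<in> R \<Longrightarrow> u \<in> words S \<Longrightarrow> v \<in> words S \<Longrightarrow> pres_eq S R u v"

definition pres_rel :: "'a set \<Rightarrow> ('a word \<times> 'a word) set \<Rightarrow> ('a word \<times> 'a word) set" where
  "pres_rel S R = {(u, v). pres_eq S R u v}"

definition presented_group :: "'a set \<Rightarrow> ('a word \<times> 'a word) set \<Rightarrow> 'a word set monoid" where
  "presented_group S R =
     \<lparr>carrier = words S // pres_rel S R,
      monoid.mult = (\<lambda>A B. \<Union>u\<in>A. \<Union>v\<in>B. pres_rel S R `` {u @ v}),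
      one = pres_rel S R `` {[]}\<rparr>"

definition free_group :: "'a set \<Rightarrow> 'a word set monoid" where
  "free_group S = presented_group S {}"

(* A basis of a group G is a subset of G, so it is no restriction to take the
   free generators from the element type of G. *)
definition is_free_group :: "('a, 'b) monoid_scheme \<Rightarrow> bool" where
  "is_free_group G \<longleftrightarrow> group G \<and> (\<exists>S :: 'a set. free_group S \<cong> G)"

datatype generator = gen_x | gen_y

abbreviation pow_word :: "'a \<Rightarrow> nat \<Rightarrow> 'a word" where
  "pow_word a n \<equiv> replicate n (a, True)"

definition Gamma3 :: "nat \<Rightarrow> generator word set monoid" where
  "Gamma3 m = presented_group {gen_x, gen_y}
     {(pow_word gen_x (2 * m), []), (pow_word gen_y (3 * m), []), (pow_word gen_x 2, pow_word gen_y 3)}"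

definition free_subgroups :: "('a, 'b) monoid_scheme \<Rightarrow> nat \<Rightarrow> 'a set set" where
  "free_subgroups G n =
     {H. subgroup H G \<and> card (rcosets\<^bsub>G\<^esub> H) = n \<and> is_free_group (G\<lparr>carrier := H\<rparr>)}"

definition free_subgroup_number :: "nat \<Rightarrow> nat \<Rightarrow> nat" where
  "free_subgroup_number m l = card (free_subgroups (Gamma3 m) (6 * m * l))"

definition free_subgroup_fps :: "nat \<Rightarrow> int fps" where
  "free_subgroup_fps m = Abs_fps (\<lambda>l. if l = 0 then 1 else int (free_subgroup_number m l))"

lemma pres_eq_words: "pres_eq S R u v \<Longrightarrow> u \<in> words S \<and> v \<in> words S"
  by (induction rule: pres_eq.induct) (auto simp: words_def)

lemma equiv_pres_rel: "equiv (words S) (pres_rel S R)"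
proof (rule equivI)
  show "pres_rel S R \<subseteq> words S \<times> words S"
    using pres_eq_words[of S R] by (auto simp: pres_rel_def)
  show "refl_on (words S) (pres_rel S R)"
    by (auto simp: pres_rel_def refl_on_def intro: pres_eq.refl)
  show "sym (pres_rel S R)"
    by (rule symI) (simp add: pres_rel_def pres_eq.sym)
  show "trans (pres_rel S R)"
    by (rule transI) (use pres_eq.trans in \<open>fastforce simp: pres_rel_def\<close>)
qed

lemma presented_group_mult:
  assumes "u \<in> words S" "v \<in> words S"
  shows "pres_rel S R `` {u} \<otimes>\<^bsub>presented_group S R\<^esub> pres_rel S R `` {v}
           = pres_rel S R `` {u @ v}"
proof -
  have UN_const: "(\<Union>x\<in>A. \<Union>y\<in>B. g x y) = C"
    if "a \<in> A" "b \<in> B" "\<And>x y. x \<in> A \<Longrightarrow> y \<in> B \<Longrightarrow> g x y = C"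
    for A B :: "'a word set" and a b and g and C :: "'a word set"
    using that by blast
  have "pres_rel S R `` {u' @ v'} = pres_rel S R `` {u @ v}"
    if "u' \<in> pres_rel S R `` {u}" "v' \<in> pres_rel S R `` {v}" for u' v'
    by (rule equiv_class_eq[OF equiv_pres_rel])
       (use that in \<open>simp add: pres_rel_def pres_eq.append pres_eq.sym\<close>)
  moreover have "u \<in> pres_rel S R `` {u}" "v \<in> pres_rel S R `` {v}"
    using assms by (auto simp: pres_rel_def intro: pres_eq.refl)
  ultimately show ?thesis
    unfolding presented_group_def monoid.simps by (intro UN_const)
qed

lemma pres_eq_inverse:
  "w \<in> words S \<Longrightarrow> pres_eq S R (map (\<lambda>(a, e). (a, \<not> e)) (rev w) @ w) []"
proof (induction w)
  case Nil
  then show ?case by (auto simp: words_def intro: pres_eq.refl)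
next
  case (Cons x w)
  obtain a e where x: "x = (a, e)" by force
  let ?i = "map (\<lambda>(a, e). (a, \<not> e)) (rev w)"
  have a: "a \<in> S" and w: "w \<in> words S" using Cons.prems x by (auto simp: words_def)
  have i: "?i \<in> words S" using w by (auto simp: words_def)
  have "pres_eq S R ([(a, \<not> e), (a, e)] @ w) ([] @ w)"
    using pres_eq.cancel[OF a, of R "\<not> e"] w by (intro pres_eq.append pres_eq.refl) auto
  then have "pres_eq S R (?i @ [(a, \<not> e), (a, e)] @ w) (?i @ w)"
    using pres_eq.append[OF pres_eq.refl[OF i]] by fastforce
  from pres_eq.trans[OF this Cons.IH[OF w]] show ?case using x by simp
qed

lemma group_presented_group: "group (presented_group S R)"
proof (rule groupI)
  let ?G = "presented_group S R" and ?c = "\<lambda>w. pres_rel S R `` {w}"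
  have car: "carrier ?G = words S // pres_rel S R" and one: "\<one>\<^bsub>?G\<^esub> = ?c []"
    by (simp_all add: presented_group_def)
  have nil: "[] \<in> words S" and app: "\<And>u v. u \<in> words S \<Longrightarrow> v \<in> words S \<Longrightarrow> u @ v \<in> words S"
    by (auto simp: words_def)
  have cls: "\<And>w. w \<in> words S \<Longrightarrow> ?c w \<in> carrier ?G"
    by (simp add: car quotientI)
  show "\<one>\<^bsub>?G\<^esub> \<in> carrier ?G" by (simp add: one cls nil)
  fix A assume "A \<in> carrier ?G"
  then obtain u where u: "u \<in> words S" "A = ?c u" by (auto simp: car elim: quotientE)
  show "\<one>\<^bsub>?G\<^esub> \<otimes>\<^bsub>?G\<^esub> A = A" by (simp add: one u presented_group_mult nil)
  let ?i = "map (\<lambda>(a, e). (a, \<not> e)) (rev u)"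
  have i: "?i \<in> words S" using u by (auto simp: words_def)
  have "?c (?i @ u) = ?c []"
    by (rule equiv_class_eq[OF equiv_pres_rel])
       (use pres_eq_inverse[OF u(1)] in \<open>simp add: pres_rel_def\<close>)
  then show "\<exists>B\<in>carrier ?G. B \<otimes>\<^bsub>?G\<^esub> A = \<one>\<^bsub>?G\<^esub>"
    by (intro bexI[OF _ cls[OF i]]) (simp add: presented_group_mult i u one)
  fix B assume "B \<in> carrier ?G"
  then obtain v where v: "v \<in> words S" "B = ?c v" by (auto simp: car elim: quotientE)
  show "A \<otimes>\<^bsub>?G\<^esub> B \<in> carrier ?G" by (simp add: u v presented_group_mult app cls)
  fix C assume "C \<in> carrier ?G"
  then obtain w where w: "w \<in> words S" "C = ?c w" by (auto simp: car elim: quotientE)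
  show "A \<otimes>\<^bsub>?G\<^esub> B \<otimes>\<^bsub>?G\<^esub> C = A \<otimes>\<^bsub>?G\<^esub> (B \<otimes>\<^bsub>?G\<^esub> C)"
    by (simp add: u v w presented_group_mult app)
qed

end

theory Submission
  imports Defs "HOL-Combinatorics.Permutations"
begin

text \<open>
  A subgroup of finite index in the amalgam \<open>\<langle>x, y | x\<^sup>2\<^sup>m = y\<^sup>3\<^sup>m = 1, x\<^sup>2 = y\<^sup>3\<rangle>\<close> is free if and
  only if \<open>x\<close> and \<open>y\<close> act on its cosets with all cycles of lengths \<open>2m\<close> and \<open>3m\<close>: a free group is
  torsion-free, and conversely the stabilizer of a point is the fundamental group of the bipartite graph
  whose vertices are the orbits of \<open>x\<close> and of \<open>y\<close> and whose edges are the orbits of \<open>x\<^sup>2 = y\<^sup>3\<close>.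

  All elements of the symmetric group with cycles of length \<open>m\<close> only are conjugate and therefore have
  the same number of square roots and of cube roots with cycles of lengths \<open>2m\<close> and \<open>3m\<close>. Hence the
  number of such actions on \<open>6mn\<close> points is \<open>(6mn)! c\<^sub>n\<close> with
  \<open>c\<^sub>n = (m/72)\<^sup>n (6n)! / ((3n)! (2n)!)\<close>. Splitting off the orbit of a point turns this into the identity
  \<open>F(z) = 1 + 6mz H'(z) / H(z)\<close> for \<open>H(z) = \<Sum> c\<^sub>n z\<^sup>n\<close>.

  Since \<open>(6n)! / ((3n)! (2n)!)\<close> is a multiple of \<open>n!\<close> and \<open>72\<close> is invertible modulo \<open>p\<^sup>\<alpha>\<close>, the series
  \<open>H\<close> reduces to a polynomial modulo \<open>p\<^sup>\<alpha>\<close>.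
\<close>

subsection \<open>Rationality and periodicity modulo prime powers\<close>

text \<open>The constant 72 is 2^3 * 3^2. On 6mn points the permutations with cycle lengths m, 2m,
  3m have centralizers of orders m^(6n) (6n)!, (2m)^(3n) (3n)! and (3m)^(2n) (2n)!; the number of
  actions is the product of the last two class sizes divided by the first, which leaves (m/72)^n.
  Fractions are avoided: the counting identities are multiplied by powers of 72, and 72 is inverted
  only modulo the prime power. That free subgroups give regular actions needs x and y to have exact
  orders 2m and 3m. The count itself supplies this, since it shows that a regular action on 6m
  points exists. That stabilizers are free is made explicit. Take the free group F on the edges
  outside a spanning tree. One map sends an edge to the closed word that runs through the tree and
  across this edge; its inverse reads off the F-component when the amalgam acts on pairs of a point
  and an element of F.\<close>

lemma recurrence_periodic:
  fixes a :: "nat \<Rightarrow> nat"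
  assumes bound: "\<And>n. a n < M"
    and step: "\<And>i j. i \<ge> n0 \<Longrightarrow> j \<ge> n0 \<Longrightarrow> (\<forall>k<D. a (i + k) = a (j + k)) \<Longrightarrow> a (i + D) = a (j + D)"
  shows "\<exists>N \<omega>. \<omega> > 0 \<and> (\<forall>l\<ge>N. a (l + \<omega>) = a l)"
proof -
  \<comment> \<open>Windows of length \<open>D\<close> with entries below \<open>M\<close> are
    finite in number, so two of them coincide; \<open>step\<close> then keeps them equal under every
    common shift.\<close>
  define v where "v n = map (\<lambda>k. a (n + k)) [0..<D]" for n
  have "v ` {n0..} \<subseteq> {xs. set xs \<subseteq> {..<M} \<and> length xs = D}"
    using bound by (auto simp: v_def)
  then have "finite (v ` {n0..})"
    by (rule finite_subset) (rule finite_lists_length_eq, simp)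
  then have "\<not> inj_on v {n0..}"
    using finite_imageD[of v "{n0..}"] infinite_Ici[of n0] by blast
  then obtain i j where ij: "i \<ge> n0" "i < j" "v i = v j"
    unfolding inj_on_def by (metis atLeast_iff nat_neq_iff)
  have v_eq: "v x = v y \<longleftrightarrow> (\<forall>k<D. a (x + k) = a (y + k))" for x y
    by (auto simp: v_def)
  have window: "v (i + t) = v (j + t)" for t
  proof (induction t)
    case 0
    then show ?case using ij by simp
  next
    case (Suc t)
    then have eq: "\<forall>k<D. a (i + t + k) = a (j + t + k)" by (simp add: v_eq)
    then have "a (i + t + D) = a (j + t + D)" using step[of "i + t" "j + t"] ij by simp
    with eq have "\<forall>k\<le>D. a (i + t + k) = a (j + t + k)" by (auto simp: le_less)
    then have "a (i + t + Suc k) = a (j + t + Suc k)" if "k < D" for k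
      using that Suc_leI by blast
    then show ?case unfolding v_eq by simp
  qed
  have "a (i + t) = a (j + t)" for t
  proof (cases "D = 0")
    case True
    \<comment> \<open>Empty windows say nothing about \<open>a\<close>, but the hypothesis of
      \<open>step\<close> is then vacuous.\<close>
    show ?thesis using step[of "i + t" "j + t"] ij True by simp
  next
    case False
    then show ?thesis using window[of t] unfolding v_eq by (auto dest: spec[of _ 0])
  qed
  note shift = this
  have "a (l + (j - i)) = a l" if "l \<ge> i" for l
  proof -
    have "l + (j - i) = j + (l - i)" "l = i + (l - i)" using that ij(2) by auto
    with shift[of "l - i"] show ?thesis by metis
  qed
  then show ?thesis using ij(2) by (intro exI[of _ i] exI[of _ "j - i"]) auto
qed

text \<open>Up to the factor (m/72)^n this is the \<open>c\<^sub>n\<close> of the overview; keeping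
  the power of 72 apart lets the counting stay in the natural numbers. The division is
  exact.\<close>

definition gamma_coeff :: "nat \<Rightarrow> nat" where
  "gamma_coeff n = fact (6 * n) div (fact (3 * n) * fact (2 * n))"

text \<open>The quotient equals binomial(6n, 3n) * binomial(3n, n) * n!.\<close>

lemma fact_dvd_gamma_coeff: "fact n dvd gamma_coeff n"
  and gamma_coeff_mult: "gamma_coeff n * (fact (3 * n) * fact (2 * n)) = fact (6 * n)"
proof -
  have "fact (2 * n) * fact n dvd (fact (3 * n) :: nat)"
    using fact_fact_dvd_fact[of "2 * n" n, where 'a = nat] by (simp add: algebra_simps)
  moreover have "fact (3 * n) * fact (3 * n) dvd (fact (6 * n) :: nat)"
    using fact_fact_dvd_fact[of "3 * n" "3 * n", where 'a = nat] by (simp add: algebra_simps)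
  ultimately have "fact (3 * n) * (fact (2 * n) * fact n) dvd (fact (6 * n) :: nat)"
    by (meson dvd_refl dvd_trans mult_dvd_mono)
  then obtain c where c: "fact (6 * n) = fact (3 * n) * (fact (2 * n) * fact n) * (c :: nat)" ..
  then have "fact (6 * n) = fact (3 * n) * fact (2 * n) * (fact n * c)"
    by (simp only: mult.assoc)
  moreover from this have "gamma_coeff n = fact n * c"
    unfolding gamma_coeff_def by (metis fact_nonzero mult_eq_0_iff nonzero_mult_div_cancel_left)
  ultimately show "fact n dvd gamma_coeff n"
    and "gamma_coeff n * (fact (3 * n) * fact (2 * n)) = fact (6 * n)"
    by (simp_all add: mult_ac)
qed

text \<open>A crude form of Legendre's formula, from p! (pk)! dividing (p + pk)!. It makes
  \<open>p * \<alpha>\<close> an explicit degree bound.\<close>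

lemma prime_power_dvd_fact:
  fixes p :: nat
  assumes "prime p" "p * k \<le> n"
  shows "p ^ k dvd fact n"
proof -
  have "p ^ k dvd fact (p * k)"
  proof (induction k)
    case (Suc k)
    have "p dvd fact p" using prime_ge_1_nat[OF assms(1)] by (intro dvd_fact) auto
    with Suc have "p * p ^ k dvd fact p * fact (p * k)" by (intro mult_dvd_mono) auto
    also have "\<dots> dvd fact (p * Suc k)"
      using fact_fact_dvd_fact[of p "p * k", where 'a = nat] by simp
    finally show ?case by simp
  qed simp
  with assms(2) show ?thesis using fact_dvd dvd_trans by blast
qed

text \<open>The arithmetic half, detached from the group theory. The assumption is the coefficient
  form of H F = H + 6mz H', multiplied by 72^n to clear denominators. Modulo the prime power,
  \<open>Q\<close> is H cut off where its coefficients vanish, and \<open>P\<close> is H + 6mz H'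
  cut off likewise.\<close>

lemma rational_and_periodic_of_log_derivative:
  fixes f :: "nat \<Rightarrow> nat" and m p \<alpha> :: nat
  assumes p: "prime p" "p \<ge> 5"
    and log_deriv: "\<And>n. n > 0 \<Longrightarrow>
      (\<Sum>j=1..n. f j * 72 ^ j * (gamma_coeff (n - j) * m ^ (n - j))) = 6 * m * n * (gamma_coeff n * m ^ n)"
  defines "F \<equiv> Abs_fps (\<lambda>l. if l = 0 then 1 else int (f l))"
  shows "\<exists>P Q :: int poly. poly Q 0 = 1 \<and>
            (\<forall>n. [fps_nth (fps_of_poly Q * F) n = coeff P n] (mod (int p ^ \<alpha>)))"
    and "\<exists>N \<omega>. \<omega> > 0 \<and> (\<forall>l\<ge>N. [f (l + \<omega>) = f l] (mod (p ^ \<alpha>)))"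
proof -
  let ?M = "int p ^ \<alpha>"
  define D where "D = p * \<alpha>"
  \<comment> \<open>The prime divisors 2 and 3 of 72 are excluded by
    \<open>p \<ge> 5\<close>.\<close>
  have "\<not> p dvd 72"
  proof
    assume "p dvd 72"
    then have "p dvd 2 ^ 3 * 3 ^ 2" by simp
    then have "p dvd 2 \<or> p dvd 3"
      using p(1) by (meson prime_dvd_mult_iff prime_dvd_power_nat)
    then show False using p(2) by (auto dest: dvd_imp_le)
  qed
  then have "coprime p 72" using p(1) by (rule prime_imp_coprime[rotated])
  then have "coprime (int p) (int 72)" by (simp only: coprime_int_iff)
  then have "coprime (72 :: int) ?M" by (simp add: coprime_commute)
  then obtain u where u: "[72 * u = 1] (mod ?M)"
    using cong_solve_coprime_int by blast
  \<comment> \<open>The coefficients of H modulo the prime power, with \<open>u\<close> in place of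
    1/72.\<close>
  define q where "q n = int (gamma_coeff n) * int m ^ n * u ^ n" for n
  have q0: "q 0 = 1" by (simp add: q_def gamma_coeff_def)
  have q_vanish: "[q n = 0] (mod ?M)" if "n \<ge> D" for n
  proof -
    have "p ^ \<alpha> dvd gamma_coeff n"
      using prime_power_dvd_fact[OF p(1)] fact_dvd_gamma_coeff that
      unfolding D_def by (meson dvd_trans)
    then have "?M dvd int (gamma_coeff n)" by (metis of_nat_dvd_iff of_nat_power)
    then show ?thesis by (simp add: q_def cong_0_iff)
  qed
  \<comment> \<open>After multiplication of the identity for \<open>n\<close> by
    \<open>u ^ n\<close>, the factor 72^j beside \<open>f j\<close> turns into the
    \<open>u ^ (n - j)\<close> contained in \<open>q (n - j)\<close>.\<close>
  have u_pow: "[72 ^ j * u ^ (j + k) = u ^ k] (mod ?M)" for j k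
  proof -
    have "[(72 * u) ^ j * u ^ k = 1 ^ j * u ^ k] (mod ?M)"
      by (intro cong_mult cong_pow u cong_refl)
    then show ?thesis by (simp add: power_mult_distrib power_add mult.assoc)
  qed
  have conv: "[(\<Sum>j=1..n. int (f j) * q (n - j)) = 6 * int m * int n * q n] (mod ?M)" if "n > 0" for n
  proof -
    have "[(\<Sum>j=1..n. int (f j) * q (n - j)) =
        (\<Sum>j=1..n. int (f j) * (int (gamma_coeff (n - j)) * int m ^ (n - j) * (72 ^ j * u ^ n)))] (mod ?M)"
    proof (rule cong_sum)
      fix j assume "j \<in> {1..n}"
      then have "[72 ^ j * u ^ n = u ^ (n - j)] (mod ?M)"
        using u_pow[of j "n - j"] by simp
      then show "[int (f j) * q (n - j) =
          int (f j) * (int (gamma_coeff (n - j)) * int m ^ (n - j) * (72 ^ j * u ^ n))] (mod ?M)"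
        unfolding q_def by (intro cong_mult cong_refl) (simp add: cong_sym)
    qed
    also have "(\<Sum>j=1..n. int (f j) * (int (gamma_coeff (n - j)) * int m ^ (n - j) * (72 ^ j * u ^ n)))
        = int (\<Sum>j=1..n. f j * 72 ^ j * (gamma_coeff (n - j) * m ^ (n - j))) * u ^ n"
      by (simp add: sum_distrib_right sum_distrib_left mult_ac)
    also have "\<dots> = 6 * int m * int n * q n"
      using log_deriv[OF that] by (simp add: q_def algebra_simps)
    finally show ?thesis .
  qed
  have F_nth: "fps_nth F 0 = 1" "\<And>l. l > 0 \<Longrightarrow> fps_nth F l = int (f l)"
    by (simp_all add: F_def)
  \<comment> \<open>The constant term 1 of \<open>F\<close> contributes the extra summand
    \<open>q n\<close>, hence the 1 in the factor on the right.\<close>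
  have full: "[(\<Sum>i\<le>n. q i * fps_nth F (n - i)) = (1 + 6 * int m * int n) * q n] (mod ?M)" for n
  proof (cases "n = 0")
    case True
    then show ?thesis by (simp add: F_nth q0)
  next
    case False
    have "(\<Sum>i\<le>n. q i * fps_nth F (n - i)) = (\<Sum>j\<le>n. q (n - j) * fps_nth F j)"
      by (rule sum.reindex_bij_witness[of _ "\<lambda>j. n - j" "\<lambda>j. n - j"]) auto
    also have "\<dots> = (\<Sum>j\<in>insert 0 {1..n}. q (n - j) * fps_nth F j)"
      by (rule sum.cong) auto
    also have "\<dots> = q n + (\<Sum>j=1..n. int (f j) * q (n - j))"
      by (simp add: F_nth mult.commute)
    finally have "(\<Sum>i\<le>n. q i * fps_nth F (n - i)) = q n + (\<Sum>j=1..n. int (f j) * q (n - j))" .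
    moreover have "(1 + 6 * int m * int n) * q n = q n + 6 * int m * int n * q n"
      by (simp add: distrib_right)
    moreover have "[q n + (\<Sum>j=1..n. int (f j) * q (n - j)) = q n + 6 * int m * int n * q n] (mod ?M)"
      using conv[of n] False by (intro cong_add cong_refl) simp
    ultimately show ?thesis by simp
  qed
  define Q where "Q = (\<Sum>i<D. monom (q i) i)"
  define P where "P = (\<Sum>i<D. monom ((1 + 6 * int m * int i) * q i) i)"
  have coeff_Q: "coeff Q n = (if n < D then q n else 0)" for n
    by (simp add: Q_def coeff_sum sum.delta if_distrib cong: if_cong)
  have coeff_P: "coeff P n = (if n < D then (1 + 6 * int m * int n) * q n else 0)" for n
    by (simp add: P_def coeff_sum sum.delta if_distrib cong: if_cong)
  have Q_q: "[coeff Q n = q n] (mod ?M)" for n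
    using q_vanish[of n] by (auto simp: coeff_Q cong_sym)
  have P_q: "[coeff P n = (1 + 6 * int m * int n) * q n] (mod ?M)" for n
    using cong_mult[OF cong_refl q_vanish[of n]] by (auto simp: coeff_P cong_sym)
  have QF: "[fps_nth (fps_of_poly Q * F) n = coeff P n] (mod ?M)" for n
  proof -
    have "fps_nth (fps_of_poly Q * F) n = (\<Sum>i\<le>n. coeff Q i * fps_nth F (n - i))"
      by (simp add: fps_mult_nth atLeast0AtMost)
    also have "[\<dots> = (\<Sum>i\<le>n. q i * fps_nth F (n - i))] (mod ?M)"
      by (intro cong_sum cong_mult Q_q cong_refl)
    also note full
    also have "[(1 + 6 * int m * int n) * q n = coeff P n] (mod ?M)"
      using P_q by (rule cong_sym)
    finally show ?thesis .
  qed
  show "\<exists>P Q :: int poly. poly Q 0 = 1 \<and>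
            (\<forall>n. [fps_nth (fps_of_poly Q * F) n = coeff P n] (mod (int p ^ \<alpha>)))"
  \<comment> \<open>For \<open>\<alpha> = 0\<close> the truncated \<open>Q\<close> is the zero
    polynomial and its constant term is lost; modulo 1 the constant 1 serves instead.\<close>
  proof (cases "D = 0")
    case True
    then have "\<alpha> = 0" using p(2) by (simp add: D_def)
    then show ?thesis by (intro exI[of _ 0] exI[of _ 1]) simp
  next
    case False
    then have "poly Q 0 = 1" by (simp add: poly_0_coeff_0 coeff_Q q0)
    then show ?thesis using QF by blast
  qed
  define a where "a n = f n mod p ^ \<alpha>" for n
  \<comment> \<open>The coefficient of \<open>Q * F\<close> at \<open>i + D\<close> lies beyond the
    degree of \<open>P\<close>, and \<open>Q\<close> has constant term 1, so
    \<open>f (i + D)\<close> can be solved for. The bound \<open>i \<ge> 1\<close> keeps clear of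
    the constant term of \<open>F\<close>, which is 1 and not \<open>f 0\<close>.\<close>
  have rec: "[int (f (i + D)) = - (\<Sum>k<D. coeff Q (D - k) * int (a (i + k)))] (mod ?M)"
    if "i \<ge> 1" for i
  proof (cases "D = 0")
    case True
    then have "\<alpha> = 0" using p(2) by (simp add: D_def)
    then show ?thesis by simp
  next
    case False
    have a_f: "[int (a n) = int (f n)] (mod ?M)" for n
      by (simp add: a_def cong_def zmod_int)
    have "fps_nth (fps_of_poly Q * F) (i + D) = (\<Sum>t\<le>i + D. coeff Q t * fps_nth F (i + D - t))"
      by (simp add: fps_mult_nth atLeast0AtMost)
    also have "\<dots> = (\<Sum>t\<le>D. coeff Q t * fps_nth F (i + D - t))"
      by (rule sum.mono_neutral_right) (auto simp: coeff_Q)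
    also have "\<dots> = (\<Sum>k\<le>D. coeff Q (D - k) * fps_nth F (i + k))"
      by (rule sum.reindex_bij_witness[of _ "\<lambda>j. D - j" "\<lambda>j. D - j"]) auto
    also have "\<dots> = (\<Sum>k\<le>D. coeff Q (D - k) * int (f (i + k)))"
      using that by (simp add: F_nth)
    also have "\<dots> = int (f (i + D)) + (\<Sum>k<D. coeff Q (D - k) * int (f (i + k)))"
      using False by (simp add: lessThan_Suc_atMost[symmetric] coeff_Q q0)
    finally have "[int (f (i + D)) + (\<Sum>k<D. coeff Q (D - k) * int (f (i + k))) = 0] (mod ?M)"
      using QF[of "i + D"] by (simp add: coeff_P)
    then have "[int (f (i + D)) = - (\<Sum>k<D. coeff Q (D - k) * int (f (i + k)))] (mod ?M)"
      by (simp add: cong_iff_dvd_diff)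
    moreover have "[(\<Sum>k<D. coeff Q (D - k) * int (a (i + k))) = (\<Sum>k<D. coeff Q (D - k) * int (f (i + k)))] (mod ?M)"
      by (intro cong_sum cong_mult cong_refl a_f)
    ultimately show ?thesis
      by (meson cong_minus_minus_iff cong_sym cong_trans)
  qed
  have "\<exists>N \<omega>. \<omega> > 0 \<and> (\<forall>l\<ge>N. a (l + \<omega>) = a l)"
  proof (rule recurrence_periodic)
    show "a n < p ^ \<alpha>" for n using p(2) by (simp add: a_def)
    fix i j assume ij: "1 \<le> i" "1 \<le> j" "\<forall>k<D. a (i + k) = a (j + k)"
    have "[int (f (i + D)) = int (f (j + D))] (mod ?M)"
      using cong_trans[OF rec[OF ij(1)]] cong_sym[OF rec[OF ij(2)]] ij(3) by simp
    then have "[f (i + D) = f (j + D)] (mod p ^ \<alpha>)"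
      by (metis cong_int_iff of_nat_power)
    then show "a (i + D) = a (j + D)" by (simp add: a_def cong_def)
  qed
  then show "\<exists>N \<omega>. \<omega> > 0 \<and> (\<forall>l\<ge>N. [f (l + \<omega>) = f l] (mod (p ^ \<alpha>)))"
    by (simp add: a_def cong_def)
qed

subsection \<open>Permutations with all cycles of the same length\<close>

text \<open>Equivalently, the permutations through which a cyclic group of order \<open>d\<close>
  acts freely on \<open>X\<close>. Being the identity outside \<open>X\<close>, they are determined
  by their values on \<open>X\<close> and can be counted.\<close>

definition regular_perms :: "nat \<Rightarrow> 'q set \<Rightarrow> ('q \<Rightarrow> 'q) set" where
  "regular_perms d X = {\<sigma>. \<sigma> permutes X \<and>
     (\<forall>p\<in>X. (\<sigma> ^^ d) p = p \<and> (\<forall>j. 0 < j \<and> j < d \<longrightarrow> (\<sigma> ^^ j) p \<noteq> p))}"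

lemma regular_permsD:
  assumes "\<sigma> \<in> regular_perms d X"
  shows "\<sigma> permutes X" and "(\<sigma> ^^ d) p = p"
    and "p \<in> X \<Longrightarrow> 0 < j \<Longrightarrow> j < d \<Longrightarrow> (\<sigma> ^^ j) p \<noteq> p"
proof -
  show *: "\<sigma> permutes X" using assms by (simp add: regular_perms_def)
  show "(\<sigma> ^^ d) p = p"
  proof (cases "p \<in> X")
    case False
    then have "\<sigma> p = p" using * by (simp add: permutes_not_in)
    then show ?thesis by (induction d) auto
  qed (use assms in \<open>simp add: regular_perms_def\<close>)
  show "p \<in> X \<Longrightarrow> 0 < j \<Longrightarrow> j < d \<Longrightarrow> (\<sigma> ^^ j) p \<noteq> p"
    using assms by (simp add: regular_perms_def)
qed

lemma funpow_permutes: "\<sigma> permutes X \<Longrightarrow> (\<sigma> ^^ n) permutes X"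
  by (induction n) (auto intro: permutes_compose permutes_id simp: id_def[symmetric] permutes_id)

lemma regular_perms_funpow_in: "\<sigma> \<in> regular_perms d X \<Longrightarrow> (\<sigma> ^^ n) p \<in> X \<longleftrightarrow> p \<in> X"
  by (rule permutes_in_image[OF funpow_permutes[OF regular_permsD(1)]])

lemma regular_perms_funpow_mod: "\<sigma> \<in> regular_perms d X \<Longrightarrow> (\<sigma> ^^ (n mod d)) p = (\<sigma> ^^ n) p"
  by (rule funpow_mod_eq) (rule regular_permsD(2))

lemma regular_perms_funpow_eq_iff:
  assumes "\<sigma> \<in> regular_perms d X" "p \<in> X" "d > 0"
  shows "(\<sigma> ^^ i) p = (\<sigma> ^^ j) p \<longleftrightarrow> i mod d = j mod d"
proof
  have *: "i mod d = j mod d" if "(\<sigma> ^^ i) p = (\<sigma> ^^ j) p" "i mod d \<le> j mod d" for i j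
  proof (rule ccontr)
    let ?i = "i mod d" and ?j = "j mod d"
    assume "?i \<noteq> ?j"
    with that(2) have ij: "?i < ?j" by simp
    have "(\<sigma> ^^ ?i) p = (\<sigma> ^^ ?j) p" using that(1) assms(1) by (simp add: regular_perms_funpow_mod)
    also have "\<dots> = (\<sigma> ^^ ?i) ((\<sigma> ^^ (?j - ?i)) p)"
      using ij by (metis add_diff_inverse_nat comp_apply funpow_add not_less_iff_gr_or_eq)
    finally have "(\<sigma> ^^ (?j - ?i)) p = p"
      using permutes_inj[OF funpow_permutes[OF regular_permsD(1)[OF assms(1)]]] by (metis injD)
    moreover have "?j - ?i < d" using assms(3) by (metis less_imp_diff_less mod_less_divisor)
    ultimately show False using regular_permsD(3)[OF assms(1,2), of "?j - ?i"] ij by simp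
  qed
  show "i mod d = j mod d" if "(\<sigma> ^^ i) p = (\<sigma> ^^ j) p"
    using *[of i j] *[of j i] that by (cases "i mod d \<le> j mod d") auto
  show "(\<sigma> ^^ i) p = (\<sigma> ^^ j) p" if "i mod d = j mod d"
    using that regular_perms_funpow_mod[OF assms(1)] by metis
qed

text \<open>A cycle of length cd splits into c cycles of length d.\<close>

lemma regular_perms_power:
  assumes "\<sigma> \<in> regular_perms (c * d) X" "c > 0"
  shows "\<sigma> ^^ c \<in> regular_perms d X"
proof -
  have "((\<sigma> ^^ c) ^^ j) p \<noteq> p" if "p \<in> X" "0 < j" "j < d" for p j
    using regular_permsD(3)[OF assms(1) that(1), of "c * j"] that assms(2)
    by (simp add: funpow_mult)
  moreover have "((\<sigma> ^^ c) ^^ d) p = p" for p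
    using regular_permsD(2)[OF assms(1)] by (simp add: funpow_mult)
  ultimately show ?thesis
    using funpow_permutes[OF regular_permsD(1)[OF assms(1)]] unfolding regular_perms_def by blast
qed

text \<open>Bijectivity is not asked for: periodicity gives surjectivity, and on a finite set
  injectivity follows.\<close>

lemma regular_permsI:
  assumes "finite X" "d > 0" "\<And>p. p \<notin> X \<Longrightarrow> \<sigma> p = p" "\<And>p. p \<in> X \<Longrightarrow> \<sigma> p \<in> X"
    and per: "\<And>p. p \<in> X \<Longrightarrow> (\<sigma> ^^ d) p = p"
    and free: "\<And>p j. p \<in> X \<Longrightarrow> 0 < j \<Longrightarrow> j < d \<Longrightarrow> (\<sigma> ^^ j) p \<noteq> p"
  shows "\<sigma> \<in> regular_perms d X"
proof -
  have pow: "(\<sigma> ^^ n) p \<in> X" if "p \<in> X" for n p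
    using that assms(4) by (induction n) auto
  have "X \<subseteq> \<sigma> ` X"
  proof
    fix p assume "p \<in> X"
    then have "(\<sigma> ^^ Suc (d - 1)) p = p" using per assms(2) by simp
    then have "p = \<sigma> ((\<sigma> ^^ (d - 1)) p)" by simp
    then show "p \<in> \<sigma> ` X" using pow[OF \<open>p \<in> X\<close>] by (rule image_eqI)
  qed
  then have "\<sigma> ` X = X" using assms(4) by auto
  then have "bij_betw \<sigma> X X"
    using assms(1) by (simp add: bij_betw_def eq_card_imp_inj_on)
  then have "\<sigma> permutes X" by (rule bij_imp_permutes) (rule assms(3))
  then show ?thesis using per free by (simp add: regular_perms_def)
qed

lemma finite_regular_perms: "finite X \<Longrightarrow> finite (regular_perms d X)"
  by (rule finite_subset[OF _ finite_permutations[of X]]) (auto simp: regular_perms_def)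

section \<open>Transversals of the cycles\<close>

definition orb_list :: "('q \<Rightarrow> 'q) \<Rightarrow> nat \<Rightarrow> 'q \<Rightarrow> 'q list" where
  "orb_list \<sigma> d p = map (\<lambda>i. (\<sigma> ^^ i) p) [0..<d]"

text \<open>Ordered choices of points from \<open>k\<close> different cycles. Distinctness of the
  concatenated cycles expresses that they are pairwise disjoint. For \<open>card X = d * k\<close>
  such a list meets every cycle once and serves as a frame that pins down a conjugating
  permutation.\<close>

definition transversals :: "nat \<Rightarrow> 'q set \<Rightarrow> ('q \<Rightarrow> 'q) \<Rightarrow> nat \<Rightarrow> 'q list set" where
  "transversals d X \<sigma> k =
     {xs. length xs = k \<and> set xs \<subseteq> X \<and> distinct (concat (map (orb_list \<sigma> d) xs))}"

lemma orb_list_props: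
  assumes "\<sigma> \<in> regular_perms d X" "p \<in> X" "d > 0"
  shows "distinct (orb_list \<sigma> d p)" "set (orb_list \<sigma> d p) = {(\<sigma> ^^ i) p |i. True}"
    "set (orb_list \<sigma> d p) \<subseteq> X"
proof -
  show "distinct (orb_list \<sigma> d p)"
    unfolding orb_list_def distinct_map
    using regular_perms_funpow_eq_iff[OF assms] by (auto intro!: inj_onI)
  show "set (orb_list \<sigma> d p) = {(\<sigma> ^^ i) p |i. True}"
  proof -
    have "(\<sigma> ^^ i) p \<in> set (orb_list \<sigma> d p)" for i
      using regular_perms_funpow_mod[OF assms(1), of i p] assms(3) unfolding orb_list_def
      by (metis (no_types, lifting) atLeastLessThan_iff image_eqI list.set_map mod_less_divisor
          set_upt zero_le)
    then show ?thesis by (auto simp: orb_list_def)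
  qed
  then show "set (orb_list \<sigma> d p) \<subseteq> X"
    using regular_perms_funpow_in[OF assms(1)] assms(2) by auto
qed

text \<open>The chosen cycles occupy \<open>d * k\<close> points, and each of the remaining points
  may be added: its cycle avoids their union, since that union is invariant.\<close>

lemma card_transversals_Suc:
  assumes "\<sigma> \<in> regular_perms d X" "finite X" "d > 0"
  shows "card (transversals d X \<sigma> (Suc k)) = card (transversals d X \<sigma> k) * (card X - d * k)"
proof -
  let ?U = "\<lambda>xs. set (concat (map (orb_list \<sigma> d) xs))"
  have orb_disj: "set (orb_list \<sigma> d p) \<inter> ?U xs = {} \<longleftrightarrow> p \<notin> ?U xs"
    if "p \<in> X" "set xs \<subseteq> X" for p xs
  proof
    show "p \<notin> ?U xs" if "set (orb_list \<sigma> d p) \<inter> ?U xs = {}"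
    proof -
      have "p \<in> set (orb_list \<sigma> d p)"
        unfolding orb_list_props(2)[OF assms(1) \<open>p \<in> X\<close> assms(3)] by (auto intro: exI[of _ 0])
      with that show ?thesis by blast
    qed
    show "set (orb_list \<sigma> d p) \<inter> ?U xs = {}" if p: "p \<notin> ?U xs"
    proof (rule ccontr)
      assume "set (orb_list \<sigma> d p) \<inter> ?U xs \<noteq> {}"
      then obtain x i j where x: "x \<in> set xs" "(\<sigma> ^^ i) p = (\<sigma> ^^ j) x"
        using orb_list_props(2)[OF assms(1) _ assms(3)] \<open>p \<in> X\<close> \<open>set xs \<subseteq> X\<close> by fastforce
      \<comment> \<open>As \<open>n + i\<close> is a multiple of \<open>d\<close>, the power
        \<open>\<sigma> ^^ n\<close> undoes \<open>\<sigma> ^^ i\<close>.\<close>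
      define n where "n = i * (d - 1)"
      have "n + i = i * d" using assms(3) by (simp add: n_def algebra_simps)
      then have "(n + i) mod d = 0 mod d" by simp
      then have "p = (\<sigma> ^^ (n + i)) p"
        using regular_perms_funpow_eq_iff[OF assms(1) \<open>p \<in> X\<close> assms(3), of "n + i" 0] by simp
      also have "\<dots> = (\<sigma> ^^ (n + j)) x" using x(2) by (simp add: funpow_add)
      finally show False
        using p x(1) orb_list_props(2)[OF assms(1) _ assms(3)] \<open>set xs \<subseteq> X\<close> by auto
    qed
  qed
  have card_U: "card (?U xs) = d * k \<and> ?U xs \<subseteq> X" if "xs \<in> transversals d X \<sigma> k" for xs
  proof -
    have "length (concat (map (orb_list \<sigma> d) xs)) = d * length xs"
      by (induction xs) (auto simp: orb_list_def)
    moreover have "?U xs \<subseteq> X"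
      using that orb_list_props(3)[OF assms(1) _ assms(3)] by (auto simp: transversals_def)
    ultimately show ?thesis
      using that by (simp add: transversals_def distinct_card del: set_concat)
  qed
  have fin: "finite (transversals d X \<sigma> k)"
    by (rule finite_subset[OF _ finite_lists_length_eq[OF assms(2), of k]])
      (auto simp: transversals_def)
  have "transversals d X \<sigma> (Suc k) =
      (\<lambda>(xs, p). p # xs) ` (SIGMA xs:transversals d X \<sigma> k. X - ?U xs)"
  proof -
    have mem: "p # xs \<in> transversals d X \<sigma> (Suc k) \<longleftrightarrow> xs \<in> transversals d X \<sigma> k \<and> p \<in> X - ?U xs"
      for p xs
    proof (cases "p \<in> X \<and> set xs \<subseteq> X")
      case True
      then show ?thesis
        using orb_disj[of p xs] orb_list_props(1)[OF assms(1) _ assms(3), of p]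
        by (auto simp: transversals_def simp del: set_concat)
    qed (auto simp: transversals_def)
    show ?thesis
    proof (intro Set.set_eqI iffI)
      fix ys assume ys: "ys \<in> transversals d X \<sigma> (Suc k)"
      then obtain p xs where "ys = p # xs"
        by (cases ys) (auto simp: transversals_def)
      with ys show "ys \<in> (\<lambda>(xs, p). p # xs) ` (SIGMA xs:transversals d X \<sigma> k. X - ?U xs)"
        using mem[of p xs] by (intro image_eqI[of _ _ "(xs, p)"]) auto
    qed (use mem in auto)
  qed
  moreover have "inj_on (\<lambda>(xs, p). p # xs) (SIGMA xs:transversals d X \<sigma> k. X - ?U xs)"
    by (auto simp: inj_on_def)
  ultimately have "card (transversals d X \<sigma> (Suc k)) =
      card (SIGMA xs:transversals d X \<sigma> k. X - ?U xs)"
    by (simp add: card_image)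
  also have "\<dots> = (\<Sum>xs\<in>transversals d X \<sigma> k. card (X - ?U xs))"
    using fin assms(2) by (intro card_SigmaI) auto
  also have "\<dots> = (\<Sum>xs\<in>transversals d X \<sigma> k. card X - d * k)"
    using card_U by (intro sum.cong HOL.refl) (metis card_Diff_subset finite_set)
  finally show ?thesis by simp
qed

lemma card_transversals:
  assumes "\<sigma> \<in> regular_perms d X" "finite X" "d > 0"
  shows "card (transversals d X \<sigma> k) = (\<Prod>j<k. card X - d * j)"
proof (induction k)
  case 0
  have "transversals d X \<sigma> 0 = {[]}" by (auto simp: transversals_def)
  then show ?case by simp
next
  case (Suc k)
  then show ?case by (simp add: card_transversals_Suc[OF assms])
qed

lemma transversal_covers:
  assumes "\<sigma> \<in> regular_perms d X" "finite X" "d > 0" "card X = d * k" "xs \<in> transversals d X \<sigma> k"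
  shows "set (concat (map (orb_list \<sigma> d) xs)) = X"
proof (rule card_subset_eq[OF assms(2)])
  show "set (concat (map (orb_list \<sigma> d) xs)) \<subseteq> X"
    using orb_list_props(3)[OF assms(1) _ assms(3)] assms(5) by (auto simp: transversals_def)
  have "length (concat (map (orb_list \<sigma> d) xs)) = d * length xs"
    by (induction xs) (auto simp: orb_list_def)
  then show "card (set (concat (map (orb_list \<sigma> d) xs))) = card X"
    using assms(4,5) by (simp add: transversals_def distinct_card del: set_concat)
qed

text \<open>If \<open>d\<close> did not divide \<open>card X\<close>, all factors in the number of
  transversals of length \<open>card X div d + 1\<close> would be positive, so that many disjoint
  cycles would exist, with more points than \<open>X\<close> has.\<close>

lemma dvd_card_if_regular_perms:
  assumes "\<sigma> \<in> regular_perms d X" "finite X" "d > 0"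
  shows "d dvd card X"
proof (rule ccontr)
  assume nd: "\<not> d dvd card X"
  let ?k = "Suc (card X div d)"
  have "d * j < card X" if "j < ?k" for j
  proof -
    have "d * j \<le> d * (card X div d)" using that by simp
    moreover have "d * (card X div d) \<le> card X" by simp
    moreover have "d * (card X div d) \<noteq> card X" using nd by (metis dvd_triv_left)
    ultimately show ?thesis by linarith
  qed
  then have "card (transversals d X \<sigma> ?k) > 0"
    unfolding card_transversals[OF assms] by (intro prod_pos) auto
  then obtain xs where xs: "xs \<in> transversals d X \<sigma> ?k"
    by (metis card_gt_0_iff ex_in_conv)
  have "length (concat (map (orb_list \<sigma> d) xs)) = d * length xs"
    by (induction xs) (auto simp: orb_list_def)
  moreover have "set (concat (map (orb_list \<sigma> d) xs)) \<subseteq> X"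
    using orb_list_props(3)[OF assms(1) _ assms(3)] xs by (auto simp: transversals_def)
  then have "card (set (concat (map (orb_list \<sigma> d) xs))) \<le> card X"
    using assms(2) by (rule card_mono[rotated])
  ultimately have "d * ?k \<le> card X"
    using xs by (simp add: transversals_def distinct_card del: set_concat)
  then show False using dividend_less_times_div[OF assms(3), of "card X"] by simp
qed


lemma funpow_intertwine: "(\<And>p. \<pi> (\<sigma> p) = \<sigma>' (\<pi> p)) \<Longrightarrow> \<pi> ((\<sigma> ^^ n) p) = (\<sigma>' ^^ n) (\<pi> p)"
  by (induction n) auto

text \<open>Coordinates on \<open>X\<close>: the number of the cycle and the position in it.
  Injectivity follows from surjectivity by counting.\<close>

lemma transversal_frame:
  assumes "\<sigma> \<in> regular_perms d X" "finite X" "d > 0" "card X = d * k" "xs \<in> transversals d X \<sigma> k"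
  shows "bij_betw (\<lambda>(j, i). (\<sigma> ^^ i) (xs ! j)) ({..<k} \<times> {..<d}) X"
proof -
  have len: "length xs = k" using assms(5) by (simp add: transversals_def)
  have "(\<lambda>(j, i). (\<sigma> ^^ i) (xs ! j)) ` ({..<k} \<times> {..<d}) = set (concat (map (orb_list \<sigma> d) xs))"
    using len by (force simp: orb_list_def in_set_conv_nth)
  also have "\<dots> = X" by (rule transversal_covers[OF assms])
  finally have im: "(\<lambda>(j, i). (\<sigma> ^^ i) (xs ! j)) ` ({..<k} \<times> {..<d}) = X" .
  moreover have "inj_on (\<lambda>(j, i). (\<sigma> ^^ i) (xs ! j)) ({..<k} \<times> {..<d})"
    by (rule eq_card_imp_inj_on) (use assms(4) in \<open>simp_all only: im, simp_all\<close>)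
  ultimately show ?thesis by (simp add: bij_betw_def)
qed

text \<open>The conjugating permutation keeps the coordinates and changes the frame. Prescribing
  both frames makes it unique, by the next lemma, which is what turns it into a count.\<close>

lemma conjugator_exists:
  assumes "\<sigma> \<in> regular_perms d X" "\<sigma>' \<in> regular_perms d X" "finite X" "d > 0" "card X = d * k"
    and xs: "xs \<in> transversals d X \<sigma> k" and ys: "ys \<in> transversals d X \<sigma>' k"
  obtains \<pi> where "\<pi> permutes X" "\<And>p. \<pi> (\<sigma> p) = \<sigma>' (\<pi> p)" "map \<pi> xs = ys"
proof -
  let ?I = "{..<k} \<times> {..<d}"
  define g where "g = (\<lambda>(j, i). (\<sigma> ^^ i) (xs ! j))"
  define h where "h = (\<lambda>(j, i). (\<sigma>' ^^ i) (ys ! j))"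
  have g: "bij_betw g ?I X" and h: "bij_betw h ?I X"
    unfolding g_def h_def
    using transversal_frame[OF assms(1,3-5) xs] transversal_frame[OF assms(2-5) ys] by auto
  define \<pi> where "\<pi> p = (if p \<in> X then h (inv_into ?I g p) else p)" for p
  have "bij_betw (h \<circ> inv_into ?I g) X X"
    using bij_betw_inv_into[OF g] h by (rule bij_betw_trans)
  then have "bij_betw \<pi> X X"
    by (rule bij_betw_cong[THEN iffD1, rotated]) (simp add: \<pi>_def)
  then have perm: "\<pi> permutes X" by (rule bij_imp_permutes) (simp add: \<pi>_def)
  have len: "length xs = k" "length ys = k" and "set xs \<subseteq> X"
    using xs ys by (simp_all add: transversals_def)
  then have xs_X: "xs ! j \<in> X" if "j < k" for j using that by (meson nth_mem subsetD)
  have \<pi>: "\<pi> ((\<sigma> ^^ i) (xs ! j)) = (\<sigma>' ^^ i) (ys ! j)" if "j < k" for i j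
  proof -
    have "(j, i mod d) \<in> ?I" using that assms(4) by simp
    then have "\<pi> (g (j, i mod d)) = h (j, i mod d)"
      using bij_betw_inv_into_left[OF g] bij_betw_apply[OF g] by (simp add: \<pi>_def)
    then show ?thesis
      by (simp add: g_def h_def regular_perms_funpow_mod[OF assms(1)] regular_perms_funpow_mod[OF assms(2)])
  qed
  show thesis
  proof (rule that[OF perm])
    show "map \<pi> xs = ys"
      using \<pi>[of _ 0] len by (intro nth_equalityI) auto
    fix p
    show "\<pi> (\<sigma> p) = \<sigma>' (\<pi> p)"
    proof (cases "p \<in> X")
      case True
      then obtain i j where "j < k" "p = (\<sigma> ^^ i) (xs ! j)"
        using bij_betw_imp_surj_on[OF g] by (force simp: g_def)
      then show ?thesis using \<pi>[of j i] \<pi>[of j "Suc i"] by simp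
    next
      case False
      then show ?thesis
        using permutes_not_in[OF perm] permutes_not_in[OF regular_permsD(1)[OF assms(1)]]
          permutes_not_in[OF regular_permsD(1)[OF assms(2)]] by simp
    qed
  qed
qed

text \<open>Every point is a power of \<open>\<sigma>\<close> applied to an entry of
  \<open>xs\<close>, and the intertwining relation carries the values along the cycle.\<close>

lemma conjugator_unique:
  assumes "\<sigma> \<in> regular_perms d X" "finite X" "d > 0" "card X = d * k" "xs \<in> transversals d X \<sigma> k"
    and "\<pi> permutes X" "\<And>p. \<pi> (\<sigma> p) = \<sigma>' (\<pi> p)" "\<pi>' permutes X" "\<And>p. \<pi>' (\<sigma> p) = \<sigma>' (\<pi>' p)"
    and "map \<pi> xs = map \<pi>' xs"
  shows "\<pi> = \<pi>'"
proof
  fix p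
  show "\<pi> p = \<pi>' p"
  proof (cases "p \<in> X")
    case True
    then obtain i j where "j < k" and p: "p = (\<sigma> ^^ i) (xs ! j)"
      using bij_betw_imp_surj_on[OF transversal_frame[OF assms(1-5)]] by force
    then have "\<pi> (xs ! j) = \<pi>' (xs ! j)"
      using assms(5,10) by (simp add: transversals_def map_eq_conv)
    then show ?thesis
      unfolding p using funpow_intertwine[of \<pi> \<sigma> \<sigma>', OF assms(7)]
        funpow_intertwine[of \<pi>' \<sigma> \<sigma>', OF assms(9)] by simp
  next
    case False
    then show ?thesis using assms(6,8) by (simp add: permutes_not_in)
  qed
qed

section \<open>Conjugation and the sizes of classes and root sets\<close>

lemma conj_intertwine: "\<pi> permutes X \<Longrightarrow> (\<pi> \<circ> \<sigma> \<circ> inv_into UNIV \<pi>) (\<pi> p) = \<pi> (\<sigma> p)"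
  by (simp add: permutes_inverses)

lemma conj_funpow: "\<pi> permutes X \<Longrightarrow> (\<pi> \<circ> \<sigma> \<circ> inv_into UNIV \<pi>) ^^ n = \<pi> \<circ> (\<sigma> ^^ n) \<circ> inv_into UNIV \<pi>"
  by (induction n) (auto simp: fun_eq_iff permutes_inverses)

lemma conj_regular_perms:
  assumes "\<pi> permutes X" "\<sigma> \<in> regular_perms d X"
  shows "\<pi> \<circ> \<sigma> \<circ> inv_into UNIV \<pi> \<in> regular_perms d X"
proof -
  have "\<pi> \<circ> \<sigma> \<circ> inv_into UNIV \<pi> permutes X"
    using assms regular_permsD(1) by (auto intro!: permutes_compose permutes_inv)
  moreover have "(\<pi> \<circ> (\<sigma> ^^ j) \<circ> inv_into UNIV \<pi>) p \<noteq> p" if "p \<in> X" "0 < j" "j < d" for p j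
  proof
    assume "(\<pi> \<circ> (\<sigma> ^^ j) \<circ> inv_into UNIV \<pi>) p = p"
    then have "(\<sigma> ^^ j) (inv_into UNIV \<pi> p) = inv_into UNIV \<pi> p"
      using permutes_inverses[OF assms(1)] by (metis comp_apply)
    moreover have "inv_into UNIV \<pi> p \<in> X" using that(1) permutes_inv[OF assms(1)] by (simp add: permutes_in_image)
    ultimately show False using regular_permsD(3)[OF assms(2)] that by blast
  qed
  moreover have "(\<pi> \<circ> (\<sigma> ^^ d) \<circ> inv_into UNIV \<pi>) p = p" for p
    using regular_permsD(2)[OF assms(2)] permutes_inverses[OF assms(1)] by simp
  ultimately show ?thesis unfolding regular_perms_def by (simp add: conj_funpow[OF assms(1)])
qed

lemma conj_transversal:
  assumes "\<pi> permutes X" "xs \<in> transversals d X \<sigma> k"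
  shows "map \<pi> xs \<in> transversals d X (\<pi> \<circ> \<sigma> \<circ> inv_into UNIV \<pi>) k"
proof -
  have "orb_list (\<pi> \<circ> \<sigma> \<circ> inv_into UNIV \<pi>) d (\<pi> p) = map \<pi> (orb_list \<sigma> d p)" for p
    by (simp add: orb_list_def conj_funpow[OF assms(1)] permutes_inverses[OF assms(1)])
  then have "concat (map (orb_list (\<pi> \<circ> \<sigma> \<circ> inv_into UNIV \<pi>) d) (map \<pi> xs)) = map \<pi> (concat (map (orb_list \<sigma> d) xs))"
    by (induction xs) auto
  moreover have "inj \<pi>" using assms(1) by (rule permutes_inj)
  moreover have "set (map \<pi> xs) \<subseteq> X"
    using assms permutes_in_image[OF assms(1)] by (auto simp: transversals_def)
  ultimately show ?thesis
    using assms(2) unfolding transversals_def by (auto simp: distinct_map intro: inj_on_subset)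
qed

text \<open>The model is \<open>k\<close> disjoint copies of the rotation of \<open>{..<d}\<close>,
  transported to \<open>X\<close>.\<close>

lemma regular_perms_nonempty:
  assumes "finite X" "d > 0" "card X = d * k"
  shows "regular_perms d X \<noteq> {}"
proof -
  let ?I = "{..<k} \<times> {..<d}"
  have "card ?I = card X" using assms(3) by simp
  then obtain h where h: "bij_betw h ?I X"
    using assms(1) by (metis finite_SigmaI finite_lessThan finite_same_card_bij)
  define \<sigma> where "\<sigma> p = (if p \<in> X then (case inv_into ?I h p of (j, i) \<Rightarrow> h (j, Suc i mod d)) else p)" for p
  have step: "\<sigma> (h (j, i)) = h (j, Suc i mod d)" if "j < k" "i < d" for i j
    using bij_betw_inv_into_left[OF h, of "(j, i)"] bij_betw_apply[OF h, of "(j, i)"] that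
    by (simp add: \<sigma>_def)
  have pow: "(\<sigma> ^^ n) (h (j, i)) = h (j, (i + n) mod d)" if "j < k" "i < d" for i j n
    using that by (induction n) (simp_all add: step mod_Suc_eq)
  have ex: "\<exists>i<d. \<exists>j<k. p = h (j, i)" if "p \<in> X" for p
    using that bij_betw_imp_surj_on[OF h] by force
  have hX: "h (j, i mod d) \<in> X" if "j < k" for i j
    using that assms(2) bij_betw_apply[OF h, of "(j, i mod d)"] by simp
  have "\<sigma> \<in> regular_perms d X"
  proof (rule regular_permsI[OF assms(1,2)])
    show "\<sigma> p = p" if "p \<notin> X" for p using that by (simp add: \<sigma>_def)
    fix p assume "p \<in> X"
    then obtain i j where ij: "i < d" "j < k" "p = h (j, i)" using ex by blast
    show "\<sigma> p \<in> X" "(\<sigma> ^^ d) p = p" using ij hX step by (simp_all add: pow)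
    show "(\<sigma> ^^ n) p \<noteq> p" if "0 < n" "n < d" for n
    proof
      assume "(\<sigma> ^^ n) p = p"
      then have "h (j, (i + n) mod d) = h (j, i)" using ij by (simp add: pow)
      then have "(i + n) mod d = i"
        using bij_betw_imp_inj_on[OF h] ij assms(2) by (auto dest!: inj_onD)
      then show False using that ij
        by (cases "i + n < d") (auto simp: mod_if split: if_splits)
    qed
  qed
  then show ?thesis by blast
qed

lemma prod_transversals: "(\<Prod>j<k. d * k - d * j) = d ^ k * (fact k :: nat)"
proof -
  have "(\<Prod>j<k. d * k - d * j) = (\<Prod>j<k. d * (k - j))"
    by (simp add: diff_mult_distrib2)
  also have "\<dots> = d ^ k * (\<Prod>j<k. k - j)"
    by (simp add: prod.distrib)
  also have "(\<Prod>j<k. k - j) = (\<Prod>i=1..k. i)"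
    by (rule prod.reindex_bij_witness[of _ "\<lambda>i. k - i" "\<lambda>j. k - j"]) auto
  finally show ?thesis by (simp add: fact_prod)
qed

text \<open>Orbit counting with explicit frames: for fixed \<open>\<sigma>\<close> and
  \<open>xs\<close>, a permutation of \<open>X\<close> corresponds to the conjugate of
  \<open>\<sigma>\<close> by it together with the image of \<open>xs\<close>. The factor
  \<open>d ^ k * fact k\<close> is the order of the centralizer.\<close>

lemma card_regular_perms:
  assumes "finite X" "d > 0" "card X = d * k"
  shows "card (regular_perms d X) * (d ^ k * fact k) = fact (d * k)"
proof -
  obtain \<sigma> where \<sigma>: "\<sigma> \<in> regular_perms d X" using regular_perms_nonempty[OF assms] by blast
  have cT: "card (transversals d X \<sigma> k) = d ^ k * fact k" if "\<sigma> \<in> regular_perms d X" for \<sigma>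
    using card_transversals[OF that assms(1,2)] by (simp add: assms(3) prod_transversals)
  have "card (transversals d X \<sigma> k) > 0" using cT[OF \<sigma>] assms(2) by simp
  then obtain xs where xs: "xs \<in> transversals d X \<sigma> k" by (metis card_gt_0_iff ex_in_conv)
  have "bij_betw (\<lambda>\<pi>. (\<pi> \<circ> \<sigma> \<circ> inv_into UNIV \<pi>, map \<pi> xs)) {\<pi>. \<pi> permutes X}
      (SIGMA \<tau>:regular_perms d X. transversals d X \<tau> k)"
    unfolding bij_betw_def
  proof (intro conjI inj_onI subset_antisym subsetI)
    fix \<pi> \<pi>' assume "\<pi> \<in> {\<pi>. \<pi> permutes X}" "\<pi>' \<in> {\<pi>. \<pi> permutes X}"
      and eq: "(\<pi> \<circ> \<sigma> \<circ> inv_into UNIV \<pi>, map \<pi> xs) = (\<pi>' \<circ> \<sigma> \<circ> inv_into UNIV \<pi>', map \<pi>' xs)"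
    then have \<pi>: "\<pi> permutes X" "\<pi>' permutes X" by auto
    show "\<pi> = \<pi>'"
    proof (rule conjugator_unique[OF \<sigma> assms xs \<pi>(1) _ \<pi>(2)])
      show "\<pi> (\<sigma> p) = (\<pi> \<circ> \<sigma> \<circ> inv_into UNIV \<pi>) (\<pi> p)" for p by (rule conj_intertwine[OF \<pi>(1), symmetric])
      show "\<pi>' (\<sigma> p) = (\<pi> \<circ> \<sigma> \<circ> inv_into UNIV \<pi>) (\<pi>' p)" for p
        using eq conj_intertwine[OF \<pi>(2), of \<sigma> p] by simp
      show "map \<pi> xs = map \<pi>' xs" using eq by simp
    qed
  next
    fix y assume "y \<in> (\<lambda>\<pi>. (\<pi> \<circ> \<sigma> \<circ> inv_into UNIV \<pi>, map \<pi> xs)) ` {\<pi>. \<pi> permutes X}"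
    then show "y \<in> (SIGMA \<tau>:regular_perms d X. transversals d X \<tau> k)"
      using conj_regular_perms[OF _ \<sigma>] conj_transversal[OF _ xs] by auto
  next
    fix y assume "y \<in> (SIGMA \<tau>:regular_perms d X. transversals d X \<tau> k)"
    then obtain \<tau> ys where y: "y = (\<tau>, ys)" "\<tau> \<in> regular_perms d X" "ys \<in> transversals d X \<tau> k" by blast
    obtain \<pi> where \<pi>: "\<pi> permutes X" "\<And>p. \<pi> (\<sigma> p) = \<tau> (\<pi> p)" "map \<pi> xs = ys"
      using conjugator_exists[OF \<sigma> y(2) assms xs y(3)] by blast
    have "\<pi> \<circ> \<sigma> \<circ> inv_into UNIV \<pi> = \<tau>" using \<pi>(1,2) by (auto simp: permutes_inverses)
    then show "y \<in> (\<lambda>\<pi>. (\<pi> \<circ> \<sigma> \<circ> inv_into UNIV \<pi>, map \<pi> xs)) ` {\<pi>. \<pi> permutes X}"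
      using \<pi> y(1) by auto
  qed
  then have "card {\<pi>. \<pi> permutes X} = card (SIGMA \<tau>:regular_perms d X. transversals d X \<tau> k)"
    by (rule bij_betw_same_card)
  also have "\<dots> = (\<Sum>\<tau>\<in>regular_perms d X. d ^ k * fact k)"
    using finite_regular_perms[OF assms(1)] finite_lists_length_eq[OF assms(1), of k] cT
    by (subst card_SigmaI) (auto simp: transversals_def intro: finite_subset[rotated])
  finally show ?thesis using card_permutations[OF HOL.refl assms(1)] assms(3) by simp
qed

text \<open>All elements of \<open>regular_perms d X\<close> are conjugate, and conjugation maps
  roots to roots; hence the fibers of the c-th power map have equal size.\<close>

lemma card_roots:
  assumes "finite X" "d > 0" "c > 0" "card X = d * k" "z \<in> regular_perms d X"
  shows "card (regular_perms (c * d) X) = card (regular_perms d X) * card {\<sigma> \<in> regular_perms (c * d) X. \<sigma> ^^ c = z}"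
proof -
  let ?R = "\<lambda>z. {\<sigma> \<in> regular_perms (c * d) X. \<sigma> ^^ c = z}"
  have le: "card (?R z) \<le> card (?R z')" if z: "z \<in> regular_perms d X" "z' \<in> regular_perms d X" for z z'
  proof -
    have "\<exists>xs. xs \<in> transversals d X z k" if "z \<in> regular_perms d X" for z
    proof -
      have "card (transversals d X z k) > 0"
        using card_transversals[OF that assms(1,2)] assms(2) by (simp add: assms(4) prod_transversals)
      then show ?thesis by (metis card_gt_0_iff ex_in_conv)
    qed
    then obtain xs ys where "xs \<in> transversals d X z k" "ys \<in> transversals d X z' k"
      using z by meson
    then obtain \<pi> where \<pi>: "\<pi> permutes X" "\<And>p. \<pi> (z p) = z' (\<pi> p)"
      using conjugator_exists[OF z assms(1,2,4)] by metis
    have zz: "\<pi> \<circ> z \<circ> inv_into UNIV \<pi> = z'" using \<pi> by (auto simp: permutes_inverses)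
    have "inj_on (\<lambda>\<sigma>. \<pi> \<circ> \<sigma> \<circ> inv_into UNIV \<pi>) (?R z)"
    proof (rule inj_onI)
      fix \<sigma> \<tau> assume "\<pi> \<circ> \<sigma> \<circ> inv_into UNIV \<pi> = \<pi> \<circ> \<tau> \<circ> inv_into UNIV \<pi>"
      then have "\<pi> (\<sigma> p) = \<pi> (\<tau> p)" for p
        using conj_intertwine[OF \<pi>(1), of \<sigma> p] conj_intertwine[OF \<pi>(1), of \<tau> p] by simp
      then show "\<sigma> = \<tau>" using permutes_inj[OF \<pi>(1)] by (auto simp: inj_def)
    qed
    moreover have "(\<lambda>\<sigma>. \<pi> \<circ> \<sigma> \<circ> inv_into UNIV \<pi>) ` ?R z \<subseteq> ?R z'"
      using conj_regular_perms[OF \<pi>(1)] zz by (auto simp: conj_funpow[OF \<pi>(1)])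
    ultimately show ?thesis
      using finite_regular_perms[OF assms(1), of "c * d"] by (intro card_inj_on_le) auto
  qed
  have "regular_perms (c * d) X = (\<Union>z\<in>regular_perms d X. ?R z)" using regular_perms_power[OF _ assms(3)] by auto
  then have "card (regular_perms (c * d) X) = card (\<Union>z\<in>regular_perms d X. ?R z)" by simp
  also have "\<dots> = (\<Sum>z\<in>regular_perms d X. card (?R z))"
    using finite_regular_perms[OF assms(1)] by (intro card_UN_disjoint) auto
  also have "\<dots> = (\<Sum>z'\<in>regular_perms d X. card (?R z))"
    using le assms(5) by (intro sum.cong HOL.refl le_antisym) auto
  finally show ?thesis by simp
qed

text \<open>These are the actions of the amalgam on \<open>X\<close> in which both cyclic factors
  act freely, given by the images of x and y. The relations x^(2m) = y^(3m) = 1 are part of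
  regularity.\<close>

definition acts :: "nat \<Rightarrow> 'q set \<Rightarrow> (('q \<Rightarrow> 'q) \<times> ('q \<Rightarrow> 'q)) set" where
  "acts m X = {(\<sigma>, \<tau>). \<sigma> \<in> regular_perms (2 * m) X \<and> \<tau> \<in> regular_perms (3 * m) X \<and> \<sigma> ^^ 2 = \<tau> ^^ 3}"

lemma finite_acts: "finite X \<Longrightarrow> finite (acts m X)"
  by (rule finite_subset[of _ "regular_perms (2 * m) X \<times> regular_perms (3 * m) X"]) (auto simp: acts_def finite_regular_perms)

lemma acts_empty:
  assumes "finite X" "m > 0" "\<not> 6 * m dvd card X"
  shows "acts m X = {}"
proof (rule ccontr)
  assume "acts m X \<noteq> {}"
  then have "2 * m dvd card X" "3 * m dvd card X"
    using dvd_card_if_regular_perms[OF _ assms(1)] assms(2) by (auto simp: acts_def)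
  then obtain a b where "card X = 2 * m * a" "card X = 3 * m * b" unfolding dvd_def by blast
  then have ab: "card X = 2 * m * a" "2 * a = 3 * b" using assms(2) by auto
  then have "3 dvd a" by presburger
  then show False using ab(1) assms(3) by (auto elim!: dvdE)
qed

text \<open>The cancellation in \<open>A = b * c / a\<close>, where \<open>a\<close>,
  \<open>b\<close>, \<open>c\<close> will be the class sizes for cycle lengths m, 2m, 3m. In use
  \<open>w = m ^ n\<close>, \<open>e = 8 ^ n\<close> and \<open>e' = 9 ^ n\<close>; the exponents 6
  - 3 - 2 leave one factor \<open>w\<close>.\<close>

lemma acts_arith:
  fixes A a b c e e' f2 f3 f6 g N w :: nat
  assumes aA: "a * A = b * c" and a: "a * (w ^ 6 * f6) = N" and b: "b * (e * w ^ 3 * f3) = N"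
    and c: "c * (e' * w ^ 2 * f2) = N" and f6: "g * (f3 * f2) = f6"
    and pos: "N > 0" "w > 0" "f2 > 0" "f3 > 0"
  shows "e * e' * A = N * (g * w)"
proof -
  have w6: "w ^ 6 = w ^ 3 * w ^ 2 * w" by (simp add: eval_nat_numeral)
  let ?K = "N * (f3 * f2 * (w ^ 3 * w ^ 2))"
  have "?K * (e * e' * A) = a * (w ^ 6 * f6) * (f3 * f2 * (w ^ 3 * w ^ 2)) * (e * e' * A)"
    by (simp only: a)
  also have "\<dots> = (a * A) * (w ^ 6 * f6) * (e * w ^ 3 * f3) * (e' * w ^ 2 * f2)"
    by (simp only: mult_ac)
  also have "\<dots> = (b * (e * w ^ 3 * f3)) * (c * (e' * w ^ 2 * f2)) * (w ^ 6 * f6)"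
    unfolding aA by (simp only: mult_ac)
  also have "\<dots> = N * N * (w ^ 3 * w ^ 2 * w * (g * (f3 * f2)))"
    by (simp only: b c f6 w6)
  also have "\<dots> = ?K * (N * (g * w))"
    by (simp only: mult_ac)
  finally show ?thesis using pos by simp
qed

text \<open>Sort the pairs by the common value z of square and cube, which is regular with cycle
  length m. By \<open>card_roots\<close> each z has b/a square roots and c/a cube roots, so there
  are bc/a pairs in all; multiplying by \<open>a * a\<close> avoids the quotients.\<close>

lemma card_acts:
  assumes "finite X" "m > 0" "card X = 6 * m * n"
  shows "72 ^ n * card (acts m X) = fact (6 * m * n) * (gamma_coeff n * m ^ n)"
proof -
  let ?R = "\<lambda>c z. {\<sigma> \<in> regular_perms (c * m) X. \<sigma> ^^ c = z}"
  have cX: "card X = m * (6 * n)" "card X = 2 * m * (3 * n)" "card X = 3 * m * (2 * n)"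
    using assms(3) by auto
  obtain z where z: "z \<in> regular_perms m X" using regular_perms_nonempty[OF assms(1,2) cX(1)] by blast
  define A a b c where "A = card (acts m X)" and "a = card (regular_perms m X)"
    and "b = card (regular_perms (2 * m) X)" and "c = card (regular_perms (3 * m) X)"
  have "acts m X = (\<Union>z\<in>regular_perms m X. ?R 2 z \<times> ?R 3 z)"
    using regular_perms_power[of _ 2 m X] by (fastforce simp: acts_def)
  then have "A = card (\<Union>z\<in>regular_perms m X. ?R 2 z \<times> ?R 3 z)" by (simp add: A_def)
  also have "\<dots> = (\<Sum>z\<in>regular_perms m X. card (?R 2 z) * card (?R 3 z))"
    using finite_regular_perms[OF assms(1)] by (subst card_UN_disjoint) (auto simp: card_cartesian_product)
  finally have "a * a * A = (\<Sum>z\<in>regular_perms m X. (a * card (?R 2 z)) * (a * card (?R 3 z)))"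
    by (simp add: sum_distrib_left mult_ac)
  also have "\<dots> = (\<Sum>z\<in>regular_perms m X. b * c)"
    unfolding a_def b_def c_def
    using card_roots[OF assms(1,2) _ cX(1), of 2] card_roots[OF assms(1,2) _ cX(1), of 3]
    by (intro sum.cong HOL.refl) simp
  finally have "a * a * A = a * (b * c)" by (simp add: a_def)
  then have "a * (a * A) = a * (b * c)" by (simp only: mult.assoc)
  moreover have "a > 0" using z finite_regular_perms[OF assms(1)] by (auto simp: a_def card_gt_0_iff)
  ultimately have aA: "a * A = b * c" by simp
  define N where "N = (fact (6 * m * n) :: nat)"
  have N0: "N > 0" by (simp add: N_def)
  have a: "a * (m ^ (6 * n) * fact (6 * n)) = N"
    using card_regular_perms[OF assms(1,2) cX(1)] by (simp add: a_def N_def mult_ac)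
  have b: "b * ((2 * m) ^ (3 * n) * fact (3 * n)) = N"
    using card_regular_perms[OF assms(1) _ cX(2)] assms(2) by (simp add: b_def N_def mult_ac)
  have c: "c * ((3 * m) ^ (2 * n) * fact (2 * n)) = N"
    using card_regular_perms[OF assms(1) _ cX(3)] assms(2) by (simp add: c_def N_def mult_ac)
  have pow3: "x ^ (3 * n) = (x ^ 3) ^ n" and pow2: "x ^ (2 * n) = (x ^ 2) ^ n"
    and pow6: "x ^ (6 * n) = (x ^ 6) ^ n" for x :: nat
    by (simp_all only: power_mult)
  have swap: "(m ^ i) ^ n = (m ^ n) ^ i" for i
    by (simp only: power_mult[symmetric] mult.commute)
  have "8 ^ n * 9 ^ n * A = N * (gamma_coeff n * m ^ n)"
  proof (rule acts_arith[OF aA])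
    show "a * ((m ^ n) ^ 6 * fact (6 * n)) = N"
      using a by (simp only: pow6 swap)
    show "b * (8 ^ n * (m ^ n) ^ 3 * fact (3 * n)) = N"
      using b by (simp add: pow3 power_mult_distrib swap)
    show "c * (9 ^ n * (m ^ n) ^ 2 * fact (2 * n)) = N"
      using c by (simp add: pow2 power_mult_distrib swap)
    show "gamma_coeff n * (fact (3 * n) * fact (2 * n)) = fact (6 * n)"
      by (rule gamma_coeff_mult)
  qed (use N0 assms(2) in auto)
  moreover have "(72 :: nat) ^ n = 8 ^ n * 9 ^ n"
    by (simp only: power_mult_distrib[symmetric]) simp
  ultimately show ?thesis by (simp only: A_def N_def)
qed

subsection \<open>Words and torsion in free groups\<close>

definition word_inv :: "'a word \<Rightarrow> 'a word" where
  "word_inv w = map (\<lambda>(a, e). (a, \<not> e)) (rev w)"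

abbreviation pcl :: "'a set \<Rightarrow> ('a word \<times> 'a word) set \<Rightarrow> 'a word \<Rightarrow> 'a word set" where
  "pcl S R w \<equiv> pres_rel S R `` {w}"

lemma words_simps [simp]:
  "[] \<in> words S" "u @ v \<in> words S \<longleftrightarrow> u \<in> words S \<and> v \<in> words S"
  "l # u \<in> words S \<longleftrightarrow> fst l \<in> S \<and> u \<in> words S" "words UNIV = UNIV"
  by (cases l; auto simp: words_def)+

lemma word_inv_simps [simp]:
  "word_inv [] = []" "word_inv (u @ v) = word_inv v @ word_inv u" "word_inv (l # u) = word_inv u @ [(fst l, \<not> snd l)]"
  by (simp_all add: word_inv_def case_prod_beta)

lemma word_inv_words [simp]: "word_inv u \<in> words S \<longleftrightarrow> u \<in> words S"
  by (induction u) auto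

lemma word_inv_word_inv [simp]: "word_inv (word_inv w) = w"
  by (induction w) auto

lemma pres_eq_word_inv_left: "w \<in> words S \<Longrightarrow> pres_eq S R (word_inv w @ w) []"
  unfolding word_inv_def by (rule pres_eq_inverse)

lemma pres_eq_word_inv_right: "w \<in> words S \<Longrightarrow> pres_eq S R (w @ word_inv w) []"
  using pres_eq_word_inv_left[of "word_inv w" S R] by simp

lemma pcl_eq_iff:
  assumes "u \<in> words S" "v \<in> words S"
  shows "pcl S R u = pcl S R v \<longleftrightarrow> pres_eq S R u v"
  using eq_equiv_class_iff[OF equiv_pres_rel assms, of R] by (simp add: pres_rel_def)

lemma carrier_presented: "carrier (presented_group S R) = pcl S R ` words S"
  by (auto simp: presented_group_def quotient_def)

lemma pcl_carrier [intro]: "w \<in> words S \<Longrightarrow> pcl S R w \<in> carrier (presented_group S R)"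
  by (simp add: carrier_presented)

lemma one_presented: "\<one>\<^bsub>presented_group S R\<^esub> = pcl S R []"
  by (simp add: presented_group_def)

lemma inv_presented:
  assumes "w \<in> words S"
  shows "inv\<^bsub>presented_group S R\<^esub> (pcl S R w) = pcl S R (word_inv w)"
proof (rule group.inv_equality[OF group_presented_group])
  show "pcl S R (word_inv w) \<otimes>\<^bsub>presented_group S R\<^esub> pcl S R w = \<one>\<^bsub>presented_group S R\<^esub>"
    using assms by (simp add: presented_group_mult one_presented pcl_eq_iff pres_eq_word_inv_left)
qed (use assms in auto)

lemma words_power [intro]: "w \<in> words S \<Longrightarrow> concat (replicate n w) \<in> words S"
  by (induction n) auto

lemma pow_presented:
  assumes "w \<in> words S"
  shows "pcl S R w [^]\<^bsub>presented_group S R\<^esub> n = pcl S R (concat (replicate n w))"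
proof -
  interpret group "presented_group S R" by (rule group_presented_group)
  show "pcl S R w [^]\<^bsub>presented_group S R\<^esub> n = pcl S R (concat (replicate n w))"
  proof (induction n)
    case 0
    then show ?case by (simp add: one_presented)
  next
    case (Suc n)
    have "pcl S R w [^]\<^bsub>presented_group S R\<^esub> Suc n
        = pcl S R w \<otimes>\<^bsub>presented_group S R\<^esub> pcl S R w [^]\<^bsub>presented_group S R\<^esub> n"
      using assms by (intro nat_pow_Suc2) auto
    then show ?case using assms Suc words_power[OF assms] by (simp add: presented_group_mult)
  qed
qed

section \<open>Words acting letter by letter\<close>

lemma foldl_closed:
  assumes "\<And>d a e. d \<in> D \<Longrightarrow> a \<in> S \<Longrightarrow> act d (a, e) \<in> D" "w \<in> words S" "d \<in> D"
  shows "foldl act d w \<in> D"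
  using assms(2,3) by (induction w arbitrary: d) (auto simp: assms(1))

text \<open>The universal property of a presentation in the form of a right action. It is used for
  reduced words, for evaluation in a group, for permutation actions and for the lifted action on
  pairs. The set \<open>D\<close> is there because the letters need to act invertibly on part of the
  type only.\<close>

lemma pres_eq_foldl:
  assumes "pres_eq S R u v"
    and closed: "\<And>d a e. d \<in> D \<Longrightarrow> a \<in> S \<Longrightarrow> act d (a, e) \<in> D"
    and cancel: "\<And>d a e. d \<in> D \<Longrightarrow> a \<in> S \<Longrightarrow> act (act d (a, e)) (a, \<not> e) = d"
    and rels: "\<And>u v d. (u, v) \<in> R \<Longrightarrow> d \<in> D \<Longrightarrow> foldl act d u = foldl act d v"
    and "d \<in> D"
  shows "foldl act d u = foldl act d v"
  using assms(1,5)
proof (induction arbitrary: d rule: pres_eq.induct)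
  case (append u u' v v')
  have "foldl act d u' \<in> D"
    using foldl_closed[where D = D and S = S and act = act, OF closed] pres_eq_words[OF append.hyps(1)] append.prems by blast
  with append show ?case by simp
qed (auto simp: cancel rels)

lemma foldl_word_inv:
  assumes closed: "\<And>d a e. d \<in> D \<Longrightarrow> a \<in> S \<Longrightarrow> act d (a, e) \<in> D"
    and cancel: "\<And>d a e. d \<in> D \<Longrightarrow> a \<in> S \<Longrightarrow> act (act d (a, e)) (a, \<not> e) = d"
    and "w \<in> words S" "d \<in> D"
  shows "foldl act (foldl act d w) (word_inv w) = d"
proof -
  have "pres_eq S {} (w @ word_inv w) []" using assms(3) by (rule pres_eq_word_inv_right)
  then have "foldl act d (w @ word_inv w) = foldl act d []"
    by (rule pres_eq_foldl[where D = D]) (use assms in auto)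
  then show ?thesis by simp
qed

section \<open>Reduced words and torsion\<close>

definition opp :: "'a \<times> bool \<Rightarrow> 'a \<times> bool" where
  "opp l = (fst l, \<not> snd l)"

lemma opp_opp [simp]: "opp (opp l) = l" by (simp add: opp_def)
lemma fst_opp [simp]: "fst (opp l) = fst l" by (simp add: opp_def)
lemma opp_eq_iff: "opp l = l' \<longleftrightarrow> l = opp l'" by (auto simp: opp_def)

abbreviation reduced :: "'a word \<Rightarrow> bool" where
  "reduced \<equiv> successively (\<lambda>l l'. l' \<noteq> opp l)"

text \<open>Right multiplication of a reduced word by a letter; the word is stored in reverse, with
  its last letter at the head.\<close>

definition push :: "'a word \<Rightarrow> 'a \<times> bool \<Rightarrow> 'a word" where
  "push d l = (if d \<noteq> [] \<and> hd d = opp l then tl d else l # d)"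

lemma reduced_push: "reduced d \<Longrightarrow> reduced (push d l)"
  by (cases d; cases "tl d") (auto simp: push_def opp_eq_iff)

lemma push_push: "reduced d \<Longrightarrow> push (push d l) (opp l) = d"
  by (cases d; cases "tl d") (auto simp: push_def opp_eq_iff)

lemma reduced_rev: "reduced (rev w) = reduced w"
proof -
  have "(\<lambda>l l'. l \<noteq> opp l') = (\<lambda>l l'. l' \<noteq> opp l)"
    by (intro ext) (metis opp_opp)
  then show ?thesis
    unfolding successively_rev by (rule arg_cong[of _ _ "\<lambda>P. successively P w"])
qed

lemma foldl_push: "reduced (rev w @ d) \<Longrightarrow> foldl push d w = rev w @ d"
proof (induction w arbitrary: d)
  case (Cons l w)
  then have "reduced (l # d)" by (simp add: successively_append_iff)
  then have "push d l = l # d" by (cases d) (auto simp: push_def)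
  then show ?case using Cons by simp
qed simp

text \<open>Van der Waerden's argument: words act on the reduced words.\<close>

lemma reduced_trivial:
  assumes "reduced w" "pres_eq S {} w []"
  shows "w = []"
proof -
  have "foldl push [] w = foldl push [] []"
    using assms(2)
  proof (rule pres_eq_foldl[where D = "{d. reduced d}"])
    show "push (push d (a, e)) (a, \<not> e) = d" if "d \<in> {d. reduced d}" for d a e
      using push_push[of d "(a, e)"] that by (simp add: opp_def)
  qed (auto intro: reduced_push)
  then show ?thesis using foldl_push[of w "[]"] assms(1) reduced_rev[of w] by simp
qed

text \<open>A cyclically reduced word has no cancellation where two copies meet. The claims on
  nonemptiness and the head carry the induction across the next joint.\<close>

lemma reduced_concat_replicate:
  assumes "reduced w" "w \<noteq> []" "hd w \<noteq> opp (last w)"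
  shows "reduced (concat (replicate n w)) \<and> (n > 0 \<longrightarrow> concat (replicate n w) \<noteq> [] \<and> hd (concat (replicate n w)) = hd w)"
proof (induction n)
  case (Suc n)
  then show ?case
    using assms by (cases "n = 0") (auto simp: successively_append_iff)
qed simp

lemma not_reducedE:
  assumes "\<not> reduced w"
  obtains u l v where "w = u @ l # opp l # v"
proof -
  have "\<exists>u l v. w = u @ l # opp l # v"
    using assms
  proof (induction w rule: induct_list012)
    case (3 l l' w)
    show ?case
    proof (cases "l' = opp l")
      case True
      then show ?thesis by (intro exI[of _ "[]"] exI[of _ l] exI[of _ w]) simp
    next
      case False
      then obtain u k v where "l' # w = u @ k # opp k # v" using 3 by auto
      then show ?thesis by (intro exI[of _ "l # u"] exI[of _ k] exI[of _ v]) simp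
    qed
  qed auto
  then show thesis using that by blast
qed

lemma (in group) pow_intertwine:
  assumes "c \<in> carrier G" "w \<in> carrier G" "u \<in> carrier G" "c \<otimes> u = u \<otimes> w"
  shows "c [^] (n :: nat) \<otimes> u = u \<otimes> w [^] n"
proof (induction n)
  case (Suc n)
  have "c [^] Suc n \<otimes> u = c [^] n \<otimes> u \<otimes> w"
    using assms by (simp add: m_assoc)
  then show ?case using assms Suc by (simp add: m_assoc)
qed (use assms in simp)

text \<open>By induction on the length: a cancelling pair, or a first letter inverse to the last,
  allows passing to a shorter conjugate. Otherwise the word is empty or cyclically reduced; in the
  second case its powers are reduced and nonempty, hence not trivial.\<close>

lemma free_torsion_free:
  assumes "w \<in> words S" "n > 0" "pres_eq S {} (concat (replicate n w)) []"
  shows "pres_eq S {} w []"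
  using assms(1,3)
proof (induction "length w" arbitrary: w rule: less_induct)
  case less
  \<comment> \<open>Covers both ways of shortening: \<open>u\<close> is empty when a pair is deleted
    and a single letter when the two ends cancel.\<close>
  have key: "pres_eq S {} w []" if w': "w' \<in> words S" "length w' < length w" "u \<in> words S"
    "pres_eq S {} w (u @ w' @ word_inv u)" for w' u
  proof -
    let ?F = "presented_group S {}" and ?c = "pcl S {}"
    interpret group ?F by (rule group_presented_group)
    have c: "?c w \<in> carrier ?F" "?c w' \<in> carrier ?F" "?c u \<in> carrier ?F"
      using less.prems(1) w'(1,3) by auto
    have "pres_eq S {} (w @ u) ((u @ w' @ word_inv u) @ u)"
      using w' by (intro pres_eq.append pres_eq.refl) auto
    moreover have "pres_eq S {} ((u @ w') @ word_inv u @ u) ((u @ w') @ [])"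
      using w' by (intro pres_eq.append pres_eq.refl pres_eq_word_inv_left) auto
    ultimately have "pres_eq S {} (w @ u) (u @ w')"
      by (auto intro: pres_eq.trans)
    then have "?c w \<otimes>\<^bsub>?F\<^esub> ?c u = ?c u \<otimes>\<^bsub>?F\<^esub> ?c w'"
      using less.prems(1) w' by (simp add: presented_group_mult pcl_eq_iff)
    then have "?c w [^]\<^bsub>?F\<^esub> n \<otimes>\<^bsub>?F\<^esub> ?c u = ?c u \<otimes>\<^bsub>?F\<^esub> ?c w' [^]\<^bsub>?F\<^esub> n"
      by (rule pow_intertwine[OF c])
    moreover have "?c w [^]\<^bsub>?F\<^esub> n = \<one>\<^bsub>?F\<^esub>"
      using less.prems pow_presented[OF less.prems(1), of "{}" n] words_power[OF less.prems(1), of n]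
      by (simp add: one_presented pcl_eq_iff)
    ultimately have "?c w' [^]\<^bsub>?F\<^esub> n = \<one>\<^bsub>?F\<^esub>"
      using c by simp
    then have "pres_eq S {} (concat (replicate n w')) []"
      using pow_presented[OF w'(1), of "{}" n] words_power[OF w'(1), of n] by (simp add: one_presented pcl_eq_iff)
    then have "pres_eq S {} w' []" using less.hyps w' by blast
    then have "pres_eq S {} (u @ w' @ word_inv u) (u @ [] @ word_inv u)"
      using w' by (intro pres_eq.append pres_eq.refl) auto
    then show ?thesis
      using w'(3,4) pres_eq_word_inv_right[of u S "{}"] by (auto intro: pres_eq.trans)
  qed
  show ?case
  proof (cases "reduced w")
    case False
    then obtain u l v where w: "w = u @ l # opp l # v" by (rule not_reducedE)
    have "pres_eq S {} (u @ [l, opp l] @ v) (u @ [] @ v)"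
      using less.prems(1) pres_eq.cancel[of "fst l" S "{}" "snd l"] w
      by (intro pres_eq.append pres_eq.refl) (auto simp: opp_def)
    then show ?thesis using key[of "u @ v" "[]"] less.prems(1) w by simp
  next
    case red: True
    show ?thesis
    proof (cases "w \<noteq> [] \<and> hd w \<noteq> opp (last w)")
      case True
      then have "reduced (concat (replicate n w))" "concat (replicate n w) \<noteq> []"
        using reduced_concat_replicate[OF red, of n] assms(2) by auto
      then show ?thesis using reduced_trivial less.prems(2) by blast
    next
      case False
      show ?thesis
      proof (cases w)
        case Nil
        then show ?thesis by (auto intro: pres_eq.refl)
      next
        case (Cons l v)
        \<comment> \<open>A letter differs from its inverse, so a word whose ends cancel has at
          least two letters.\<close>
        then have "v \<noteq> []" using False by (auto simp: opp_def prod_eq_iff)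
        then obtain v' l' where v: "v = v' @ [l']" by (metis rev_exhaust)
        then have "l' = opp l" using False Cons by (auto simp: opp_eq_iff)
        then have "w = [l] @ v' @ word_inv [l]" using Cons v by (simp add: opp_def)
        then show ?thesis
          using key[of v' "[l]"] pres_eq.refl[OF less.prems(1)] less.prems(1) Cons v by auto
      qed
    qed
  qed
qed

lemma is_free_group_torsion_free:
  fixes G :: "('a, 'b) monoid_scheme"
  assumes "is_free_group G" "g \<in> carrier G" "n > 0" "g [^]\<^bsub>G\<^esub> (n :: nat) = \<one>\<^bsub>G\<^esub>"
  shows "g = \<one>\<^bsub>G\<^esub>"
proof -
  obtain S :: "'a set" where G: "Group.group G" and S: "free_group S \<cong> G"
    using assms(1) by (auto simp: is_free_group_def)
  interpret F: group "free_group S" unfolding free_group_def by (rule group_presented_group)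
  obtain h where h: "h \<in> iso (free_group S) G" using S by (auto simp: is_iso_def)
  then interpret h: group_hom "free_group S" G h
    using G by (simp add: group_hom_def group_hom_axioms_def iso_def F.group_axioms)
  obtain w where w: "w \<in> words S" "g = h (pcl S {} w)"
    using h assms(2) by (force simp: iso_def bij_betw_def free_group_def carrier_presented)
  have wc: "pcl S {} w \<in> carrier (free_group S)" using w by (auto simp: free_group_def)
  have "h (pcl S {} w [^]\<^bsub>free_group S\<^esub> n) = h \<one>\<^bsub>free_group S\<^esub>"
    using assms(4) w wc by (simp add: h.hom_nat_pow)
  then have "pcl S {} w [^]\<^bsub>free_group S\<^esub> n = \<one>\<^bsub>free_group S\<^esub>"
    using h wc by (intro inj_onD[of h "carrier (free_group S)"]) (auto simp: iso_def bij_betw_def)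
  then have "pres_eq S {} (concat (replicate n w)) []"
    using pow_presented[OF w(1), of "{}" n] words_power[OF w(1), of n] by (simp add: free_group_def one_presented pcl_eq_iff)
  then have "pres_eq S {} w []" using free_torsion_free w(1) assms(3) by blast
  then have "pcl S {} w = \<one>\<^bsub>free_group S\<^esub>"
    using w(1) by (simp add: free_group_def one_presented pcl_eq_iff)
  then show ?thesis using w by simp
qed

text \<open>Words are evaluated by successive right multiplication, which is independent of the
  representative because there are no relations to check.\<close>

lemma free_group_hom_exists:
  assumes "group G" "\<And>a. a \<in> S \<Longrightarrow> h a \<in> carrier G"
  obtains \<psi> where "\<psi> \<in> hom (free_group S) G" "\<And>a. a \<in> S \<Longrightarrow> \<psi> (pcl S {} [(a, True)]) = h a"
proof -
  interpret group G by (rule assms(1))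
  define act where "act d l = d \<otimes>\<^bsub>G\<^esub> (if snd l then h (fst l) else inv\<^bsub>G\<^esub> h (fst l))" for d l
  have closed: "act d (a, e) \<in> carrier G" if "d \<in> carrier G" "a \<in> S" for d a e
    using that assms(2) by (simp add: act_def)
  have cancel: "act (act d (a, e)) (a, \<not> e) = d" if "d \<in> carrier G" "a \<in> S" for d a e
    using that assms(2) by (cases e) (simp_all add: act_def m_assoc)
  define ev where "ev w = foldl act \<one>\<^bsub>G\<^esub> w" for w
  have ev_closed: "ev w \<in> carrier G" if "w \<in> words S" for w
    unfolding ev_def
    by (rule foldl_closed[where D = "carrier G" and S = S and act = act, OF closed that]) auto
  \<comment> \<open>Folding from \<open>d\<close> is left translation by \<open>d\<close> of folding
    from 1; this makes evaluation multiplicative.\<close>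
  have mult: "foldl act d w = d \<otimes>\<^bsub>G\<^esub> ev w" if "w \<in> words S" "d \<in> carrier G" for d w
    using that(1)
  proof (induction w rule: rev_induct)
    case (snoc l w)
    have app: "foldl act c (w @ [l]) = foldl act c w \<otimes>\<^bsub>G\<^esub> (if snd l then h (fst l) else inv\<^bsub>G\<^esub> h (fst l))" for c
      by (simp add: act_def)
    from snoc have "w \<in> words S" "fst l \<in> S" "foldl act d w = d \<otimes>\<^bsub>G\<^esub> ev w" by auto
    then show ?case
      using that(2) ev_closed[of w] assms(2) unfolding ev_def app by (simp add: m_assoc)
  qed (use that in \<open>simp add: ev_def\<close>)
  define \<psi> where "\<psi> C = ev (SOME w. w \<in> words S \<and> C = pcl S {} w)" for C
  have \<psi>: "\<psi> (pcl S {} w) = ev w" if w: "w \<in> words S" for w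
  proof -
    define v where "v = (SOME v. v \<in> words S \<and> pcl S {} w = pcl S {} v)"
    have "\<exists>v. v \<in> words S \<and> pcl S {} w = pcl S {} v" using w by blast
    from someI_ex[OF this] have v: "v \<in> words S" "pcl S {} w = pcl S {} v"
      unfolding v_def by blast+
    then have "pres_eq S {} v w"
      using pcl_eq_iff[OF v(1) w, of "{}"] by simp
    then have "ev v = ev w"
      unfolding ev_def by (rule pres_eq_foldl[where D = "carrier G"]) (auto simp: closed cancel)
    then show ?thesis by (simp add: \<psi>_def v_def)
  qed
  show thesis
  proof
    show "\<psi> \<in> hom (free_group S) G"
    proof (rule homI)
      fix A B assume "A \<in> carrier (free_group S)" "B \<in> carrier (free_group S)"
      then obtain u v where "u \<in> words S" "A = pcl S {} u" "v \<in> words S" "B = pcl S {} v"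
        by (auto simp: free_group_def carrier_presented)
      moreover from this have "ev (u @ v) = ev u \<otimes>\<^bsub>G\<^esub> ev v"
        using mult[of v "ev u"] ev_closed[of u] by (simp only: ev_def foldl_append)
      ultimately show "\<psi> (A \<otimes>\<^bsub>free_group S\<^esub> B) = \<psi> A \<otimes>\<^bsub>G\<^esub> \<psi> B"
        by (simp add: free_group_def presented_group_mult \<psi>)
    qed (auto simp: free_group_def carrier_presented \<psi> ev_closed)
    show "\<psi> (pcl S {} [(a, True)]) = h a" if "a \<in> S" for a
      using that assms(2) by (simp add: \<psi> ev_def act_def)
  qed
qed

subsection \<open>Permutation actions and their orbits\<close>

text \<open>Inverse letters act through the powers \<open>2 * m - 1\<close> and
  \<open>3 * m - 1\<close>, which are the inverse permutations as soon as the cycle lengths are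
  right. Words are read from left to right, as a right action.\<close>

fun move :: "nat \<Rightarrow> ('q \<Rightarrow> 'q) \<times> ('q \<Rightarrow> 'q) \<Rightarrow> 'q \<Rightarrow> generator \<times> bool \<Rightarrow> 'q" where
  "move m (\<sigma>, \<tau>) p (gen_x, e) = (\<sigma> ^^ (if e then 1 else 2 * m - 1)) p"
| "move m (\<sigma>, \<tau>) p (gen_y, e) = (\<tau> ^^ (if e then 1 else 3 * m - 1)) p"

abbreviation run :: "nat \<Rightarrow> ('q \<Rightarrow> 'q) \<times> ('q \<Rightarrow> 'q) \<Rightarrow> 'q \<Rightarrow> generator word \<Rightarrow> 'q" where
  "run m \<rho> p w \<equiv> foldl (move m \<rho>) p w"

abbreviation gens :: "generator set" where "gens \<equiv> {gen_x, gen_y}"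

definition rels :: "nat \<Rightarrow> (generator word \<times> generator word) set" where
  "rels m = {(pow_word gen_x (2 * m), []), (pow_word gen_y (3 * m), []), (pow_word gen_x 2, pow_word gen_y 3)}"

abbreviation cl :: "nat \<Rightarrow> generator word \<Rightarrow> generator word set" where
  "cl m \<equiv> pcl gens (rels m)"

abbreviation eqv :: "nat \<Rightarrow> generator word \<Rightarrow> generator word \<Rightarrow> bool" where
  "eqv m \<equiv> pres_eq gens (rels m)"

lemma Gamma3_eq: "Gamma3 m = presented_group gens (rels m)"
  by (simp add: Gamma3_def rels_def)

lemma gens_UNIV: "gens = UNIV"
  by (auto intro: generator.exhaust)

lemma words_gens [simp]: "w \<in> words gens"
  by (simp add: gens_UNIV)

lemma cl_eq_iff: "cl m u = cl m v \<longleftrightarrow> eqv m u v"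
  by (rule pcl_eq_iff) simp_all

lemma group_Gamma3: "group (Gamma3 m)"
  unfolding Gamma3_eq by (rule group_presented_group)

lemma Gamma3_simps:
  "carrier (Gamma3 m) = range (cl m)" "cl m u \<otimes>\<^bsub>Gamma3 m\<^esub> cl m v = cl m (u @ v)"
  "\<one>\<^bsub>Gamma3 m\<^esub> = cl m []" "inv\<^bsub>Gamma3 m\<^esub> (cl m u) = cl m (word_inv u)"
  "cl m u [^]\<^bsub>Gamma3 m\<^esub> n = cl m (concat (replicate n u))"
  unfolding Gamma3_eq
  by (simp_all add: presented_group_mult one_presented inv_presented pow_presented carrier_presented)
    (simp add: gens_UNIV)

lemma actsD:
  assumes "(\<sigma>, \<tau>) \<in> acts m X"
  shows "\<sigma> \<in> regular_perms (2 * m) X" "\<tau> \<in> regular_perms (3 * m) X" "\<sigma> (\<sigma> p) = \<tau> (\<tau> (\<tau> p))"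
proof -
  show "\<sigma> \<in> regular_perms (2 * m) X" "\<tau> \<in> regular_perms (3 * m) X" using assms by (auto simp: acts_def)
  have "(\<sigma> ^^ 2) p = (\<tau> ^^ 3) p" using assms by (auto simp: acts_def)
  then show "\<sigma> (\<sigma> p) = \<tau> (\<tau> (\<tau> p))" by (simp add: eval_nat_numeral)
qed

lemma regular_perms_in: "\<sigma> \<in> regular_perms d X \<Longrightarrow> \<sigma> p \<in> X \<longleftrightarrow> p \<in> X"
  by (rule permutes_in_image[OF regular_permsD(1)])

lemma move_in: "\<rho> \<in> acts m X \<Longrightarrow> move m \<rho> p l \<in> X \<longleftrightarrow> p \<in> X"
  using actsD(1,2)[of "fst \<rho>" "snd \<rho>" m X]
  by (cases \<rho>; cases l; cases "fst l") (auto simp: regular_perms_funpow_in regular_perms_in)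

lemma run_in: "\<rho> \<in> acts m X \<Longrightarrow> run m \<rho> p w \<in> X \<longleftrightarrow> p \<in> X"
  by (induction w arbitrary: p) (auto simp: move_in)

lemma move_cancel:
  assumes "\<rho> \<in> acts m X" "m > 0"
  shows "move m \<rho> (move m \<rho> p (a, e)) (a, \<not> e) = p"
proof -
  have *: "(f ^^ (d - 1)) (f p) = p \<and> f ((f ^^ (d - 1)) p) = p" if "f \<in> regular_perms d X" "d > 0" for f d
  proof -
    have "(f ^^ Suc (d - 1)) p = p" using regular_permsD(2)[OF that(1)] that(2) by simp
    then show ?thesis by (simp add: funpow_swap1)
  qed
  obtain \<sigma> \<tau> where \<rho>: "\<rho> = (\<sigma>, \<tau>)" by force
  show ?thesis
    using *[of \<sigma> "2 * m"] *[of \<tau> "3 * m"] actsD[of \<sigma> \<tau> m X] assms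
    by (cases a; cases e) (simp_all add: \<rho>)
qed

lemma run_pow:
  "run m (\<sigma>, \<tau>) p (pow_word gen_x n) = (\<sigma> ^^ n) p"
  "run m (\<sigma>, \<tau>) p (pow_word gen_y n) = (\<tau> ^^ n) p"
  by (induction n arbitrary: p) (simp_all add: funpow_swap1)

lemma run_eqv:
  assumes "\<rho> \<in> acts m X" "m > 0" "eqv m u v"
  shows "run m \<rho> p u = run m \<rho> p v"
  using assms(3)
proof (rule pres_eq_foldl[where D = UNIV])
  obtain \<sigma> \<tau> where \<rho>: "\<rho> = (\<sigma>, \<tau>)" by force
  show "run m \<rho> d u = run m \<rho> d v" if "(u, v) \<in> rels m" for u v d
  proof -
    have "u = pow_word gen_x (2 * m) \<and> v = [] \<or> u = pow_word gen_y (3 * m) \<and> v = [] \<or>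
        u = pow_word gen_x 2 \<and> v = pow_word gen_y 3"
      using that by (simp add: rels_def)
    moreover have "(\<sigma> ^^ (2 * m)) d = d" "(\<tau> ^^ (3 * m)) d = d" "\<sigma> ^^ 2 = \<tau> ^^ 3"
      using assms(1) regular_permsD(2)[of \<sigma> "2 * m" X] regular_permsD(2)[of \<tau> "3 * m" X] by (simp_all add: \<rho> acts_def)
    ultimately show ?thesis
      unfolding \<rho> by (elim disjE conjE) (simp_all only: run_pow foldl_Nil)
  qed
qed (use move_cancel[OF assms(1,2)] in auto)

lemma run_word_inv:
  assumes "\<rho> \<in> acts m X" "m > 0"
  shows "run m \<rho> (run m \<rho> p w) (word_inv w) = p"
  by (rule foldl_word_inv[where D = UNIV and S = gens]) (use move_cancel[OF assms] in auto)

section \<open>Restricting and gluing actions\<close>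

definition trans_acts :: "nat \<Rightarrow> 'q set \<Rightarrow> 'q \<Rightarrow> (('q \<Rightarrow> 'q) \<times> ('q \<Rightarrow> 'q)) set" where
  "trans_acts m X b = {\<rho> \<in> acts m X. range (run m \<rho> b) = X}"

text \<open>With \<open>g = id\<close> this restricts \<open>f\<close> to an invariant set and keeps
  the convention of being the identity outside; with a second action as \<open>g\<close> it glues
  the two.\<close>

definition restr :: "'q set \<Rightarrow> ('q \<Rightarrow> 'q) \<Rightarrow> ('q \<Rightarrow> 'q) \<Rightarrow> 'q \<Rightarrow> 'q" where
  "restr K f g p = (if p \<in> K then f p else g p)"

lemma restr_funpow:
  assumes "f ` K \<subseteq> K" "g ` (- K) \<subseteq> - K"
  shows "(restr K f g ^^ n) p = (if p \<in> K then (f ^^ n) p else (g ^^ n) p)"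
proof -
  have "p \<in> K \<Longrightarrow> (f ^^ n) p \<in> K" "p \<notin> K \<Longrightarrow> (g ^^ n) p \<notin> K" for n
    using assms by (induction n) auto
  then show ?thesis by (induction n) (auto simp: restr_def)
qed

lemma restr_regular_perms:
  assumes "\<sigma> \<in> regular_perms d X" "K \<subseteq> X" "\<sigma> ` K \<subseteq> K" "finite K"
  shows "restr K \<sigma> id \<in> regular_perms d K"
proof -
  note pow = restr_funpow[of \<sigma> K id, OF assms(3)]
  have "\<sigma> ` K = K"
    using assms(3,4) permutes_inj[OF regular_permsD(1)[OF assms(1)]] by (meson endo_inj_surj inj_on_subset subset_UNIV)
  then have "bij_betw (restr K \<sigma> id) K K"
    using permutes_inj[OF regular_permsD(1)[OF assms(1)]]
    by (auto simp: bij_betw_def restr_def inj_on_def inj_def image_def)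
  then have "restr K \<sigma> id permutes K" by (rule bij_imp_permutes) (simp add: restr_def)
  then show ?thesis
    using assms(2) regular_permsD(2,3)[OF assms(1)] unfolding regular_perms_def by (auto simp: pow)
qed

text \<open>As the supports are disjoint, gluing is composition.\<close>

lemma glue_regular_perms:
  assumes "\<sigma> \<in> regular_perms d K" "\<tau> \<in> regular_perms d L" "K \<inter> L = {}"
  shows "restr K \<sigma> \<tau> \<in> regular_perms d (K \<union> L)"
proof -
  have \<sigma>K: "\<sigma> ` K \<subseteq> K" using regular_perms_funpow_in[OF assms(1), of 1] by auto
  have \<tau>K: "\<tau> ` (- K) \<subseteq> - K"
  proof clarify
    fix p assume p: "p \<notin> K" "\<tau> p \<in> K"
    then have "\<tau> p \<notin> L" using assms(3) by blast
    then have "p \<notin> L" using regular_perms_funpow_in[OF assms(2), of 1] by auto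
    then have "\<tau> p = p" using permutes_not_in[OF regular_permsD(1)[OF assms(2)]] by blast
    with p show False by simp
  qed
  have "\<tau> p = p" if "p \<in> K" for p
    using that assms(3) permutes_not_in[OF regular_permsD(1)[OF assms(2)]] by blast
  then have "restr K \<sigma> \<tau> = \<sigma> \<circ> \<tau>"
    using \<tau>K permutes_not_in[OF regular_permsD(1)[OF assms(1)]] by (auto simp: restr_def fun_eq_iff)
  moreover have "\<sigma> \<circ> \<tau> permutes K \<union> L"
    using regular_permsD(1)[OF assms(1)] regular_permsD(1)[OF assms(2)]
    by (intro permutes_compose) (auto intro: permutes_subset)
  ultimately have "restr K \<sigma> \<tau> permutes K \<union> L" by simp
  then show ?thesis
    using regular_permsD(2,3)[OF assms(1)] regular_permsD(2,3)[OF assms(2)] assms(3)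
    unfolding regular_perms_def by (auto simp: restr_funpow[OF \<sigma>K \<tau>K])
qed

definition restr2 where
  "restr2 K \<rho> \<rho>' = (restr K (fst \<rho>) (fst \<rho>'), restr K (snd \<rho>) (snd \<rho>'))"

lemma restr_acts:
  assumes "\<rho> \<in> acts m X" "K \<subseteq> X" "fst \<rho> ` K \<subseteq> K" "snd \<rho> ` K \<subseteq> K" "finite K"
  shows "restr2 K \<rho> (id, id) \<in> acts m K"
proof -
  obtain \<sigma> \<tau> where \<rho>: "\<rho> = (\<sigma>, \<tau>)" by force
  have "restr K \<sigma> id ^^ 2 = restr K \<tau> id ^^ 3"
    using assms(1,3,4) unfolding \<rho> acts_def
    by (auto simp: fun_eq_iff restr_funpow)
  then show ?thesis
    using assms restr_regular_perms[OF actsD(1), of \<sigma> \<tau> m X K] restr_regular_perms[OF actsD(2), of \<sigma> \<tau> m X K]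
    by (simp add: \<rho> restr2_def acts_def)
qed

lemma acts_closed:
  assumes "\<rho> \<in> acts m K"
  shows "fst \<rho> ` K \<subseteq> K" "snd \<rho> ` K \<subseteq> K"
  using assms regular_perms_funpow_in[of "fst \<rho>" "2 * m" K 1] regular_perms_funpow_in[of "snd \<rho>" "3 * m" K 1]
  by (auto simp: acts_def)

lemma acts_outside:
  assumes "\<rho> \<in> acts m K" "p \<notin> K"
  shows "fst \<rho> p = p" "snd \<rho> p = p"
  using assms permutes_not_in[OF regular_permsD(1)] by (auto simp: acts_def)

lemma glue_acts:
  assumes "\<rho> \<in> acts m K" "\<rho>' \<in> acts m L" "K \<inter> L = {}"
  shows "restr2 K \<rho> \<rho>' \<in> acts m (K \<union> L)"
proof -
  obtain \<sigma> \<tau> \<sigma>' \<tau>' where \<rho>: "\<rho> = (\<sigma>, \<tau>)" "\<rho>' = (\<sigma>', \<tau>')" by force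
  have cl: "f ` K \<subseteq> K" if "f \<in> regular_perms d K" for f d
    using regular_perms_funpow_in[OF that, of 1] by auto
  have cl': "f ` (- K) \<subseteq> - K" if f: "f \<in> regular_perms d L" for f d
  proof clarify
    fix p assume p: "p \<notin> K" "f p \<in> K"
    then have "f p \<notin> L" using assms(3) by blast
    then have "p \<notin> L" using regular_perms_funpow_in[OF f, of 1] by auto
    then have "f p = p" using permutes_not_in[OF regular_permsD(1)[OF f]] by blast
    with p show False by simp
  qed
  have "\<sigma> \<in> regular_perms (2 * m) K" "\<tau> \<in> regular_perms (3 * m) K" "\<sigma>' \<in> regular_perms (2 * m) L" "\<tau>' \<in> regular_perms (3 * m) L"
    "\<sigma> ^^ 2 = \<tau> ^^ 3" "\<sigma>' ^^ 2 = \<tau>' ^^ 3"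
    using assms(1,2) by (auto simp: \<rho> acts_def)
  moreover from this have "restr K \<sigma> \<sigma>' ^^ 2 = restr K \<tau> \<tau>' ^^ 3"
    using cl cl' by (simp add: fun_eq_iff restr_funpow)
  ultimately show ?thesis
    using glue_regular_perms[OF _ _ assms(3)] by (simp add: \<rho> restr2_def acts_def)
qed

lemma run_cong:
  assumes "\<And>p. p \<in> K \<Longrightarrow> fst \<rho> p = fst \<rho>' p \<and> snd \<rho> p = snd \<rho>' p"
    and "fst \<rho> ` K \<subseteq> K" "snd \<rho> ` K \<subseteq> K" "p \<in> K"
  shows "run m \<rho> p w = run m \<rho>' p w"
proof -
  obtain \<sigma> \<tau> \<sigma>' \<tau>' where \<rho>: "\<rho> = (\<sigma>, \<tau>)" "\<rho>' = (\<sigma>', \<tau>')" by force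
  have pow: "(\<sigma> ^^ n) p = (\<sigma>' ^^ n) p \<and> (\<sigma>' ^^ n) p \<in> K" "(\<tau> ^^ n) p = (\<tau>' ^^ n) p \<and> (\<tau>' ^^ n) p \<in> K"
    if "p \<in> K" for n p
    using that assms(1-3) by (induction n) (auto simp: \<rho>)
  have "move m \<rho> p l = move m \<rho>' p l \<and> move m \<rho>' p l \<in> K" if "p \<in> K" for p l
    using pow[OF that] pow[OF that, of 1] unfolding \<rho>
    by (cases "(m, (\<sigma>, \<tau>), p, l)" rule: move.cases) auto
  then show ?thesis
    using assms(4) by (induction w arbitrary: p) auto
qed

text \<open>Words can be undone, so the complement of an orbit is invariant as well.\<close>

lemma orbit_closed:
  assumes "\<rho> \<in> acts m X" "m > 0" "K = range (run m \<rho> b)"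
  shows "fst \<rho> ` K \<subseteq> K" "snd \<rho> ` K \<subseteq> K" "fst \<rho> ` (- K) \<subseteq> - K" "snd \<rho> ` (- K) \<subseteq> - K"
proof -
  obtain \<sigma> \<tau> where \<rho>: "\<rho> = (\<sigma>, \<tau>)" by force
  have K: "run m \<rho> p u \<in> K \<longleftrightarrow> p \<in> K" for p u
  proof
    assume "p \<in> K"
    then obtain w where "p = run m \<rho> b w" using assms(3) by auto
    then have "run m \<rho> p u = run m \<rho> b (w @ u)" by simp
    then show "run m \<rho> p u \<in> K" unfolding assms(3) by (rule range_eqI)
  next
    assume "run m \<rho> p u \<in> K"
    then obtain w where "run m \<rho> p u = run m \<rho> b w" using assms(3) by auto
    then have "p = run m \<rho> b (w @ word_inv u)" using run_word_inv[OF assms(1,2), of p u] by simp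
    then show "p \<in> K" unfolding assms(3) by (rule range_eqI)
  qed
  show "fst \<rho> ` K \<subseteq> K" "fst \<rho> ` (- K) \<subseteq> - K"
    using K[of _ "[(gen_x, True)]"] by (auto simp: \<rho>)
  show "snd \<rho> ` K \<subseteq> K" "snd \<rho> ` (- K) \<subseteq> - K"
    using K[of _ "[(gen_y, True)]"] by (auto simp: \<rho>)
qed

lemma card_acts_orbit:
  assumes X: "finite X" "m > 0" and K: "K \<subseteq> X" "b \<in> K"
  shows "card {\<rho> \<in> acts m X. range (run m \<rho> b) = K} = card (trans_acts m K b) * card (acts m (X - K))"
proof -
  have fin: "finite K" "finite (X - K)" using X K finite_subset by auto
  have "bij_betw (\<lambda>\<rho>. (restr2 K \<rho> (id, id), restr2 (X - K) \<rho> (id, id)))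
      {\<rho> \<in> acts m X. range (run m \<rho> b) = K} (trans_acts m K b \<times> acts m (X - K))"
  proof (rule bij_betw_byWitness[where f' = "\<lambda>(\<rho>, \<rho>'). restr2 K \<rho> \<rho>'"])
    show "\<forall>\<rho>\<in>{\<rho> \<in> acts m X. range (run m \<rho> b) = K}.
        (case (restr2 K \<rho> (id, id), restr2 (X - K) \<rho> (id, id)) of (\<rho>, \<rho>') \<Rightarrow> restr2 K \<rho> \<rho>') = \<rho>"
    proof
      fix \<rho> assume "\<rho> \<in> {\<rho> \<in> acts m X. range (run m \<rho> b) = K}"
      then have "\<rho> \<in> acts m X" by simp
      from acts_outside[OF this] K
      show "(case (restr2 K \<rho> (id, id), restr2 (X - K) \<rho> (id, id)) of (\<rho>, \<rho>') \<Rightarrow> restr2 K \<rho> \<rho>') = \<rho>"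
        by (auto simp: restr2_def restr_def fun_eq_iff prod_eq_iff)
    qed
    show "\<forall>a\<in>trans_acts m K b \<times> acts m (X - K).
       (restr2 K (case a of (\<rho>, \<rho>') \<Rightarrow> restr2 K \<rho> \<rho>') (id, id),
        restr2 (X - K) (case a of (\<rho>, \<rho>') \<Rightarrow> restr2 K \<rho> \<rho>') (id, id)) = a"
    proof
      fix a assume "a \<in> trans_acts m K b \<times> acts m (X - K)"
      then have "fst a \<in> acts m K" "snd a \<in> acts m (X - K)" by (auto simp: trans_acts_def)
      from acts_outside[OF this(1)] acts_outside[OF this(2)]
      show "(restr2 K (case a of (\<rho>, \<rho>') \<Rightarrow> restr2 K \<rho> \<rho>') (id, id),
        restr2 (X - K) (case a of (\<rho>, \<rho>') \<Rightarrow> restr2 K \<rho> \<rho>') (id, id)) = a"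
        by (auto simp: restr2_def restr_def fun_eq_iff prod_eq_iff case_prod_beta)
    qed
    show "(\<lambda>\<rho>. (restr2 K \<rho> (id, id), restr2 (X - K) \<rho> (id, id))) ` {\<rho> \<in> acts m X. range (run m \<rho> b) = K}
        \<subseteq> trans_acts m K b \<times> acts m (X - K)"
    proof (rule image_subsetI)
      fix \<rho> assume "\<rho> \<in> {\<rho> \<in> acts m X. range (run m \<rho> b) = K}"
      then have \<rho>: "\<rho> \<in> acts m X" "K = range (run m \<rho> b)" by auto
      note clo = orbit_closed[OF \<rho>(1) X(2) \<rho>(2)]
      have "fst \<rho> ` (X - K) \<subseteq> X - K" "snd \<rho> ` (X - K) \<subseteq> X - K"
        using acts_closed[OF \<rho>(1)] clo(3,4) by auto
      then have "restr2 (X - K) \<rho> (id, id) \<in> acts m (X - K)"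
        by (intro restr_acts[OF \<rho>(1)] fin) auto
      moreover have "restr2 K \<rho> (id, id) \<in> acts m K"
        by (intro restr_acts[OF \<rho>(1)] fin K clo)
      moreover have "run m (restr2 K \<rho> (id, id)) b w = run m \<rho> b w" for w
        using clo K(2) by (intro run_cong[symmetric, of K]) (auto simp: restr2_def restr_def)
      ultimately show "(restr2 K \<rho> (id, id), restr2 (X - K) \<rho> (id, id)) \<in> trans_acts m K b \<times> acts m (X - K)"
        using \<rho>(2) by (auto simp: trans_acts_def)
    qed
    show "(\<lambda>(\<rho>, \<rho>'). restr2 K \<rho> \<rho>') ` (trans_acts m K b \<times> acts m (X - K)) \<subseteq> {\<rho> \<in> acts m X. range (run m \<rho> b) = K}"
    proof (rule image_subsetI)
      fix a assume "a \<in> trans_acts m K b \<times> acts m (X - K)"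
      then obtain \<rho> \<rho>' where a: "a = (\<rho>, \<rho>')" and \<rho>: "\<rho> \<in> trans_acts m K b" "\<rho>' \<in> acts m (X - K)" by blast
      from \<rho>(1) have \<rho>K: "\<rho> \<in> acts m K" "range (run m \<rho> b) = K" by (auto simp: trans_acts_def)
      have "run m \<rho> b w = run m (restr2 K \<rho> \<rho>') b w" for w
        using acts_closed[OF \<rho>K(1)] K(2) by (intro run_cong[of K]) (auto simp: restr2_def restr_def)
      moreover have "K \<union> (X - K) = X" using K by auto
      ultimately show "(case a of (\<rho>, \<rho>') \<Rightarrow> restr2 K \<rho> \<rho>') \<in> {\<rho> \<in> acts m X. range (run m \<rho> b) = K}"
        using glue_acts[OF \<rho>K(1) \<rho>(2)] \<rho>K(2) by (auto simp: a)
    qed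
  qed
  from bij_betw_same_card[OF this] show ?thesis by (simp add: card_cartesian_product)
qed

text \<open>The combinatorial source of the logarithmic derivative: an action is a transitive one on
  the orbit \<open>K\<close> of \<open>b\<close> and an arbitrary one on the rest.\<close>

lemma card_acts_decompose:
  assumes "finite X" "m > 0" "b \<in> X"
  shows "card (acts m X) = (\<Sum>K | b \<in> K \<and> K \<subseteq> X. card (trans_acts m K b) * card (acts m (X - K)))"
proof -
  let ?\<K> = "{K. b \<in> K \<and> K \<subseteq> X}"
  have "finite ?\<K>" using assms(1) by (auto intro: finite_subset[of _ "Pow X"])
  have "range (run m \<rho> b) \<in> ?\<K>" if "\<rho> \<in> acts m X" for \<rho>
  proof -
    have "b \<in> range (run m \<rho> b)" by (rule range_eqI[of _ _ "[]"]) simp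
    moreover have "range (run m \<rho> b) \<subseteq> X" using run_in[OF that, of b] assms(3) by blast
    ultimately show ?thesis by blast
  qed
  then have "acts m X = (\<Union>K\<in>?\<K>. {\<rho> \<in> acts m X. range (run m \<rho> b) = K})" by blast
  then have "card (acts m X) = card (\<Union>K\<in>?\<K>. {\<rho> \<in> acts m X. range (run m \<rho> b) = K})" by simp
  also have "\<dots> = (\<Sum>K\<in>?\<K>. card {\<rho> \<in> acts m X. range (run m \<rho> b) = K})"
    using \<open>finite ?\<K>\<close> finite_acts[OF assms(1)] by (intro card_UN_disjoint) auto
  also have "\<dots> = (\<Sum>K\<in>?\<K>. card (trans_acts m K b) * card (acts m (X - K)))"
    using card_acts_orbit[OF assms(1,2)] by (intro sum.cong HOL.refl) blast
  finally show ?thesis .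
qed

subsection \<open>Point stabilizers\<close>

definition stab :: "nat \<Rightarrow> ('q \<Rightarrow> 'q) \<times> ('q \<Rightarrow> 'q) \<Rightarrow> 'q \<Rightarrow> generator word set set" where
  "stab m \<rho> b = {cl m w |w. run m \<rho> b w = b}"

lemma stab_iff:
  assumes "\<rho> \<in> acts m X" "m > 0"
  shows "cl m w \<in> stab m \<rho> b \<longleftrightarrow> run m \<rho> b w = b"
  unfolding stab_def using run_eqv[OF assms] by (fastforce simp: cl_eq_iff)

lemma subgroup_stab:
  assumes "\<rho> \<in> acts m X" "m > 0"
  shows "subgroup (stab m \<rho> b) (Gamma3 m)"
proof (rule group.subgroupI[OF group_Gamma3])
  show "stab m \<rho> b \<subseteq> carrier (Gamma3 m)" by (auto simp: stab_def Gamma3_simps)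
  have "cl m [] \<in> stab m \<rho> b" by (simp add: stab_iff[OF assms])
  then show "stab m \<rho> b \<noteq> {}" by blast
  fix c assume "c \<in> stab m \<rho> b"
  then obtain u where u: "c = cl m u" "run m \<rho> b u = b" by (auto simp: stab_def)
  show "inv\<^bsub>Gamma3 m\<^esub> c \<in> stab m \<rho> b"
    using run_word_inv[OF assms, of b u] u by (simp add: Gamma3_simps stab_iff[OF assms])
  fix d assume "d \<in> stab m \<rho> b"
  then obtain v where v: "d = cl m v" "run m \<rho> b v = b" by (auto simp: stab_def)
  show "c \<otimes>\<^bsub>Gamma3 m\<^esub> d \<in> stab m \<rho> b"
    using u v by (simp add: Gamma3_simps stab_iff[OF assms])
qed

text \<open>The right coset of \<open>w\<close> consists of the elements that lead from
  \<open>b\<close> to the same point as \<open>w\<close>, so cosets correspond to points of the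
  orbit.\<close>

lemma card_rcosets_stab:
  assumes "\<rho> \<in> trans_acts m K b" "m > 0"
  shows "card (rcosets\<^bsub>Gamma3 m\<^esub> (stab m \<rho> b)) = card K"
proof -
  have \<rho>: "\<rho> \<in> acts m K" "range (run m \<rho> b) = K" using assms(1) by (auto simp: trans_acts_def)
  define fib where "fib p = {cl m v |v. run m \<rho> b v = p}" for p
  have coset: "stab m \<rho> b #>\<^bsub>Gamma3 m\<^esub> cl m w = fib (run m \<rho> b w)" for w
  proof (rule subset_antisym; rule subsetI)
    fix c assume "c \<in> stab m \<rho> b #>\<^bsub>Gamma3 m\<^esub> cl m w"
    then obtain u where "c = cl m (u @ w)" "run m \<rho> b u = b"
      by (auto simp: r_coset_def stab_def Gamma3_simps)
    then show "c \<in> fib (run m \<rho> b w)"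
      unfolding fib_def by (auto intro!: exI[of _ "u @ w"])
  next
    fix c assume "c \<in> fib (run m \<rho> b w)"
    then obtain v where v: "c = cl m v" "run m \<rho> b v = run m \<rho> b w" by (auto simp: fib_def)
    have "eqv m (v @ word_inv w @ w) (v @ [])"
      by (intro pres_eq.append pres_eq.refl pres_eq_word_inv_left) simp_all
    then have "c = cl m (v @ word_inv w) \<otimes>\<^bsub>Gamma3 m\<^esub> cl m w"
      by (simp add: v Gamma3_simps cl_eq_iff pres_eq.sym)
    moreover have "cl m (v @ word_inv w) \<in> stab m \<rho> b"
      using v run_word_inv[OF \<rho>(1) assms(2)] by (simp add: stab_iff[OF \<rho>(1) assms(2)])
    ultimately show "c \<in> stab m \<rho> b #>\<^bsub>Gamma3 m\<^esub> cl m w" unfolding r_coset_def by blast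
  qed
  have "rcosets\<^bsub>Gamma3 m\<^esub> (stab m \<rho> b) = fib ` K"
    unfolding RCOSETS_def by (auto simp: coset Gamma3_simps \<rho>(2)[symmetric])
  moreover have "inj_on fib K"
  proof (rule inj_onI)
    fix p q assume "p \<in> K" "q \<in> K" "fib p = fib q"
    then obtain w where w: "p = run m \<rho> b w" using \<rho>(2) by blast
    then have "cl m w \<in> fib q" using \<open>fib p = fib q\<close> by (auto simp: fib_def)
    then show "p = q" using w run_eqv[OF \<rho>(1) assms(2)] by (auto simp: fib_def cl_eq_iff)
  qed
  ultimately show ?thesis by (simp add: card_image)
qed

text \<open>Instead of a normal form in the amalgam, a single action detects the orders:
  \<open>card_acts\<close> with n = 1 is positive, and in a regular action on 6m points smaller
  powers of x and y move every point.\<close>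

lemma gen_order:
  assumes "m > 0"
  shows "\<And>j. 0 < j \<Longrightarrow> j < 2 * m \<Longrightarrow> cl m (pow_word gen_x j) \<noteq> cl m []"
    and "\<And>j. 0 < j \<Longrightarrow> j < 3 * m \<Longrightarrow> cl m (pow_word gen_y j) \<noteq> cl m []"
proof -
  let ?X = "{..<6 * m}"
  have "72 ^ 1 * card (acts m ?X) = fact (6 * m * 1) * (gamma_coeff 1 * m ^ 1)"
    by (rule card_acts) (use assms in auto)
  moreover have "gamma_coeff 1 * (fact (3 * 1) * fact (2 * 1)) = fact (6 * 1)"
    by (rule gamma_coeff_mult)
  then have "gamma_coeff 1 \<noteq> 0" by (metis fact_nonzero mult_zero_left)
  ultimately have "72 ^ 1 * card (acts m ?X) \<noteq> 0" using assms by (simp only: mult_eq_0_iff) simp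
  then have "card (acts m ?X) \<noteq> 0" by (metis mult_0_right)
  then have "acts m ?X \<noteq> {}" by (metis card.empty)
  then obtain \<sigma> \<tau> where a: "(\<sigma>, \<tau>) \<in> acts m ?X" by auto
  have "0 \<in> ?X" using assms by simp
  then have free: "0 < j \<Longrightarrow> j < 2 * m \<Longrightarrow> (\<sigma> ^^ j) 0 \<noteq> 0" "0 < j \<Longrightarrow> j < 3 * m \<Longrightarrow> (\<tau> ^^ j) 0 \<noteq> 0" for j
    using regular_permsD(3)[OF actsD(1)[OF a]] regular_permsD(3)[OF actsD(2)[OF a]] by blast+
  have trivial: "run m (\<sigma>, \<tau>) 0 w = 0" if "cl m w = cl m []" for w
    using run_eqv[OF a assms, of w "[]" 0] that by (simp add: cl_eq_iff)
  show "cl m (pow_word gen_x j) \<noteq> cl m []" if "0 < j" "j < 2 * m" for j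
    using free(1)[OF that] trivial[of "pow_word gen_x j"] by (auto simp: run_pow)
  show "cl m (pow_word gen_y j) \<noteq> cl m []" if "0 < j" "j < 3 * m" for j
    using free(2)[OF that] trivial[of "pow_word gen_y j"] by (auto simp: run_pow)
qed

section \<open>From free subgroups to actions on cosets\<close>

lemma gen_pow_rels:
  "cl m (pow_word gen_x (2 * m)) = cl m []" "cl m (pow_word gen_y (3 * m)) = cl m []"
  "cl m (pow_word gen_x 2) = cl m (pow_word gen_y 3)"
  by (simp_all only: cl_eq_iff) (rule pres_eq.rel; simp add: rels_def)+

lemma cl_pow_word: "cl m (pow_word a n) = cl m [(a, True)] [^]\<^bsub>Gamma3 m\<^esub> n"
proof -
  have "concat (replicate n [(a, True)]) = pow_word a n" by (induction n) auto
  then show ?thesis by (simp only: Gamma3_simps(5))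
qed

text \<open>The action on the right cosets, with \<open>K\<close> as names for the cosets and
  \<open>b\<close> as the name of \<open>H\<close>. Regularity uses freeness: if a power of a
  generator fixes the coset of \<open>w\<close>, its conjugate by \<open>w\<close> is a torsion
  element of \<open>H\<close>, hence trivial, and \<open>gen_order\<close> excludes this.\<close>

lemma coset_action_exists:
  assumes H: "H \<in> free_subgroups (Gamma3 m) (card K)" and K: "finite K" "b \<in> K" and "m > 0"
  shows "\<exists>\<rho>\<in>trans_acts m K b. stab m \<rho> b = H"
proof -
  interpret group "Gamma3 m" by (rule group_Gamma3)
  let ?C = "rcosets\<^bsub>Gamma3 m\<^esub> H"
  have sub: "subgroup H (Gamma3 m)" and card: "card ?C = card K"
    and free: "is_free_group (Gamma3 m\<lparr>carrier := H\<rparr>)"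
    using H by (auto simp: free_subgroups_def)
  note HG = subgroup.subset[OF sub]
  have H_in: "H \<in> ?C" by (rule subgroup.subgroup_in_rcosets[OF sub group_axioms])
  have "card ?C > 0" unfolding card using K by (auto simp: card_gt_0_iff)
  then have "finite ?C" by (rule card_ge_0_finite)
  then obtain h0 where h0: "bij_betw h0 ?C K" using finite_same_card_bij K(1) card by blast
  \<comment> \<open>The transposition corrects an arbitrary naming so that \<open>H\<close> is
    called \<open>b\<close>.\<close>
  define h where "h = Transposition.transpose (h0 H) b \<circ> h0"
  have "h0 H \<in> K" using h0 H_in by (rule bij_betw_apply)
  then have "bij_betw (Transposition.transpose (h0 H) b) K K"
    using K(2) by (intro permutes_imp_bij permutes_swap_id)
  with h0 have h: "bij_betw h ?C K" unfolding h_def by (rule bij_betw_trans)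
  have hH: "h H = b" by (simp add: h_def)
  have act: "c #>\<^bsub>Gamma3 m\<^esub> cl m u \<in> ?C"
    "c #>\<^bsub>Gamma3 m\<^esub> cl m u #>\<^bsub>Gamma3 m\<^esub> cl m v = c #>\<^bsub>Gamma3 m\<^esub> cl m (u @ v)"
    "c #>\<^bsub>Gamma3 m\<^esub> cl m [] = c" if cC: "c \<in> ?C" for c u v
  proof -
    have c: "c \<subseteq> carrier (Gamma3 m)" by (rule subgroup.rcosets_carrier[OF sub group_axioms that])
    have clc: "cl m u \<in> carrier (Gamma3 m)" for u by (simp add: Gamma3_simps)
    obtain g where g: "g \<in> carrier (Gamma3 m)" "c = H #>\<^bsub>Gamma3 m\<^esub> g"
      using cC unfolding RCOSETS_def by blast
    show "c #>\<^bsub>Gamma3 m\<^esub> cl m u \<in> ?C"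
      using g clc HG by (auto simp: coset_mult_assoc intro!: rcosetsI)
    show "c #>\<^bsub>Gamma3 m\<^esub> cl m u #>\<^bsub>Gamma3 m\<^esub> cl m v = c #>\<^bsub>Gamma3 m\<^esub> cl m (u @ v)"
      using coset_mult_assoc[OF c clc clc] by (simp add: Gamma3_simps)
    show "c #>\<^bsub>Gamma3 m\<^esub> cl m [] = c"
      using coset_mult_one[OF c] by (simp add: Gamma3_simps)
  qed
  define f where "f a p = (if p \<in> K then h (inv_into ?C h p #>\<^bsub>Gamma3 m\<^esub> cl m [(a, True)]) else p)" for a p
  have hK: "h c \<in> K" if "c \<in> ?C" for c using h that by (rule bij_betw_apply)
  have f_h: "f a (h c) = h (c #>\<^bsub>Gamma3 m\<^esub> cl m [(a, True)])" if "c \<in> ?C" for a c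
    using that hK bij_betw_inv_into_left[OF h] by (simp add: f_def)
  have pow: "(f a ^^ n) (h c) = h (c #>\<^bsub>Gamma3 m\<^esub> cl m (pow_word a n))" if "c \<in> ?C" for a n c
    using that
  proof (induction n arbitrary: c)
    case (Suc n)
    then show ?case using act[of c] by (simp add: f_h del: funpow.simps(2) add: funpow_Suc_right)
  qed (simp add: act)
  have h_inj: "c = d" if "h c = h d" "c \<in> ?C" "d \<in> ?C" for c d
    using bij_betw_imp_inj_on[OF h] that by (rule inj_onD)
  have regular_perms: "f a \<in> regular_perms d K"
    if "d > 0" and d: "cl m (pow_word a d) = cl m []"
      and j: "\<And>j. 0 < j \<Longrightarrow> j < d \<Longrightarrow> cl m (pow_word a j) \<noteq> cl m []" for a d
  proof (rule regular_permsI[OF K(1) that(1)])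
    show "f a p = p" if "p \<notin> K" for p using that by (simp add: f_def)
    fix p assume "p \<in> K"
    then obtain c where c: "p = h c" "c \<in> ?C" using bij_betw_imp_surj_on[OF h] by blast
    show "f a p \<in> K" using c act hK by (simp add: f_h)
    show "(f a ^^ d) p = p" using c by (simp add: pow d act)
    fix j assume j0: "0 < j" "j < d"
    show "(f a ^^ j) p \<noteq> p"
    proof
      assume "(f a ^^ j) p = p"
      then have "h (c #>\<^bsub>Gamma3 m\<^esub> cl m (pow_word a j)) = h c" using c by (simp add: pow)
      then have cj: "c #>\<^bsub>Gamma3 m\<^esub> cl m (pow_word a j) = c" using act(1)[OF c(2)] c(2) by (rule h_inj)
      obtain w where w: "c = H #>\<^bsub>Gamma3 m\<^esub> cl m w"
        using c(2) by (auto simp: RCOSETS_def Gamma3_simps)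
      let ?t = "cl m (w @ pow_word a j @ word_inv w)"
      have clc: "cl m u \<in> carrier (Gamma3 m)" for u by (simp add: Gamma3_simps)
      have "H #>\<^bsub>Gamma3 m\<^esub> ?t = c #>\<^bsub>Gamma3 m\<^esub> cl m (pow_word a j) #>\<^bsub>Gamma3 m\<^esub> cl m (word_inv w)"
        by (simp only: w act(2)[OF H_in] append_assoc)
      also have "\<dots> = H #>\<^bsub>Gamma3 m\<^esub> cl m (w @ word_inv w)"
        unfolding cj by (simp only: w act(2)[OF H_in])
      also have "cl m (w @ word_inv w) = cl m []" by (simp add: cl_eq_iff pres_eq_word_inv_right)
      finally have tH: "?t \<in> H" using act(3)[OF H_in] coset_join1[OF _ clc sub] HG by simp
      have "eqv m (((w @ pow_word a j) @ word_inv w @ w)) ((w @ pow_word a j) @ [])"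
        by (intro pres_eq.append pres_eq.refl pres_eq_word_inv_left) simp_all
      then have inter: "?t \<otimes>\<^bsub>Gamma3 m\<^esub> cl m w = cl m w \<otimes>\<^bsub>Gamma3 m\<^esub> cl m (pow_word a j)"
        by (simp add: Gamma3_simps cl_eq_iff)
      note gpow = cl_pow_word[of m _ a]
      have "cl m (pow_word a j) [^]\<^bsub>Gamma3 m\<^esub> d = cl m (pow_word a d) [^]\<^bsub>Gamma3 m\<^esub> j"
        by (simp only: gpow nat_pow_pow[OF clc] mult.commute)
      also have "\<dots> = \<one>\<^bsub>Gamma3 m\<^esub>" by (simp only: d Gamma3_simps(3)[symmetric] nat_pow_one)
      finally have "?t [^]\<^bsub>Gamma3 m\<^esub> d \<otimes>\<^bsub>Gamma3 m\<^esub> cl m w = cl m w"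
        using pow_intertwine[OF clc clc clc inter, of d] r_one[OF clc] by simp
      then have "?t [^]\<^bsub>Gamma3 m\<^esub> d = \<one>\<^bsub>Gamma3 m\<^esub>"
        using r_cancel_one[OF clc nat_pow_closed[OF clc]] by blast
      then have "?t [^]\<^bsub>Gamma3 m\<lparr>carrier := H\<rparr>\<^esub> d = \<one>\<^bsub>Gamma3 m\<lparr>carrier := H\<rparr>\<^esub>"
        using nat_pow_consistent[of ?t d H] by simp
      then have t1: "?t = \<one>\<^bsub>Gamma3 m\<^esub>"
        using is_free_group_torsion_free[OF free _ that(1)] tH by simp
      then have "cl m w \<otimes>\<^bsub>Gamma3 m\<^esub> cl m (pow_word a j) = cl m w"
        using inter l_one[OF clc] by simp
      then have "cl m (pow_word a j) = cl m []"
        using l_cancel_one[OF clc clc] by (simp only: Gamma3_simps(3))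
      then show False using j j0 by blast
    qed
  qed
  let ?\<rho> = "(f gen_x, f gen_y)"
  have "f gen_x ^^ 2 = f gen_y ^^ 3"
  proof
    fix p
    show "(f gen_x ^^ 2) p = (f gen_y ^^ 3) p"
    proof (cases "p \<in> K")
      case True
      then obtain c where "p = h c" "c \<in> ?C" using bij_betw_imp_surj_on[OF h] by blast
      then show ?thesis by (simp only: pow gen_pow_rels(3))
    next
      case False
      then show ?thesis by (simp add: f_def eval_nat_numeral)
    qed
  qed
  then have acts: "?\<rho> \<in> acts m K"
    using assms(4) gen_order gen_pow_rels by (simp add: acts_def regular_perms)
  \<comment> \<open>Inverse generators are rewritten as the positive powers by which
    \<open>move\<close> interprets them.\<close>
  have inv_gen: "cl m [(a, False)] = cl m (pow_word a (d - 1))"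
    if "d > 0" "cl m (pow_word a d) = cl m []" for a d
  proof -
    have "eqv m ([(a, False), (a, True)] @ pow_word a (d - 1)) ([] @ pow_word a (d - 1))"
      using pres_eq.cancel[of a gens "rels m" False] by (intro pres_eq.append pres_eq.refl) (simp_all add: gens_UNIV)
    moreover have "[(a, False), (a, True)] @ pow_word a (d - 1) = [(a, False)] @ pow_word a d"
      using that(1) by (cases d) auto
    moreover have "eqv m ([(a, False)] @ pow_word a d) ([(a, False)] @ [])"
      using that(2) by (intro pres_eq.append pres_eq.refl) (simp_all add: cl_eq_iff)
    ultimately show ?thesis by (auto simp: cl_eq_iff intro: pres_eq.trans pres_eq.sym)
  qed
  have move_h: "move m ?\<rho> (h c) (a, e) = h (c #>\<^bsub>Gamma3 m\<^esub> cl m [(a, e)])" if "c \<in> ?C" for c a e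
    using that assms(4) inv_gen[OF _ gen_pow_rels(1)] inv_gen[OF _ gen_pow_rels(2)]
    by (cases a; cases e) (simp_all add: f_h pow)
  have run_h: "run m ?\<rho> (h c) w = h (c #>\<^bsub>Gamma3 m\<^esub> cl m w)" if "c \<in> ?C" for c w
    using that
  proof (induction w arbitrary: c)
    case (Cons l w)
    obtain a e where "l = (a, e)" by force
    with Cons act[of c] show ?case by (simp add: move_h del: move.simps)
  qed (simp add: act)
  have run_b: "run m ?\<rho> b w = h (H #>\<^bsub>Gamma3 m\<^esub> cl m w)" for w
    using run_h[OF H_in] hH by simp
  have "range (run m ?\<rho> b) = h ` ?C"
    by (auto simp: run_b RCOSETS_def Gamma3_simps)
  then have "?\<rho> \<in> trans_acts m K b"
    using acts bij_betw_imp_surj_on[OF h] by (simp add: trans_acts_def)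
  moreover have "stab m ?\<rho> b = H"
  proof -
    have "run m ?\<rho> b w = b \<longleftrightarrow> cl m w \<in> H" for w
    proof -
      have w: "cl m w \<in> carrier (Gamma3 m)" by (simp add: Gamma3_simps)
      have "run m ?\<rho> b w = b \<longleftrightarrow> h (H #>\<^bsub>Gamma3 m\<^esub> cl m w) = h H" by (simp add: run_b hH)
      also have "\<dots> \<longleftrightarrow> H #>\<^bsub>Gamma3 m\<^esub> cl m w = H" by (rule iffI, erule h_inj[OF _ act(1)[OF H_in] H_in], simp)
      also have "\<dots> \<longleftrightarrow> cl m w \<in> H" using coset_join1[OF _ w sub] coset_join2[OF w sub] by blast
      finally show ?thesis .
    qed
    then show ?thesis using HG by (auto simp: stab_def Gamma3_simps)
  qed
  ultimately show ?thesis by blast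
qed

section \<open>Renaming the points of a transitive action\<close>

definition conj2 :: "('q \<Rightarrow> 'q) \<Rightarrow> ('q \<Rightarrow> 'q) \<times> ('q \<Rightarrow> 'q) \<Rightarrow> ('q \<Rightarrow> 'q) \<times> ('q \<Rightarrow> 'q)" where
  "conj2 \<pi> \<rho> = (\<pi> \<circ> fst \<rho> \<circ> inv_into UNIV \<pi>, \<pi> \<circ> snd \<rho> \<circ> inv_into UNIV \<pi>)"

lemma conj2_acts:
  assumes "\<pi> permutes X" "\<rho> \<in> acts m X"
  shows "conj2 \<pi> \<rho> \<in> acts m X"
  using assms conj_regular_perms[OF assms(1)] by (auto simp: acts_def conj2_def conj_funpow[OF assms(1)])

lemma conj2_run:
  assumes "\<pi> permutes X"
  shows "run m (conj2 \<pi> \<rho>) (\<pi> p) w = \<pi> (run m \<rho> p w)"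
proof -
  have "move m (conj2 \<pi> \<rho>) (\<pi> p) l = \<pi> (move m \<rho> p l)" for p l
    by (cases \<rho>; cases l; cases "fst l")
      (auto simp: conj2_def permutes_inverses[OF assms] conj_funpow[OF assms])
  then show ?thesis by (induction w arbitrary: p) simp_all
qed

text \<open>Transitive actions with the same stabilizer of \<open>b\<close> differ by a renaming of
  the points that fixes \<open>b\<close>. This renaming is unique, because each point is reached
  from \<open>b\<close> by a word.\<close>

lemma card_trans_acts_stab:
  assumes K: "finite K" "b \<in> K" "m > 0" and \<rho>0: "\<rho>\<^sub>0 \<in> trans_acts m K b"
  shows "card {\<rho> \<in> trans_acts m K b. stab m \<rho> b = stab m \<rho>\<^sub>0 b} = fact (card K - 1)"
proof -
  have a0: "\<rho>\<^sub>0 \<in> acts m K" "range (run m \<rho>\<^sub>0 b) = K" using \<rho>0 by (auto simp: trans_acts_def)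
  have perm: "\<pi> permutes K" "\<pi> b = b" if "\<pi> permutes (K - {b})" for \<pi>
    using that permutes_not_in[OF that, of b] by (auto intro: permutes_subset)
  have run_b: "run m (conj2 \<pi> \<rho>\<^sub>0) b w = \<pi> (run m \<rho>\<^sub>0 b w)" if "\<pi> permutes (K - {b})" for \<pi> w
    using conj2_run[OF perm(1)[OF that], of m \<rho>\<^sub>0 b w] perm(2)[OF that] by simp
  have "bij_betw (\<lambda>\<pi>. conj2 \<pi> \<rho>\<^sub>0) {\<pi>. \<pi> permutes (K - {b})}
      {\<rho> \<in> trans_acts m K b. stab m \<rho> b = stab m \<rho>\<^sub>0 b}"
    unfolding bij_betw_def
  proof (intro conjI inj_onI subset_antisym subsetI)
    fix \<pi> \<pi>' assume "\<pi> \<in> {\<pi>. \<pi> permutes (K - {b})}" "\<pi>' \<in> {\<pi>. \<pi> permutes (K - {b})}"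
      and eq: "conj2 \<pi> \<rho>\<^sub>0 = conj2 \<pi>' \<rho>\<^sub>0"
    then have p: "\<pi> permutes (K - {b})" "\<pi>' permutes (K - {b})" by auto
    show "\<pi> = \<pi>'"
    proof
      fix q
      show "\<pi> q = \<pi>' q"
      proof (cases "q \<in> K")
        case True
        then obtain w where "q = run m \<rho>\<^sub>0 b w" using a0(2) by blast
        then show ?thesis using run_b[OF p(1), of w] run_b[OF p(2), of w] eq by simp
      next
        case False
        then show ?thesis using p by (simp add: permutes_not_in)
      qed
    qed
  next
    fix \<rho> assume "\<rho> \<in> (\<lambda>\<pi>. conj2 \<pi> \<rho>\<^sub>0) ` {\<pi>. \<pi> permutes (K - {b})}"
    then obtain \<pi> where p: "\<pi> permutes (K - {b})" and \<rho>: "\<rho> = conj2 \<pi> \<rho>\<^sub>0" by blast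
    have "range (run m \<rho> b) = \<pi> ` range (run m \<rho>\<^sub>0 b)"
      by (simp only: image_image \<rho> run_b[OF p])
    then have "range (run m \<rho> b) = K" using permutes_image[OF perm(1)[OF p]] a0(2) by simp
    moreover have "run m \<rho> b w = b \<longleftrightarrow> run m \<rho>\<^sub>0 b w = b" for w
      using run_b[OF p, of w] perm(2)[OF p] inj_eq[OF permutes_inj[OF p], of "run m \<rho>\<^sub>0 b w" b]
      by (simp add: \<rho>)
    then have "stab m \<rho> b = stab m \<rho>\<^sub>0 b" by (simp add: stab_def)
    ultimately show "\<rho> \<in> {\<rho> \<in> trans_acts m K b. stab m \<rho> b = stab m \<rho>\<^sub>0 b}"
      using conj2_acts[OF perm(1)[OF p] a0(1)] by (simp add: trans_acts_def \<rho>)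
  next
    fix \<rho> assume "\<rho> \<in> {\<rho> \<in> trans_acts m K b. stab m \<rho> b = stab m \<rho>\<^sub>0 b}"
    then have a: "\<rho> \<in> acts m K" "range (run m \<rho> b) = K" and st: "stab m \<rho> b = stab m \<rho>\<^sub>0 b"
      by (auto simp: trans_acts_def)
    \<comment> \<open>Whether two words end at the same point can be read off the stabilizer. Hence
      matching the endpoints of each word in the two actions is a well-defined map.\<close>
    have same: "run m \<rho>' b u = run m \<rho>' b v \<longleftrightarrow> cl m (u @ word_inv v) \<in> stab m \<rho>' b"
      if "\<rho>' \<in> acts m K" for \<rho>' u v
      using run_word_inv[OF that K(3), of b v] run_word_inv[OF that K(3), of "run m \<rho>' b u" "word_inv v"]
      by (auto simp: stab_iff[OF that K(3)])
    then have eq_iff: "run m \<rho> b u = run m \<rho> b v \<longleftrightarrow> run m \<rho>\<^sub>0 b u = run m \<rho>\<^sub>0 b v" for u v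
      by (simp only: same[OF a(1)] same[OF a0(1)] st)
    define \<pi> where "\<pi> p = (if p \<in> K then run m \<rho> b (SOME w. run m \<rho>\<^sub>0 b w = p) else p)" for p
    have \<pi>_run: "\<pi> (run m \<rho>\<^sub>0 b w) = run m \<rho> b w" for w
    proof -
      have "run m \<rho>\<^sub>0 b (SOME v. run m \<rho>\<^sub>0 b v = run m \<rho>\<^sub>0 b w) = run m \<rho>\<^sub>0 b w"
        by (rule someI_ex) blast
      then show ?thesis using eq_iff a0(2) by (auto simp: \<pi>_def)
    qed
    have "\<pi> ` K = range (run m \<rho> b)"
      unfolding a0(2)[symmetric] by (simp only: image_image \<pi>_run)
    then have "\<pi> ` K = K" using a(2) by simp
    then have "bij_betw \<pi> K K" using K(1) by (simp add: bij_betw_def eq_card_imp_inj_on)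
    then have pK: "\<pi> permutes K" by (rule bij_imp_permutes) (simp add: \<pi>_def)
    have "\<pi> b = b" using \<pi>_run[of "[]"] by simp
    then have p: "\<pi> permutes (K - {b})"
      using pK K(2) by (auto intro: permutes_superset)
    obtain \<sigma> \<tau> \<sigma>0 \<tau>0 where st: "\<rho> = (\<sigma>, \<tau>)" "\<rho>\<^sub>0 = (\<sigma>0, \<tau>0)" by force
    have "\<pi> (\<sigma>0 q) = \<sigma> (\<pi> q) \<and> \<pi> (\<tau>0 q) = \<tau> (\<pi> q)" for q
    proof (cases "q \<in> K")
      case True
      then obtain w where w: "q = run m \<rho>\<^sub>0 b w" using a0(2) by blast
      show ?thesis
        using \<pi>_run[of w] \<pi>_run[of "w @ [(gen_x, True)]"] \<pi>_run[of "w @ [(gen_y, True)]"]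
        by (simp add: w st)
    next
      case False
      then show ?thesis
        using acts_outside[OF a(1) False] acts_outside[OF a0(1) False] by (simp add: \<pi>_def st)
    qed
    then have "\<rho> = conj2 \<pi> \<rho>\<^sub>0"
      by (auto simp: conj2_def st fun_eq_iff permutes_inverses[OF pK])
    then show "\<rho> \<in> (\<lambda>\<pi>. conj2 \<pi> \<rho>\<^sub>0) ` {\<pi>. \<pi> permutes (K - {b})}" using p by blast
  qed
  from bij_betw_same_card[OF this] show ?thesis using card_permutations[of "K - {b}" "card K - 1"] K by simp
qed

subsection \<open>A spanning tree of the quotient graph\<close>

lemma pow_word_Suc: "pow_word a (Suc n) = pow_word a n @ [(a, True)]"
  by (simp add: replicate_append_same)

lemma eqv_appendI: "eqv m u u' \<Longrightarrow> eqv m (w @ u) (w @ u')"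
  by (intro pres_eq.append pres_eq.refl) simp_all

lemma eqv_append_rightI: "eqv m u u' \<Longrightarrow> eqv m (u @ w) (u' @ w)"
  by (intro pres_eq.append pres_eq.refl) simp_all

lemma pow_word_mod:
  assumes "cl m (pow_word a d) = cl m []"
  shows "eqv m (pow_word a n) (pow_word a (n mod d))"
proof -
  interpret group "Gamma3 m" by (rule group_Gamma3)
  let ?g = "cl m [(a, True)]"
  have g: "?g \<in> carrier (Gamma3 m)" by (simp add: Gamma3_simps)
  note gpow = cl_pow_word[of m _ a]
  have "?g [^]\<^bsub>Gamma3 m\<^esub> n = ?g [^]\<^bsub>Gamma3 m\<^esub> (d * (n div d) + n mod d)" by simp
  also have "\<dots> = (?g [^]\<^bsub>Gamma3 m\<^esub> d) [^]\<^bsub>Gamma3 m\<^esub> (n div d) \<otimes>\<^bsub>Gamma3 m\<^esub> ?g [^]\<^bsub>Gamma3 m\<^esub> (n mod d)"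
    using g by (simp only: nat_pow_mult nat_pow_pow)
  also have "?g [^]\<^bsub>Gamma3 m\<^esub> d = \<one>\<^bsub>Gamma3 m\<^esub>"
    using assms by (simp only: gpow Gamma3_simps(3))
  finally have "?g [^]\<^bsub>Gamma3 m\<^esub> n = ?g [^]\<^bsub>Gamma3 m\<^esub> (n mod d)"
    by (simp only: nat_pow_one l_one nat_pow_closed g)
  then show ?thesis by (simp only: gpow[symmetric] cl_eq_iff)
qed

text \<open>This is how regularity enters the proof of freeness: exponents leading to the same point
  agree modulo the full order of the generator, so a path inside one orbit determines a group
  element.\<close>

lemma pow_word_eqv:
  assumes "(\<sigma>, \<tau>) \<in> acts m X" "m > 0" "p \<in> X"
  shows "(\<sigma> ^^ i) p = (\<sigma> ^^ j) p \<Longrightarrow> eqv m (pow_word gen_x i) (pow_word gen_x j)"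
    and "(\<tau> ^^ i) p = (\<tau> ^^ j) p \<Longrightarrow> eqv m (pow_word gen_y i) (pow_word gen_y j)"
proof -
  have "eqv m (pow_word gen_x i) (pow_word gen_x (i mod (2 * m)))"
    "eqv m (pow_word gen_y i) (pow_word gen_y (i mod (3 * m)))" for i
    by (rule pow_word_mod, rule gen_pow_rels)+
  note * = this
  show "eqv m (pow_word gen_x i) (pow_word gen_x j)" if "(\<sigma> ^^ i) p = (\<sigma> ^^ j) p"
  proof -
    have "i mod (2 * m) = j mod (2 * m)"
      using regular_perms_funpow_eq_iff[OF actsD(1)[OF assms(1)] assms(3)] that assms(2) by simp
    then show ?thesis using *(1)[of i] *(1)[of j] by (metis pres_eq.sym pres_eq.trans)
  qed
  show "eqv m (pow_word gen_y i) (pow_word gen_y j)" if "(\<tau> ^^ i) p = (\<tau> ^^ j) p"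
  proof -
    have "i mod (3 * m) = j mod (3 * m)"
      using regular_perms_funpow_eq_iff[OF actsD(2)[OF assms(1)] assms(3)] that assms(2) by simp
    then show ?thesis using *(2)[of i] *(2)[of j] by (metis pres_eq.sym pres_eq.trans)
  qed
qed

lemma square_cube:
  assumes "(\<sigma>, \<tau>) \<in> acts m X"
  shows "(\<sigma> ^^ (2 * i)) p = (\<tau> ^^ (3 * i)) p"
proof -
  have "\<sigma> ^^ 2 = \<tau> ^^ 3" using assms by (simp add: acts_def)
  then have "(\<sigma> ^^ 2) ^^ i = (\<tau> ^^ 3) ^^ i" by simp
  then show ?thesis by (simp add: funpow_mult)
qed

lemma square_cube_word: "eqv m (pow_word gen_x (2 * i)) (pow_word gen_y (3 * i))"
proof (induction i)
  case (Suc i)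
  have "eqv m (pow_word gen_x (2 * i) @ pow_word gen_x 2) (pow_word gen_y (3 * i) @ pow_word gen_y 3)"
    using Suc gen_pow_rels(3)[of m] by (intro pres_eq.append) (simp_all only: cl_eq_iff)
  then show ?case by (simp flip: replicate_add add: add.commute)
qed (simp add: pres_eq.refl)

text \<open>Multiplying by \<open>e(p)\<^sup>-\<^sup>1 e(q)\<close> along a letter \<open>y\<close> leading from \<open>p\<close> to \<open>q\<close> respects the relations
  as soon as \<open>e\<close> is constant on the orbits of \<open>x\<^sup>2 = y\<^sup>3\<close>.\<close>

definition lift :: "nat \<Rightarrow> ('q \<Rightarrow> 'q) \<times> ('q \<Rightarrow> 'q) \<Rightarrow> 'f monoid \<Rightarrow> ('q \<Rightarrow> 'f) \<Rightarrow> 'q \<times> 'f \<Rightarrow> generator \<times> bool \<Rightarrow> 'q \<times> 'f" where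
  "lift m \<rho> F e s l =
     (move m \<rho> (fst s) l,
      if fst l = gen_y then snd s \<otimes>\<^bsub>F\<^esub> inv\<^bsub>F\<^esub> (e (fst s)) \<otimes>\<^bsub>F\<^esub> e (move m \<rho> (fst s) l) else snd s)"

text \<open>An assignment of group elements to the edges: invariance under x^2 says that
  \<open>e\<close> depends only on the edge through a point.\<close>

definition cocycle :: "('q \<Rightarrow> 'q) \<times> ('q \<Rightarrow> 'q) \<Rightarrow> 'f monoid \<Rightarrow> ('q \<Rightarrow> 'f) \<Rightarrow> bool" where
  "cocycle \<rho> F e \<longleftrightarrow> group F \<and> (\<forall>p. e p \<in> carrier F) \<and> (\<forall>p. e (fst \<rho> (fst \<rho> p)) = e p)"

lemma fst_lift: "fst (foldl (lift m \<rho> F e) s w) = run m \<rho> (fst s) w"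
  by (induction w arbitrary: s) (simp_all add: lift_def)

lemma lift_closed:
  assumes "cocycle \<rho> F e" "s \<in> UNIV \<times> carrier F"
  shows "lift m \<rho> F e s l \<in> UNIV \<times> carrier F"
proof -
  interpret group F using assms(1) by (simp add: cocycle_def)
  show ?thesis using assms by (auto simp: cocycle_def lift_def)
qed

lemma lift_cancel:
  assumes "\<rho> \<in> acts m X" "m > 0" "cocycle \<rho> F e" "s \<in> UNIV \<times> carrier F"
  shows "lift m \<rho> F e (lift m \<rho> F e s (a, i)) (a, \<not> i) = s"
proof -
  interpret group F using assms(3) by (simp add: cocycle_def)
  have ec: "e p \<in> carrier F" for p using assms(3) by (simp add: cocycle_def)
  obtain p f where s: "s = (p, f)" by force
  show ?thesis
    using assms(4) move_cancel[OF assms(1,2), of p a i] ec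
    by (cases a) (simp_all add: lift_def s m_assoc inv_solve_left flip: m_assoc[of "e q" "inv\<^bsub>F\<^esub> e q" for q])
qed

lemma lift_pow:
  assumes "cocycle (\<sigma>, \<tau>) F e" "f \<in> carrier F"
  shows "foldl (lift m (\<sigma>, \<tau>) F e) (p, f) (pow_word gen_x n) = ((\<sigma> ^^ n) p, f)"
    and "foldl (lift m (\<sigma>, \<tau>) F e) (p, f) (pow_word gen_y n) = ((\<tau> ^^ n) p, f \<otimes>\<^bsub>F\<^esub> inv\<^bsub>F\<^esub> (e p) \<otimes>\<^bsub>F\<^esub> e ((\<tau> ^^ n) p))"
proof -
  interpret group F using assms(1) by (simp add: cocycle_def)
  have ec: "e p \<in> carrier F" for p using assms(1) by (simp add: cocycle_def)
  show "foldl (lift m (\<sigma>, \<tau>) F e) (p, f) (pow_word gen_x n) = ((\<sigma> ^^ n) p, f)"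
    by (induction n) (simp, simp add: pow_word_Suc lift_def del: replicate_Suc)
  show "foldl (lift m (\<sigma>, \<tau>) F e) (p, f) (pow_word gen_y n) = ((\<tau> ^^ n) p, f \<otimes>\<^bsub>F\<^esub> inv\<^bsub>F\<^esub> (e p) \<otimes>\<^bsub>F\<^esub> e ((\<tau> ^^ n) p))"
  proof (induction n)
    case 0
    then show ?case using assms(2) ec by (simp add: m_assoc)
  next
    case (Suc n)
    have "f \<otimes>\<^bsub>F\<^esub> inv\<^bsub>F\<^esub> (e p) \<otimes>\<^bsub>F\<^esub> e q \<otimes>\<^bsub>F\<^esub> inv\<^bsub>F\<^esub> (e q) = f \<otimes>\<^bsub>F\<^esub> inv\<^bsub>F\<^esub> (e p)" for q
      using assms(2) ec by (simp add: m_assoc)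
    then show ?case using Suc by (simp add: pow_word_Suc lift_def del: replicate_Suc)
  qed
qed

text \<open>Letters x contribute nothing, and a run of letters y telescopes to \<open>e\<close> at
  the start inverted times \<open>e\<close> at the end. For y^(3m) the endpoints coincide; for y^3 =
  x^2 they lie on the same edge.\<close>

lemma lift_eqv:
  assumes "\<rho> \<in> acts m X" "m > 0" "cocycle \<rho> F e" "s \<in> UNIV \<times> carrier F" "eqv m u v"
  shows "foldl (lift m \<rho> F e) s u = foldl (lift m \<rho> F e) s v"
  using assms(5)
proof (rule pres_eq_foldl[where D = "UNIV \<times> carrier F"])
  interpret group F using assms(3) by (simp add: cocycle_def)
  obtain \<sigma> \<tau> where \<rho>: "\<rho> = (\<sigma>, \<tau>)" by force
  have ec: "e p \<in> carrier F" for p using assms(3) by (simp add: cocycle_def)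
  note coc = assms(3)[unfolded \<rho>]
  show "foldl (lift m \<rho> F e) d u = foldl (lift m \<rho> F e) d v" if uv: "(u, v) \<in> rels m" "d \<in> UNIV \<times> carrier F" for u v d
  proof -
    obtain p f where d: "d = (p, f)" "f \<in> carrier F" using uv by auto
    have "u = pow_word gen_x (2 * m) \<and> v = [] \<or> u = pow_word gen_y (3 * m) \<and> v = [] \<or>
        u = pow_word gen_x 2 \<and> v = pow_word gen_y 3"
      using uv by (simp add: rels_def)
    moreover have "(\<sigma> ^^ (2 * m)) p = p" "(\<tau> ^^ (3 * m)) p = p" "(\<sigma> ^^ 2) p = (\<tau> ^^ 3) p"
      using assms(1) regular_permsD(2)[of \<sigma> "2 * m" X] regular_permsD(2)[of \<tau> "3 * m" X] by (simp_all add: \<rho> acts_def)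
    moreover have "e ((\<tau> ^^ 3) p) = e p"
    proof -
      have "(\<tau> ^^ 3) p = \<sigma> (\<sigma> p)"
        using actsD(3)[of \<sigma> \<tau> m X p] assms(1) by (simp add: \<rho> eval_nat_numeral)
      then show ?thesis using coc by (simp add: cocycle_def)
    qed
    moreover have "f \<otimes>\<^bsub>F\<^esub> inv\<^bsub>F\<^esub> (e p) \<otimes>\<^bsub>F\<^esub> e p = f"
      using d ec by (simp add: m_assoc)
    ultimately show ?thesis
      unfolding \<rho> d(1) by (elim disjE conjE) (simp_all only: lift_pow[OF coc d(2)] foldl_Nil)
  qed
qed (use lift_cancel[OF assms(1-3)] lift_closed[OF assms(3)] assms(4) in blast)+

lemma lift_word_inv:
  assumes "\<rho> \<in> acts m X" "m > 0" "cocycle \<rho> F e" "s \<in> UNIV \<times> carrier F"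
  shows "foldl (lift m \<rho> F e) (foldl (lift m \<rho> F e) s w) (word_inv w) = s"
  by (rule foldl_word_inv[where D = "UNIV \<times> carrier F" and S = gens])
    (use lift_cancel[OF assms(1-3)] lift_closed[OF assms(3)] assms(4) in auto)

text \<open>The lifted action multiplies on the right and so commutes with left translation; the
  contributions of closed words at \<open>b\<close> can therefore be multiplied.\<close>

lemma lift_mult_left:
  assumes "cocycle \<rho> F e" "f \<in> carrier F" "h \<in> carrier F"
  shows "foldl (lift m \<rho> F e) (p, h \<otimes>\<^bsub>F\<^esub> f) w = (run m \<rho> p w, h \<otimes>\<^bsub>F\<^esub> snd (foldl (lift m \<rho> F e) (p, f) w))"
proof -
  interpret group F using assms(1) by (simp add: cocycle_def)
  have ec: "e p \<in> carrier F" for p using assms(1) by (simp add: cocycle_def)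
  show ?thesis
    using assms(2)
  proof (induction w arbitrary: p f)
    case (Cons l w)
    let ?q = "move m \<rho> p l" and ?f = "snd (lift m \<rho> F e (p, f) l)"
    have "?f \<in> carrier F" using lift_closed[OF assms(1), of "(p, f)" m l] Cons.prems by auto
    moreover have "lift m \<rho> F e (p, h \<otimes>\<^bsub>F\<^esub> f) l = (?q, h \<otimes>\<^bsub>F\<^esub> ?f)" "lift m \<rho> F e (p, f) l = (?q, ?f)"
      using Cons.prems assms(3) ec by (simp_all add: lift_def m_assoc)
    ultimately show ?case using Cons.IH[of ?f ?q] by simp
  qed simp
qed

section \<open>Growing the spanning tree\<close>

definition orbit_index :: "('q \<Rightarrow> 'q) \<Rightarrow> 'q \<Rightarrow> 'q \<Rightarrow> nat" where
  "orbit_index f p q = (SOME i. (f ^^ i) p = q)"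

lemma orbit_index_eq: "q = (f ^^ i) p \<Longrightarrow> (f ^^ orbit_index f p q) p = q"
  unfolding orbit_index_def by (rule someI[of _ i]) simp

definition funpow_orbit :: "('q \<Rightarrow> 'q) \<Rightarrow> 'q \<Rightarrow> 'q set" where
  "funpow_orbit f p = {q. \<exists>i. q = (f ^^ i) p}"

lemma funpow_orbit_base: "p \<in> funpow_orbit f p"
  by (auto simp: funpow_orbit_def intro: exI[of _ 0])

lemma funpow_orbit_step: "q \<in> funpow_orbit f p \<Longrightarrow> f q \<in> funpow_orbit f p"
  unfolding funpow_orbit_def by (auto intro: exI[of _ "Suc i" for i])

lemma funpow_orbit_orbit_index: "q \<in> funpow_orbit f p \<Longrightarrow> (f ^^ orbit_index f p q) p = q"
  unfolding funpow_orbit_def using orbit_index_eq by fast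

lemma funpow_closed: "f ` A \<subseteq> A \<Longrightarrow> p \<in> A \<Longrightarrow> (f ^^ n) p \<in> A"
  by (induction n) auto

lemma funpow_orbit_disjoint:
  assumes "f \<in> regular_perms d X" "d > 0" "f ` A \<subseteq> A" "p \<notin> A"
  shows "funpow_orbit f p \<inter> A = {}"
proof (rule ccontr)
  assume "funpow_orbit f p \<inter> A \<noteq> {}"
  then obtain i where i: "(f ^^ i) p \<in> A" by (auto simp: funpow_orbit_def)
  define n where "n = i * (d - 1)"
  have "n + i = i * d" using assms(2) by (simp add: n_def algebra_simps)
  then have "(f ^^ (n + i)) p = p"
    using regular_perms_funpow_mod[OF assms(1), of "n + i" p] by simp
  moreover have "(f ^^ n) ((f ^^ i) p) \<in> A" by (rule funpow_closed[OF assms(3) i])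
  ultimately show False using assms(4) by (simp add: funpow_add)
qed

text \<open>A partial spanning tree of the graph whose vertices are the orbits of \<open>x\<close> and of \<open>y\<close> and whose
  edges are the orbits of \<open>x\<^sup>2 = y\<^sup>3\<close>. The sets \<open>A\<close> and \<open>B\<close> are the unions of the \<open>x\<close>-orbits and of the
  \<open>y\<close>-orbits reached so far, \<open>T\<close> is the union of the edges of the tree, and \<open>g\<close> and \<open>k\<close> give for each
  point the words that lead to it from \<open>b\<close> in the tree, ending with letters \<open>x\<close> and \<open>y\<close>, respectively.
  The last condition says that cocycles that are trivial on \<open>T\<close> are trivial along the tree.\<close>

definition tree :: "'f itself \<Rightarrow> nat \<Rightarrow> ('q \<Rightarrow> 'q) \<times> ('q \<Rightarrow> 'q) \<Rightarrow> 'q set \<Rightarrow> 'q \<Rightarrow> 'q set \<Rightarrow> 'q set \<Rightarrow> 'q set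
    \<Rightarrow> ('q \<Rightarrow> generator word) \<Rightarrow> ('q \<Rightarrow> generator word) \<Rightarrow> bool" where
  "tree _ m \<rho> X b A B T g k \<longleftrightarrow>
     b \<in> A \<and> A \<subseteq> X \<and> B \<subseteq> X \<and> T \<subseteq> A \<inter> B \<and> fst \<rho> ` A \<subseteq> A \<and> snd \<rho> ` B \<subseteq> B \<and>
     (\<forall>p. fst \<rho> (fst \<rho> p) \<in> T \<longleftrightarrow> p \<in> T) \<and> eqv m (g b) [] \<and>
     (\<forall>p\<in>A. eqv m (g (fst \<rho> p)) (g p @ [(gen_x, True)])) \<and>
     (\<forall>p\<in>B. eqv m (k (snd \<rho> p)) (k p @ [(gen_y, True)])) \<and>
     (\<forall>p\<in>T. eqv m (g p) (k p)) \<and>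
     (\<forall>(F :: 'f monoid) e. cocycle \<rho> F e \<and> (\<forall>p\<in>T. e p = \<one>\<^bsub>F\<^esub>) \<longrightarrow>
       (\<forall>p\<in>A. foldl (lift m \<rho> F e) (b, \<one>\<^bsub>F\<^esub>) (g p) = (p, \<one>\<^bsub>F\<^esub>)) \<and>
       (\<forall>p\<in>B. foldl (lift m \<rho> F e) (b, \<one>\<^bsub>F\<^esub>) (k p) = (p, e p)))"

lemma treeD:
  assumes t: "tree TYPE('f) m (\<sigma>, \<tau>) X b A B T g k"
  shows "b \<in> A" "A \<subseteq> X" "B \<subseteq> X" "T \<subseteq> A \<inter> B" "\<sigma> ` A \<subseteq> A" "\<tau> ` B \<subseteq> B"
    and "\<And>p. \<sigma> (\<sigma> p) \<in> T \<longleftrightarrow> p \<in> T" and "eqv m (g b) []"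
    and "\<And>p. p \<in> A \<Longrightarrow> eqv m (g (\<sigma> p)) (g p @ [(gen_x, True)])"
    and "\<And>p. p \<in> B \<Longrightarrow> eqv m (k (\<tau> p)) (k p @ [(gen_y, True)])"
    and "\<And>p. p \<in> T \<Longrightarrow> eqv m (g p) (k p)"
    and "\<And>(F :: 'f monoid) e. cocycle (\<sigma>, \<tau>) F e \<Longrightarrow> (\<forall>p\<in>T. e p = \<one>\<^bsub>F\<^esub>) \<Longrightarrow>
       (\<forall>p\<in>A. foldl (lift m (\<sigma>, \<tau>) F e) (b, \<one>\<^bsub>F\<^esub>) (g p) = (p, \<one>\<^bsub>F\<^esub>)) \<and>
       (\<forall>p\<in>B. foldl (lift m (\<sigma>, \<tau>) F e) (b, \<one>\<^bsub>F\<^esub>) (k p) = (p, e p))"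
  using t unfolding tree_def fst_conv snd_conv by blast+

lemma word_funpow:
  assumes "\<And>p. p \<in> B \<Longrightarrow> eqv m (k (\<tau> p)) (k p @ [(a, True)])" "\<tau> ` B \<subseteq> B" "p \<in> B"
  shows "eqv m (k ((\<tau> ^^ n) p)) (k p @ pow_word a n)"
proof (induction n)
  case 0
  then show ?case by (simp add: pres_eq.refl)
next
  case (Suc n)
  have "eqv m (k (\<tau> ((\<tau> ^^ n) p))) (k ((\<tau> ^^ n) p) @ [(a, True)])"
    by (rule assms(1)[OF funpow_closed[OF assms(2,3)]])
  also have "eqv m \<dots> ((k p @ pow_word a n) @ [(a, True)])"
    using Suc by (rule eqv_append_rightI)
  finally (pres_eq.trans) show ?case by (simp add: replicate_append_same)
qed

lemma orbit_words_step:
  assumes "(\<sigma>, \<tau>) \<in> acts m X" "m > 0" "p \<in> X"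
  shows "q \<in> funpow_orbit \<sigma> p \<Longrightarrow>
      eqv m (w @ pow_word gen_x (orbit_index \<sigma> p (\<sigma> q))) ((w @ pow_word gen_x (orbit_index \<sigma> p q)) @ [(gen_x, True)])"
    and "q \<in> funpow_orbit \<tau> p \<Longrightarrow>
      eqv m (w @ pow_word gen_y (orbit_index \<tau> p (\<tau> q))) ((w @ pow_word gen_y (orbit_index \<tau> p q)) @ [(gen_y, True)])"
proof -
  show "eqv m (w @ pow_word gen_x (orbit_index \<sigma> p (\<sigma> q))) ((w @ pow_word gen_x (orbit_index \<sigma> p q)) @ [(gen_x, True)])"
    if q: "q \<in> funpow_orbit \<sigma> p"
  proof -
    have "(\<sigma> ^^ orbit_index \<sigma> p (\<sigma> q)) p = (\<sigma> ^^ Suc (orbit_index \<sigma> p q)) p"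
      using funpow_orbit_orbit_index[OF q] funpow_orbit_orbit_index[OF funpow_orbit_step[OF q]] by simp
    then have "eqv m (w @ pow_word gen_x (orbit_index \<sigma> p (\<sigma> q))) (w @ pow_word gen_x (Suc (orbit_index \<sigma> p q)))"
      by (intro eqv_appendI pow_word_eqv(1)[OF assms])
    then show ?thesis by (simp only: pow_word_Suc append_assoc)
  qed
  show "eqv m (w @ pow_word gen_y (orbit_index \<tau> p (\<tau> q))) ((w @ pow_word gen_y (orbit_index \<tau> p q)) @ [(gen_y, True)])"
    if q: "q \<in> funpow_orbit \<tau> p"
  proof -
    have "(\<tau> ^^ orbit_index \<tau> p (\<tau> q)) p = (\<tau> ^^ Suc (orbit_index \<tau> p q)) p"
      using funpow_orbit_orbit_index[OF q] funpow_orbit_orbit_index[OF funpow_orbit_step[OF q]] by simp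
    then have "eqv m (w @ pow_word gen_y (orbit_index \<tau> p (\<tau> q))) (w @ pow_word gen_y (Suc (orbit_index \<tau> p q)))"
      by (intro eqv_appendI pow_word_eqv(2)[OF assms])
    then show ?thesis by (simp only: pow_word_Suc append_assoc)
  qed
qed

text \<open>Nonnegative powers exhaust the orbit, as the permutation has finite order. In an action
  this is also the orbit of y^3.\<close>

definition edge :: "('q \<Rightarrow> 'q) \<Rightarrow> 'q \<Rightarrow> 'q set" where
  "edge \<sigma> p = {q. \<exists>i. q = (\<sigma> ^^ (2 * i)) p}"

lemma edge_base: "p \<in> edge \<sigma> p"
  by (auto simp: edge_def intro: exI[of _ 0])

lemma edge_subset_orbits:
  assumes "(\<sigma>, \<tau>) \<in> acts m X"
  shows "edge \<sigma> p \<subseteq> funpow_orbit \<sigma> p" "edge \<sigma> p \<subseteq> funpow_orbit \<tau> p"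
proof -
  show "edge \<sigma> p \<subseteq> funpow_orbit \<sigma> p" by (auto simp: edge_def funpow_orbit_def)
  show "edge \<sigma> p \<subseteq> funpow_orbit \<tau> p"
    unfolding edge_def funpow_orbit_def square_cube[OF assms] by auto
qed

lemma edge_step_iff:
  assumes "(\<sigma>, \<tau>) \<in> acts m X" "m > 0"
  shows "\<sigma> (\<sigma> q) \<in> edge \<sigma> p \<longleftrightarrow> q \<in> edge \<sigma> p"
proof
  assume "q \<in> edge \<sigma> p"
  then obtain i where "q = (\<sigma> ^^ (2 * i)) p" by (auto simp: edge_def)
  then have "\<sigma> (\<sigma> q) = (\<sigma> ^^ (2 * Suc i)) p" by simp
  then show "\<sigma> (\<sigma> q) \<in> edge \<sigma> p" unfolding edge_def by blast
next
  assume "\<sigma> (\<sigma> q) \<in> edge \<sigma> p"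
  then obtain i where i: "\<sigma> (\<sigma> q) = (\<sigma> ^^ (2 * i)) p" by (auto simp: edge_def)
  note c = actsD(1)[OF assms(1)]
  \<comment> \<open>One step back from exponent \<open>2 * i\<close>, with a full turn of
    \<open>2 * m\<close> added to keep the exponent nonnegative.\<close>
  define j where "j = i + m - 1"
  have "\<sigma> (\<sigma> ((\<sigma> ^^ (2 * j)) p)) = (\<sigma> ^^ (2 * Suc j)) p" by simp
  also have "2 * Suc j = 2 * i + 2 * m" using assms(2) by (simp add: j_def)
  also have "(\<sigma> ^^ (2 * i + 2 * m)) p = \<sigma> (\<sigma> q)" using regular_permsD(2)[OF c] i by (simp add: funpow_add)
  finally have "q = (\<sigma> ^^ (2 * j)) p"
    using permutes_inj[OF regular_permsD(1)[OF c]] by (auto dest: injD)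
  then show "q \<in> edge \<sigma> p" unfolding edge_def by blast
qed

text \<open>Along an edge, moving by x or by y gives the same group element since x^2 = y^3. The two
  mixed forms serve the attachment of a new x-orbit and of a new y-orbit.\<close>

lemma edge_words:
  assumes "(\<sigma>, \<tau>) \<in> acts m X" "m > 0" "p \<in> X" "q \<in> edge \<sigma> p"
  obtains i where "q = (\<sigma> ^^ (2 * i)) p" "q = (\<tau> ^^ (3 * i)) p"
    "eqv m (pow_word gen_x (orbit_index \<sigma> p q)) (pow_word gen_y (3 * i))"
    "eqv m (pow_word gen_x (2 * i)) (pow_word gen_y (orbit_index \<tau> p q))"
proof -
  obtain i where i: "q = (\<sigma> ^^ (2 * i)) p" using assms(4) by (auto simp: edge_def)
  then have j: "q = (\<tau> ^^ (3 * i)) p" using square_cube[OF assms(1)] by simp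
  have "eqv m (pow_word gen_x (orbit_index \<sigma> p q)) (pow_word gen_x (2 * i))"
    using orbit_index_eq[OF i] i by (intro pow_word_eqv(1)[OF assms(1-3)]) simp
  moreover have "eqv m (pow_word gen_y (3 * i)) (pow_word gen_y (orbit_index \<tau> p q))"
    using orbit_index_eq[OF j] j by (intro pow_word_eqv(2)[OF assms(1-3)]) simp
  ultimately show thesis
    using that[OF i j] square_cube_word[of m i] by (blast intro: pres_eq.trans)
qed

text \<open>The new x-orbit is hooked to the tree by the edge through \<open>p\<close>: its words
  run to \<open>p\<close> by \<open>k p\<close> and continue with letters x. The contribution
  \<open>e p\<close> of \<open>k p\<close> vanishes since \<open>p\<close> now lies in the
  tree.\<close>

lemma tree_extend_x:
  assumes a: "(\<sigma>, \<tau>) \<in> acts m X" "m > 0" and t: "tree TYPE('f) m (\<sigma>, \<tau>) X b A B T g k"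
    and p: "p \<in> B" "p \<notin> A"
  shows "\<exists>T' g'. tree TYPE('f) m (\<sigma>, \<tau>) X b (A \<union> funpow_orbit \<sigma> p) B T' g' k"
proof -
  let ?O = "funpow_orbit \<sigma> p" and ?Z = "edge \<sigma> p"
  define g' where "g' q = (if q \<in> ?O then k p @ pow_word gen_x (orbit_index \<sigma> p q) else g q)" for q
  note t1 = treeD(1-6)[OF t] and t2 = treeD(7)[OF t] and t3 = treeD(8)[OF t] and t4 = treeD(9)[OF t]
    and t5 = treeD(10)[OF t] and t6 = treeD(11)[OF t] and t7 = treeD(12)[OF t]
  have pX: "p \<in> X" using p t1 by blast
  have disj: "?O \<inter> A = {}"
    using a(2) by (intro funpow_orbit_disjoint[OF actsD(1)[OF a(1)] _ t1(5) p(2)]) simp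
  have OX: "?O \<subseteq> X" using regular_perms_funpow_in[OF actsD(1)[OF a(1)]] pX by (auto simp: funpow_orbit_def)
  have ZO: "?Z \<subseteq> ?O" by (rule edge_subset_orbits(1)[OF a(1)])
  have ZB: "?Z \<subseteq> B"
    using edge_subset_orbits(2)[OF a(1), of p] funpow_closed[OF t1(6) p(1)] by (auto simp: funpow_orbit_def)
  have g'A: "g' q = g q" if "q \<in> A" for q using that disj by (auto simp: g'_def)
  have "tree TYPE('f) m (\<sigma>, \<tau>) X b (A \<union> ?O) B (T \<union> ?Z) g' k"
    unfolding tree_def fst_conv snd_conv
  proof (intro conjI allI impI ballI)
    show "b \<in> A \<union> ?O" "A \<union> ?O \<subseteq> X" "B \<subseteq> X" "T \<union> ?Z \<subseteq> (A \<union> ?O) \<inter> B" "\<tau> ` B \<subseteq> B"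
      using t1 OX ZO ZB by auto
    show "\<sigma> ` (A \<union> ?O) \<subseteq> A \<union> ?O" using t1(5) funpow_orbit_step[of _ \<sigma> p] by auto
    show "\<sigma> (\<sigma> q) \<in> T \<union> ?Z \<longleftrightarrow> q \<in> T \<union> ?Z" for q using t2 edge_step_iff[OF a] by simp
    show "eqv m (g' b) []" using t3 g'A t1(1) by simp
    show "eqv m (k (\<tau> q)) (k q @ [(gen_y, True)])" if "q \<in> B" for q by (rule t5[OF that])
    show "eqv m (g' (\<sigma> q)) (g' q @ [(gen_x, True)])" if "q \<in> A \<union> ?O" for q
    proof (cases "q \<in> ?O")
      case True
      then show ?thesis using orbit_words_step(1)[OF a pX True] funpow_orbit_step[OF True] by (simp add: g'_def)
    next
      case False
      then have "q \<in> A" "\<sigma> q \<in> A" using that t1(5) by auto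
      then show ?thesis using t4 g'A by simp
    qed
    show "eqv m (g' q) (k q)" if "q \<in> T \<union> ?Z" for q
    proof (cases "q \<in> ?Z")
      case True
      then obtain i where i: "q = (\<tau> ^^ (3 * i)) p" "eqv m (pow_word gen_x (orbit_index \<sigma> p q)) (pow_word gen_y (3 * i))"
        by (rule edge_words[OF a pX])
      have "eqv m (g' q) (k p @ pow_word gen_y (3 * i))"
        using True ZO eqv_appendI[OF i(2)] by (auto simp: g'_def)
      moreover have "eqv m (k q) (k p @ pow_word gen_y (3 * i))"
        unfolding i(1) using t5 t1(6) p(1) by (rule word_funpow)
      ultimately show ?thesis by (blast intro: pres_eq.trans pres_eq.sym)
    next
      case False
      then have "q \<in> T" "q \<in> A" using that t1(4) by auto
      then show ?thesis using t6 g'A by simp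
    qed
    fix F :: "'f monoid" and e assume "cocycle (\<sigma>, \<tau>) F e \<and> (\<forall>p\<in>T \<union> ?Z. e p = \<one>\<^bsub>F\<^esub>)"
    then have c: "cocycle (\<sigma>, \<tau>) F e" and eT: "\<forall>p\<in>T. e p = \<one>\<^bsub>F\<^esub>" and ep: "e p = \<one>\<^bsub>F\<^esub>"
      using edge_base[of p \<sigma>] by blast+
    from c have "e p \<in> carrier F" unfolding cocycle_def by blast
    note c7 = t7[OF c eT]
    show "foldl (lift m (\<sigma>, \<tau>) F e) (b, \<one>\<^bsub>F\<^esub>) (k q) = (q, e q)" if "q \<in> B" for q using c7 that by blast
    show "foldl (lift m (\<sigma>, \<tau>) F e) (b, \<one>\<^bsub>F\<^esub>) (g' q) = (q, \<one>\<^bsub>F\<^esub>)" if "q \<in> A \<union> ?O" for q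
    proof (cases "q \<in> ?O")
      case True
      have "foldl (lift m (\<sigma>, \<tau>) F e) (b, \<one>\<^bsub>F\<^esub>) (k p) = (p, e p)" using c7 p(1) by blast
      then show ?thesis
        using True lift_pow(1)[OF c \<open>e p \<in> carrier F\<close>] funpow_orbit_orbit_index[OF True] ep by (simp add: g'_def)
    next
      case False
      then show ?thesis using c7 that g'A by auto
    qed
  qed
  then show ?thesis by blast
qed

text \<open>The mirror image, except that letters y do contribute: from \<open>p\<close>, where
  \<open>e\<close> is trivial, to \<open>q\<close> they yield exactly \<open>e q\<close>.\<close>

lemma tree_extend_y:
  assumes a: "(\<sigma>, \<tau>) \<in> acts m X" "m > 0" and t: "tree TYPE('f) m (\<sigma>, \<tau>) X b A B T g k"
    and p: "p \<in> A" "p \<notin> B"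
  shows "\<exists>T' k'. tree TYPE('f) m (\<sigma>, \<tau>) X b A (B \<union> funpow_orbit \<tau> p) T' g k'"
proof -
  let ?O = "funpow_orbit \<tau> p" and ?Z = "edge \<sigma> p"
  define k' where "k' q = (if q \<in> ?O then g p @ pow_word gen_y (orbit_index \<tau> p q) else k q)" for q
  note t1 = treeD(1-6)[OF t] and t2 = treeD(7)[OF t] and t3 = treeD(8)[OF t] and t4 = treeD(9)[OF t]
    and t5 = treeD(10)[OF t] and t6 = treeD(11)[OF t] and t7 = treeD(12)[OF t]
  have pX: "p \<in> X" using p t1 by blast
  have disj: "?O \<inter> B = {}"
    using a(2) by (intro funpow_orbit_disjoint[OF actsD(2)[OF a(1)] _ t1(6) p(2)]) simp
  have OX: "?O \<subseteq> X" using regular_perms_funpow_in[OF actsD(2)[OF a(1)]] pX by (auto simp: funpow_orbit_def)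
  have ZO: "?Z \<subseteq> ?O" by (rule edge_subset_orbits(2)[OF a(1)])
  have ZA: "?Z \<subseteq> A"
    using edge_subset_orbits(1)[OF a(1), of p] funpow_closed[OF t1(5) p(1)] by (auto simp: funpow_orbit_def)
  have k'B: "k' q = k q" if "q \<in> B" for q using that disj by (auto simp: k'_def)
  have "tree TYPE('f) m (\<sigma>, \<tau>) X b A (B \<union> ?O) (T \<union> ?Z) g k'"
    unfolding tree_def fst_conv snd_conv
  proof (intro conjI allI impI ballI)
    show "b \<in> A" "A \<subseteq> X" "B \<union> ?O \<subseteq> X" "T \<union> ?Z \<subseteq> A \<inter> (B \<union> ?O)" "\<sigma> ` A \<subseteq> A"
      using t1 OX ZO ZA by auto
    show "\<tau> ` (B \<union> ?O) \<subseteq> B \<union> ?O" using t1(6) funpow_orbit_step[of _ \<tau> p] by auto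
    show "\<sigma> (\<sigma> q) \<in> T \<union> ?Z \<longleftrightarrow> q \<in> T \<union> ?Z" for q using t2 edge_step_iff[OF a] by simp
    show "eqv m (g b) []" by (rule t3)
    show "eqv m (g (\<sigma> q)) (g q @ [(gen_x, True)])" if "q \<in> A" for q by (rule t4[OF that])
    show "eqv m (k' (\<tau> q)) (k' q @ [(gen_y, True)])" if "q \<in> B \<union> ?O" for q
    proof (cases "q \<in> ?O")
      case True
      then show ?thesis using orbit_words_step(2)[OF a pX True] funpow_orbit_step[OF True] by (simp add: k'_def)
    next
      case False
      then have "q \<in> B" "\<tau> q \<in> B" using that t1(6) by auto
      then show ?thesis using t5 k'B by simp
    qed
    show "eqv m (g q) (k' q)" if "q \<in> T \<union> ?Z" for q
    proof (cases "q \<in> ?Z")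
      case True
      then obtain i where i: "q = (\<sigma> ^^ (2 * i)) p" "eqv m (pow_word gen_x (2 * i)) (pow_word gen_y (orbit_index \<tau> p q))"
        by (rule edge_words[OF a pX])
      have "eqv m (g p @ pow_word gen_x (2 * i)) (k' q)"
        using True ZO eqv_appendI[OF i(2)] by (auto simp: k'_def)
      moreover have "eqv m (g q) (g p @ pow_word gen_x (2 * i))"
        unfolding i(1) using t4 t1(5) p(1) by (rule word_funpow)
      ultimately show ?thesis by (blast intro: pres_eq.trans)
    next
      case False
      then have "q \<in> T" "q \<in> B" using that t1(4) by auto
      then show ?thesis using t6 k'B by simp
    qed
    fix F :: "'f monoid" and e assume "cocycle (\<sigma>, \<tau>) F e \<and> (\<forall>p\<in>T \<union> ?Z. e p = \<one>\<^bsub>F\<^esub>)"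
    then have c: "cocycle (\<sigma>, \<tau>) F e" and eT: "\<forall>p\<in>T. e p = \<one>\<^bsub>F\<^esub>" and ep: "e p = \<one>\<^bsub>F\<^esub>"
      using edge_base[of p \<sigma>] by blast+
    interpret group F using c by (simp add: cocycle_def)
    have ec: "e q \<in> carrier F" for q using c by (simp add: cocycle_def)
    note c7 = t7[OF c eT]
    show "foldl (lift m (\<sigma>, \<tau>) F e) (b, \<one>\<^bsub>F\<^esub>) (g q) = (q, \<one>\<^bsub>F\<^esub>)" if "q \<in> A" for q using c7 that by blast
    show "foldl (lift m (\<sigma>, \<tau>) F e) (b, \<one>\<^bsub>F\<^esub>) (k' q) = (q, e q)" if "q \<in> B \<union> ?O" for q
    proof (cases "q \<in> ?O")
      case True
      have "foldl (lift m (\<sigma>, \<tau>) F e) (b, \<one>\<^bsub>F\<^esub>) (g p) = (p, \<one>\<^bsub>F\<^esub>)" using c7 p(1) by blast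
      then show ?thesis
        using True lift_pow(2)[OF c one_closed] funpow_orbit_orbit_index[OF True] ep ec by (simp add: k'_def)
    next
      case False
      then show ?thesis using c7 that k'B by auto
    qed
  qed
  then show ?thesis by blast
qed

lemma tree_start:
  assumes a: "(\<sigma>, \<tau>) \<in> acts m X" "m > 0" "b \<in> X"
  shows "\<exists>g k. tree TYPE('f) m (\<sigma>, \<tau>) X b (funpow_orbit \<sigma> b) {} {} g k"
proof -
  define g where "g q = pow_word gen_x (orbit_index \<sigma> b q)" for q
  have "tree TYPE('f) m (\<sigma>, \<tau>) X b (funpow_orbit \<sigma> b) {} {} g (\<lambda>_. [])"
    unfolding tree_def fst_conv snd_conv
  proof (intro conjI allI impI ballI)
    show "funpow_orbit \<sigma> b \<subseteq> X" using regular_perms_funpow_in[OF actsD(1)[OF a(1)]] a(3) by (auto simp: funpow_orbit_def)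
    show "\<sigma> ` funpow_orbit \<sigma> b \<subseteq> funpow_orbit \<sigma> b" using funpow_orbit_step by auto
    show "eqv m (g b) []"
      using pow_word_eqv(1)[OF a, of "orbit_index \<sigma> b b" 0] funpow_orbit_orbit_index[OF funpow_orbit_base[of b \<sigma>]] by (simp add: g_def)
    show "eqv m (g (\<sigma> p)) (g p @ [(gen_x, True)])" if "p \<in> funpow_orbit \<sigma> b" for p
      using orbit_words_step(1)[OF a that, of "[]"] by (simp add: g_def)
    fix F :: "'f monoid" and e p assume *: "cocycle (\<sigma>, \<tau>) F e \<and> (\<forall>p\<in>{}. e p = \<one>\<^bsub>F\<^esub>)"
      and p: "p \<in> funpow_orbit \<sigma> b"
    then interpret group F by (simp add: cocycle_def)
    show "foldl (lift m (\<sigma>, \<tau>) F e) (b, \<one>\<^bsub>F\<^esub>) (g p) = (p, \<one>\<^bsub>F\<^esub>)"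
      using * lift_pow(1)[of \<sigma> \<tau> F e "\<one>\<^bsub>F\<^esub>"] funpow_orbit_orbit_index[OF p] by (simp add: g_def)
  qed (auto intro: funpow_orbit_base)
  then show ?thesis by blast
qed

text \<open>Grow the tree while some point belongs to only one of \<open>A\<close> and
  \<open>B\<close>. When they agree, the set is invariant under both generators and is everything by
  transitivity.\<close>

lemma spanning_tree_exists:
  assumes a: "(\<sigma>, \<tau>) \<in> trans_acts m X b" "m > 0" and X: "finite X"
  shows "\<exists>T g k. tree TYPE('f) m (\<sigma>, \<tau>) X b X X T g k"
proof -
  have acts: "(\<sigma>, \<tau>) \<in> acts m X" and ran: "range (run m (\<sigma>, \<tau>) b) = X"
    using a(1) by (auto simp: trans_acts_def)
  have "b \<in> X" using ran by (metis foldl_Nil rangeI)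
  have grow: "\<exists>T g k. tree TYPE('f) m (\<sigma>, \<tau>) X b X X T g k" if "tree TYPE('f) m (\<sigma>, \<tau>) X b A B T g k" for A B T g k
    using that
  proof (induction "card (X - A) + card (X - B)" arbitrary: A B T g k rule: less_induct)
    case less
    have sub: "b \<in> A" "A \<subseteq> X" "B \<subseteq> X" "\<sigma> ` A \<subseteq> A" "\<tau> ` B \<subseteq> B"
      using less.prems unfolding tree_def by auto
    have shrink: "card (X - (C \<union> funpow_orbit f p)) < card (X - C)" if "p \<in> X" "p \<notin> C" for C p f
      using that X funpow_orbit_base[of p f] by (intro psubset_card_mono) auto
    consider p where "p \<in> B" "p \<notin> A" | p where "p \<in> A" "p \<notin> B" | "A = B" by blast
    then show ?case
    proof cases
      case 1
      then show ?thesis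
        using tree_extend_x[OF acts a(2) less.prems 1] less.hyps shrink[of p A \<sigma>] sub
        by (metis add_less_mono1 subsetD)
    next
      case 2
      then show ?thesis
        using tree_extend_y[OF acts a(2) less.prems 2] less.hyps shrink[of p B \<tau>] sub
        by (metis add_less_cancel_left subsetD)
    next
      case 3
      have "move m (\<sigma>, \<tau>) p l \<in> A" if "p \<in> A" for p l
        using funpow_closed[OF sub(4) that] funpow_closed[OF sub(5), of p] that sub(4,5) 3
        by (cases l; cases "fst l") auto
      then have "run m (\<sigma>, \<tau>) p w \<in> A" if "p \<in> A" for p w
        using that by (induction w arbitrary: p) auto
      then have "X \<subseteq> A" using ran sub(1) by blast
      then have "A = X" using sub(2) by blast
      then show ?thesis using less.prems 3 by blast
    qed
  qed
  show ?thesis using tree_start[OF acts a(2) \<open>b \<in> X\<close>] grow by blast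
qed

section \<open>The isomorphism between a free group and the stabilizer\<close>

lemma edge_eq:
  assumes "(\<sigma>, \<tau>) \<in> acts m X" "m > 0" "q \<in> edge \<sigma> p"
  shows "edge \<sigma> q = edge \<sigma> p"
proof -
  have sub: "edge \<sigma> q \<subseteq> edge \<sigma> p" if "q \<in> edge \<sigma> p" for p q
  proof
    fix r assume "r \<in> edge \<sigma> q"
    then obtain i j where "r = (\<sigma> ^^ (2 * j)) ((\<sigma> ^^ (2 * i)) p)" using \<open>q \<in> edge \<sigma> p\<close> by (auto simp: edge_def)
    then have "r = (\<sigma> ^^ (2 * (j + i))) p" by (simp add: funpow_add distrib_left)
    then show "r \<in> edge \<sigma> p" unfolding edge_def by blast
  qed
  obtain i where i: "q = (\<sigma> ^^ (2 * i)) p" using assms(3) by (auto simp: edge_def)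
  \<comment> \<open>As \<open>j + i\<close> is a multiple of \<open>m\<close>, the power
    \<open>2 * j\<close> of \<open>\<sigma>\<close> undoes the power \<open>2 * i\<close>.\<close>
  define j where "j = i * (m - 1)"
  have "j + i = i * m" using assms(2) by (simp add: j_def algebra_simps)
  then have "2 * j + 2 * i = i * (2 * m)" by simp
  moreover have "(\<sigma> ^^ (i * (2 * m))) p = p"
    using regular_perms_funpow_mod[OF actsD(1)[OF assms(1)], of "i * (2 * m)" p] by simp
  ultimately have "p = (\<sigma> ^^ (2 * j)) q" by (simp add: i flip: funpow_add comp_apply[of "\<sigma> ^^ (2 * j)"])
  then have "p \<in> edge \<sigma> q" unfolding edge_def by blast
  with sub assms(3) show ?thesis by blast
qed

text \<open>Used for a letter y from p to q: \<open>A\<close> and \<open>A'\<close> are the classes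
  of \<open>g p\<close> and \<open>g q\<close>, \<open>B\<close> that of \<open>k p\<close>, and
  \<open>L\<close> the letter, so \<open>B\<close> times \<open>L\<close> is the class of
  \<open>k q\<close>.\<close>

lemma (in group) tree_step:
  assumes "P \<in> carrier G" "A \<in> carrier G" "B \<in> carrier G" "A' \<in> carrier G" "L \<in> carrier G"
  shows "P \<otimes> inv (B \<otimes> inv A) \<otimes> (B \<otimes> L \<otimes> inv A') \<otimes> A' = P \<otimes> A \<otimes> L"
proof -
  have cancel: "inv x \<otimes> (x \<otimes> y) = y" if "x \<in> carrier G" "y \<in> carrier G" for x y
    using that by (simp flip: m_assoc)
  have "P \<otimes> inv (B \<otimes> inv A) \<otimes> (B \<otimes> L \<otimes> inv A') \<otimes> A'
      = P \<otimes> (A \<otimes> (inv B \<otimes> (B \<otimes> (L \<otimes> (inv A' \<otimes> A')))))"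
    using assms by (simp add: inv_mult_group m_assoc del: l_inv)
  then show ?thesis using assms by (simp add: cancel m_assoc)
qed

lemma (in group) mult_inv_mult_right:
  assumes "A \<in> carrier G" "B \<in> carrier G" "Z \<in> carrier G"
  shows "A \<otimes> Z \<otimes> inv (B \<otimes> Z) = A \<otimes> inv B"
proof -
  have "Z \<otimes> (inv Z \<otimes> inv B) = inv B" using assms by (simp flip: m_assoc)
  then show ?thesis using assms by (simp add: inv_mult_group m_assoc)
qed

lemma words_step:
  assumes a: "\<rho> \<in> acts m X" "m > 0"
    and step: "\<And>p. p \<in> X \<Longrightarrow> eqv m (g (move m \<rho> p (c, True))) (g p @ [(c, True)])" and p: "p \<in> X"
  shows "eqv m (g (move m \<rho> p (c, i))) (g p @ [(c, i)])"
proof (cases i)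
  case True
  then show ?thesis using step p by simp
next
  case False
  let ?q = "move m \<rho> p (c, False)"
  have "?q \<in> X" "move m \<rho> ?q (c, True) = p"
    using p move_in[OF a(1)] move_cancel[OF a, of p c False] by simp_all
  then have "eqv m (g p) (g ?q @ [(c, True)])" using step[of ?q] by simp
  then have "eqv m (g p @ [(c, False)]) ((g ?q @ [(c, True)]) @ [(c, False)])" by (rule eqv_append_rightI)
  also have "(g ?q @ [(c, True)]) @ [(c, False)] = g ?q @ [(c, True), (c, False)]" by simp
  also have "eqv m \<dots> (g ?q @ [])"
    using pres_eq.cancel[of c gens "rels m" True] by (intro eqv_appendI) (simp add: gens_UNIV)
  finally (pres_eq.trans) show ?thesis using False by (simp add: pres_eq.sym)
qed

text \<open>The free generators are the closed words \<open>k p\<close> followed by the inverse of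
  \<open>g p\<close>, one for each edge outside the tree. The map \<psi> from the abstract free
  group sends labels to them. It is inverted by the lifted action, which recovers an element of the
  free group from any closed word.\<close>

lemma stab_free:
  assumes tr: "\<rho> \<in> trans_acts m X b" and m: "m > 0" and X: "finite X"
  shows "is_free_group (Gamma3 m\<lparr>carrier := stab m \<rho> b\<rparr>)"
proof -
  obtain \<sigma> \<tau> where \<rho>: "\<rho> = (\<sigma>, \<tau>)" by force
  have a: "\<rho> \<in> acts m X" and ran: "range (run m \<rho> b) = X" using tr by (auto simp: trans_acts_def)
  note a' = a[unfolded \<rho>]
  obtain T g k where t: "tree TYPE((generator word set \<times> bool) list set) m (\<sigma>, \<tau>) X b X X T g k"
    using spanning_tree_exists[OF tr[unfolded \<rho>] m X, where 'f = "(generator word set \<times> bool) list set"]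
    by (elim exE)
  note sX = treeD(5,6)[OF t] and T = treeD(7)[OF t] and gb = treeD(8)[OF t] and g_step = treeD(9)[OF t]
    and k_step = treeD(10)[OF t] and gk = treeD(11)[OF t] and coc = treeD(12)[OF t]
  have edge_X: "edge \<sigma> p \<subseteq> X" if "p \<in> X" for p
    using regular_perms_funpow_in[OF actsD(1)[OF a']] that by (auto simp: edge_def)
  have XX: "\<sigma> (\<sigma> p) \<in> X \<longleftrightarrow> p \<in> X" for p using regular_perms_in[OF actsD(1)[OF a']] by simp
  interpret \<Gamma>: group "Gamma3 m" by (rule group_Gamma3)
  have clc: "cl m u \<in> carrier (Gamma3 m)" for u by (simp add: Gamma3_simps)
  define rep where "rep p = (SOME q. q \<in> edge \<sigma> p)" for p
  have rep: "rep p \<in> edge \<sigma> p" for p unfolding rep_def by (rule someI[of _ p]) (rule edge_base)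
  \<comment> \<open>The notion of free group asks for basis names in the element type of the group.
    The class of the tree word to a chosen point of the edge is such a name, and it determines the
    edge because the word ends at that point.\<close>
  define lab where "lab p = cl m (g (rep p))" for p
  define S where "S = lab ` (X - T)"
  let ?F = "free_group S"
  interpret F: group ?F unfolding free_group_def by (rule group_presented_group)
  \<comment> \<open>Edges outside the tree carry their generators, and the identity everywhere else
    makes \<open>e\<close> trivial along the tree.\<close>
  define e where "e p = pcl S {} (if p \<in> X - T then [(lab p, True)] else [])" for p
  have one_F: "\<one>\<^bsub>?F\<^esub> = pcl S {} []" by (simp add: free_group_def one_presented)
  have ec: "e p \<in> carrier ?F" for p
  proof -
    have "(if p \<in> X - T then [(lab p, True)] else []) \<in> words S"
      unfolding S_def by (cases "p \<in> X - T") (simp_all del: Diff_iff)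
    then show ?thesis unfolding e_def free_group_def by (rule pcl_carrier)
  qed
  have "edge \<sigma> (\<sigma> (\<sigma> p)) = edge \<sigma> p" for p
    by (rule edge_eq[OF a' m edge_step_iff[OF a' m, THEN iffD2, OF edge_base]])
  then have "rep (\<sigma> (\<sigma> p)) = rep p" for p by (simp only: rep_def)
  then have "e (\<sigma> (\<sigma> p)) = e p" for p by (simp only: e_def lab_def Diff_iff T XX)
  then have c: "cocycle \<rho> ?F e"
    using ec F.group_axioms by (simp add: cocycle_def \<rho>)
  have eT: "e p = \<one>\<^bsub>?F\<^esub>" if "p \<in> T" for p using that by (simp add: e_def one_F)
  let ?L = "foldl (lift m \<rho> ?F e)"
  have "(\<forall>p\<in>X. ?L (b, \<one>\<^bsub>?F\<^esub>) (g p) = (p, \<one>\<^bsub>?F\<^esub>)) \<and> (\<forall>p\<in>X. ?L (b, \<one>\<^bsub>?F\<^esub>) (k p) = (p, e p))"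
    unfolding \<rho> by (rule coc[OF c[unfolded \<rho>]]) (use eT in blast)
  then have lg: "?L (b, \<one>\<^bsub>?F\<^esub>) (g p) = (p, \<one>\<^bsub>?F\<^esub>)" and lk: "?L (b, \<one>\<^bsub>?F\<^esub>) (k p) = (p, e p)" if "p \<in> X" for p
    using that by blast+
  have run_g: "run m \<rho> b (g p) = p" if "p \<in> X" for p
    using arg_cong[OF lg[OF that], of fst] by (simp add: fst_lift)
  have lab_eq: "edge \<sigma> p = edge \<sigma> q" if "p \<in> X" "q \<in> X" "lab p = lab q" for p q
  proof -
    have "run m \<rho> b (g (rep p)) = run m \<rho> b (g (rep q))"
      using that(3) run_eqv[OF a m] by (simp add: lab_def cl_eq_iff)
    moreover have "rep p \<in> X" "rep q \<in> X" using rep edge_X that by blast+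
    ultimately have "rep p = rep q" using run_g by simp
    then show ?thesis using edge_eq[OF a' m rep, of p] edge_eq[OF a' m rep, of q] by simp
  qed
  \<comment> \<open>The loop through the tree that arrives at \<open>p\<close> by letters y and
    returns from its x-side; it is trivial for \<open>p\<close> in \<open>T\<close>. Moving
    \<open>p\<close> along its edge multiplies both words on the right by the same element, so
    \<open>s\<close> depends only on the edge.\<close>
  define s where "s p = cl m (k p) \<otimes>\<^bsub>Gamma3 m\<^esub> inv\<^bsub>Gamma3 m\<^esub> cl m (g p)" for p
  have sc: "s p \<in> carrier (Gamma3 m)" for p using clc by (simp add: s_def)
  have s_edge: "s q = s p" if "p \<in> X" "q \<in> edge \<sigma> p" for p q
  proof -
    obtain i where i: "q = (\<sigma> ^^ (2 * i)) p" using \<open>q \<in> edge \<sigma> p\<close> by (auto simp: edge_def)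
    let ?z = "cl m (pow_word gen_x (2 * i))"
    have "eqv m (g q) (g p @ pow_word gen_x (2 * i))"
      unfolding i using g_step sX(1) \<open>p \<in> X\<close> by (rule word_funpow)
    then have gq: "cl m (g q) = cl m (g p) \<otimes>\<^bsub>Gamma3 m\<^esub> ?z" by (simp add: Gamma3_simps cl_eq_iff)
    have "eqv m (k q) (k p @ pow_word gen_y (3 * i))"
      unfolding i square_cube[OF a'] using k_step sX(2) \<open>p \<in> X\<close> by (rule word_funpow)
    moreover have "eqv m (k p @ pow_word gen_y (3 * i)) (k p @ pow_word gen_x (2 * i))"
      by (intro eqv_appendI pres_eq.sym[OF square_cube_word])
    ultimately have "eqv m (k q) (k p @ pow_word gen_x (2 * i))" by (rule pres_eq.trans)
    then have kq: "cl m (k q) = cl m (k p) \<otimes>\<^bsub>Gamma3 m\<^esub> ?z" by (simp add: Gamma3_simps cl_eq_iff)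
    show ?thesis unfolding s_def gq kq by (rule \<Gamma>.mult_inv_mult_right[OF clc clc clc])
  qed
  define h where "h l = s (SOME p. p \<in> X - T \<and> lab p = l)" for l
  have h_lab: "h (lab p) = s p" if "p \<in> X - T" for p
  proof -
    define q where "q = (SOME q. q \<in> X - T \<and> lab q = lab p)"
    have "\<exists>q. q \<in> X - T \<and> lab q = lab p" using that by blast
    from someI_ex[OF this] have q: "q \<in> X - T" "lab q = lab p" by (simp_all add: q_def)
    have "edge \<sigma> q = edge \<sigma> p" using q that by (intro lab_eq) auto
    then have "q \<in> edge \<sigma> p" using edge_base[of q \<sigma>] by simp
    then show ?thesis using s_edge[of p q] that by (simp add: h_def q_def)
  qed
  have "h l \<in> carrier (Gamma3 m)" for l by (simp add: h_def sc)
  then obtain \<psi> where \<psi>: "\<psi> \<in> hom ?F (Gamma3 m)" "\<And>l. l \<in> S \<Longrightarrow> \<psi> (pcl S {} [(l, True)]) = h l"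
    using free_group_hom_exists[of "Gamma3 m" S h] \<Gamma>.group_axioms by blast
  interpret \<psi>: group_hom ?F "Gamma3 m" \<psi>
    using \<psi>(1) by (simp add: group_hom_def group_hom_axioms_def F.group_axioms \<Gamma>.group_axioms)
  have \<psi>_e: "\<psi> (e p) = s p" if "p \<in> X" for p
  proof (cases "p \<in> T")
    case True
    then have "cl m (g p) = cl m (k p)" using gk by (simp add: cl_eq_iff)
    then have "s p = \<one>\<^bsub>Gamma3 m\<^esub>" using clc by (simp add: s_def)
    then show ?thesis using eT[OF True] by simp
  next
    case False
    then show ?thesis using that \<psi>(2)[of "lab p"] h_lab[of p] by (simp add: e_def S_def)
  qed
  \<comment> \<open>Any word equals the image of its F-component followed by the tree word to its
    endpoint. For closed words that tree word is trivial, which gives surjectivity.\<close>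
  have to_free: "\<exists>f\<in>carrier ?F. ?L (b, \<one>\<^bsub>?F\<^esub>) w = (run m \<rho> b w, f) \<and>
      cl m w = \<psi> f \<otimes>\<^bsub>Gamma3 m\<^esub> cl m (g (run m \<rho> b w))" for w
  proof (induction w rule: rev_induct)
    case Nil
    have "cl m (g b) = \<one>\<^bsub>Gamma3 m\<^esub>" using gb by (simp add: Gamma3_simps cl_eq_iff)
    then show ?case by (intro bexI[of _ "\<one>\<^bsub>?F\<^esub>"]) (simp_all add: Gamma3_simps(3)[symmetric])
  next
    case (snoc l w)
    obtain c' i where l: "l = (c', i)" by force
    let ?p = "run m \<rho> b w"
    let ?q = "move m \<rho> ?p l"
    from snoc obtain f where f: "f \<in> carrier ?F" "?L (b, \<one>\<^bsub>?F\<^esub>) w = (?p, f)"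
      "cl m w = \<psi> f \<otimes>\<^bsub>Gamma3 m\<^esub> cl m (g ?p)" by blast
    have pX: "?p \<in> X" using ran by blast
    have qX: "?q \<in> X" using pX move_in[OF a] by blast
    have cl_snoc: "cl m (w @ [l]) = \<psi> f \<otimes>\<^bsub>Gamma3 m\<^esub> cl m (g ?p) \<otimes>\<^bsub>Gamma3 m\<^esub> cl m [l]"
      using f(3) by (simp add: Gamma3_simps(2)[symmetric])
    have L_snoc: "?L (b, \<one>\<^bsub>?F\<^esub>) (w @ [l]) = lift m \<rho> ?F e (?p, f) l" and run_snoc: "run m \<rho> b (w @ [l]) = ?q"
      by (simp_all only: foldl_append foldl_Cons foldl_Nil f(2))
    show ?case
    proof (cases c')
      case gen_x
      have "eqv m (g ?q) (g ?p @ [l])"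
        unfolding l gen_x by (rule words_step[OF a m _ pX]) (simp add: \<rho> g_step)
      then have "cl m (g ?q) = cl m (g ?p) \<otimes>\<^bsub>Gamma3 m\<^esub> cl m [l]" by (simp add: Gamma3_simps cl_eq_iff)
      then have "cl m (w @ [l]) = \<psi> f \<otimes>\<^bsub>Gamma3 m\<^esub> cl m (g ?q)"
        using f(1) clc cl_snoc by (simp add: \<Gamma>.m_assoc)
      moreover have "lift m \<rho> ?F e (?p, f) l = (?q, f)" by (simp add: lift_def l gen_x)
      ultimately show ?thesis
        using f(1) unfolding L_snoc run_snoc by blast
    next
      case gen_y
      have "eqv m (k ?q) (k ?p @ [l])"
        unfolding l gen_y by (rule words_step[OF a m _ pX]) (simp add: \<rho> k_step)
      then have kq: "cl m (k ?q) = cl m (k ?p) \<otimes>\<^bsub>Gamma3 m\<^esub> cl m [l]" by (simp add: Gamma3_simps cl_eq_iff)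
      let ?f = "f \<otimes>\<^bsub>?F\<^esub> inv\<^bsub>?F\<^esub> e ?p \<otimes>\<^bsub>?F\<^esub> e ?q"
      have "\<psi> ?f = \<psi> f \<otimes>\<^bsub>Gamma3 m\<^esub> inv\<^bsub>Gamma3 m\<^esub> s ?p \<otimes>\<^bsub>Gamma3 m\<^esub> s ?q"
        using f(1) ec \<psi>_e[OF pX] \<psi>_e[OF qX] by simp
      then have "\<psi> ?f \<otimes>\<^bsub>Gamma3 m\<^esub> cl m (g ?q) = cl m (w @ [l])"
        using \<Gamma>.tree_step[of "\<psi> f" "cl m (g ?p)" "cl m (k ?p)" "cl m (g ?q)" "cl m [l]"] f(1) clc
        unfolding s_def kq cl_snoc by simp
      moreover have "lift m \<rho> ?F e (?p, f) l = (?q, ?f)" by (simp add: lift_def l gen_y)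
      moreover have "?f \<in> carrier ?F" using f(1) ec by simp
      ultimately show ?thesis
        unfolding L_snoc run_snoc by (intro bexI[of _ ?f]) simp_all
    qed
  qed
  \<comment> \<open>Each \<open>f\<close> is the F-component of some closed word representing
    \<open>\<psi> f\<close>. Equal images then have equal components by \<open>lift_eqv\<close>,
    which gives injectivity.\<close>
  have from_free: "\<exists>w. \<psi> f = cl m w \<and> ?L (b, \<one>\<^bsub>?F\<^esub>) w = (b, f)" if fF: "f \<in> carrier ?F" for f
  proof -
    obtain u where u: "u \<in> words S" "f = pcl S {} u"
      using fF by (auto simp: free_group_def carrier_presented)
    have "\<exists>w. \<psi> (pcl S {} u) = cl m w \<and> ?L (b, \<one>\<^bsub>?F\<^esub>) w = (b, pcl S {} u)"
      using u(1)
    proof (induction u rule: rev_induct)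
      case Nil
      have "\<psi> (pcl S {} []) = cl m []"
        using \<psi>.hom_one by (simp add: one_F Gamma3_simps(3))
      then show ?case by (intro exI[of _ "[]"]) (simp add: one_F)
    next
      case (snoc l u)
      obtain a i where l: "l = (a, i)" by force
      from snoc.prems have uS: "u \<in> words S" and aS: "a \<in> S" by (auto simp: l)
      then obtain p where p: "p \<in> X - T" "a = lab p" by (auto simp: S_def)
      then have pX: "p \<in> X" and ep: "e p = pcl S {} [(a, True)]" by (auto simp: e_def)
      from snoc uS obtain w where w: "\<psi> (pcl S {} u) = cl m w" "?L (b, \<one>\<^bsub>?F\<^esub>) w = (b, pcl S {} u)" by blast
      have uc: "pcl S {} u \<in> carrier ?F" using uS by (auto simp: free_group_def)
      have L_left: "?L (b, f) v = (run m \<rho> b v, f \<otimes>\<^bsub>?F\<^esub> snd (?L (b, \<one>\<^bsub>?F\<^esub>) v))" if "f \<in> carrier ?F" for f v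
        using lift_mult_left[OF c F.one_closed that, of m b v] that by simp
      \<comment> \<open>A generator is realized by going out along \<open>k p\<close> and back along
        \<open>g p\<close>, its inverse by exchanging the two.\<close>
      have "\<exists>v x. ?L (b, \<one>\<^bsub>?F\<^esub>) v = (b, x) \<and> x \<in> carrier ?F \<and> \<psi> x = cl m v \<and> pcl S {} [l] = x"
      proof (cases i)
        case True
        have "?L (b, e p) (g p) = (p, e p)"
          using L_left[OF ec, of p "g p"] lg[OF pX] run_g[OF pX] ec by simp
        then have "?L (p, e p) (word_inv (g p)) = (b, e p)"
          using lift_word_inv[OF a m c, of "(b, e p)" "g p"] ec by simp
        then have "?L (b, \<one>\<^bsub>?F\<^esub>) (k p @ word_inv (g p)) = (b, e p)"
          by (simp only: foldl_append lk[OF pX])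
        moreover have "\<psi> (e p) = cl m (k p @ word_inv (g p))"
          by (simp only: \<psi>_e[OF pX] s_def Gamma3_simps)
        moreover have "pcl S {} [l] = e p" using True by (simp only: ep l)
        ultimately show ?thesis using ec[of p] by (intro exI conjI)
      next
        case False
        have il: "pcl S {} [l] = inv\<^bsub>?F\<^esub> e p"
          using aS False inv_presented[of "[(a, True)]" S "{}"] by (simp add: ep l free_group_def)
        have "fst (?L (b, \<one>\<^bsub>?F\<^esub>) (k p)) = p" using lk[OF pX] by simp
        then have "run m \<rho> b (k p) = p" by (simp add: fst_lift)
        then have "?L (b, inv\<^bsub>?F\<^esub> e p) (k p) = (p, \<one>\<^bsub>?F\<^esub>)"
          using L_left[of "inv\<^bsub>?F\<^esub> e p" "k p"] lk[OF pX] ec by simp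
        then have "?L (p, \<one>\<^bsub>?F\<^esub>) (word_inv (k p)) = (b, inv\<^bsub>?F\<^esub> e p)"
          using lift_word_inv[OF a m c, of "(b, inv\<^bsub>?F\<^esub> e p)" "k p"] ec by simp
        then have "?L (b, \<one>\<^bsub>?F\<^esub>) (g p @ word_inv (k p)) = (b, inv\<^bsub>?F\<^esub> e p)"
          by (simp only: foldl_append lg[OF pX])
        moreover have "\<psi> (inv\<^bsub>?F\<^esub> e p) = inv\<^bsub>Gamma3 m\<^esub> s p" using ec \<psi>_e[OF pX] by simp
        then have "\<psi> (inv\<^bsub>?F\<^esub> e p) = cl m (g p @ word_inv (k p))"
          using \<Gamma>.inv_mult_group[OF clc \<Gamma>.inv_closed[OF clc], of "k p" "g p"] clc
          by (simp add: s_def Gamma3_simps(2,4))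
        ultimately show ?thesis using F.inv_closed[OF ec, of p] il by (intro exI conjI)
      qed
      then obtain v x where v: "?L (b, \<one>\<^bsub>?F\<^esub>) v = (b, x)" "x \<in> carrier ?F" "\<psi> x = cl m v" "pcl S {} [l] = x" by blast
      have ul: "pcl S {} (u @ [l]) = pcl S {} u \<otimes>\<^bsub>?F\<^esub> x"
        using uS aS v(4) l by (simp add: free_group_def presented_group_mult[symmetric])
      have "run m \<rho> b v = b" using arg_cong[OF v(1), of fst] by (simp add: fst_lift)
      then have "?L (b, \<one>\<^bsub>?F\<^esub>) (w @ v) = (b, pcl S {} (u @ [l]))"
        using w(2) L_left[OF uc, of v] v(1) ul by simp
      moreover have "\<psi> (pcl S {} (u @ [l])) = cl m (w @ v)"
        using ul uc v w(1) by (simp add: Gamma3_simps)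
      ultimately show ?case by blast
    qed
    then show ?thesis using u(2) by simp
  qed
  have sub: "subgroup (stab m \<rho> b) (Gamma3 m)" by (rule subgroup_stab[OF a m])
  have "\<psi> \<in> iso ?F (Gamma3 m\<lparr>carrier := stab m \<rho> b\<rparr>)"
  proof -
    have in_stab: "\<psi> f \<in> stab m \<rho> b" if f: "f \<in> carrier ?F" for f
    proof -
      obtain w where w: "\<psi> f = cl m w" "?L (b, \<one>\<^bsub>?F\<^esub>) w = (b, f)" using from_free[OF f] by blast
      have "run m \<rho> b w = b" using arg_cong[OF w(2), of fst] by (simp add: fst_lift)
      then show ?thesis using w(1) stab_iff[OF a m] by simp
    qed
    have "inj_on \<psi> (carrier ?F)"
    proof (rule inj_onI)
      fix f f' assume f: "f \<in> carrier ?F" "f' \<in> carrier ?F" "\<psi> f = \<psi> f'"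
      obtain w where w: "\<psi> f = cl m w" "?L (b, \<one>\<^bsub>?F\<^esub>) w = (b, f)" using from_free[OF f(1)] by blast
      obtain w' where w': "\<psi> f' = cl m w'" "?L (b, \<one>\<^bsub>?F\<^esub>) w' = (b, f')" using from_free[OF f(2)] by blast
      have "cl m w = cl m w'" using w(1) w'(1) f(3) by simp
      then have "eqv m w w'" by (simp only: cl_eq_iff)
      moreover have "(b, \<one>\<^bsub>?F\<^esub>) \<in> UNIV \<times> carrier ?F" by simp
      ultimately have "?L (b, \<one>\<^bsub>?F\<^esub>) w = ?L (b, \<one>\<^bsub>?F\<^esub>) w'" by (intro lift_eqv[OF a m c])
      then show "f = f'" using w(2) w'(2) by simp
    qed
    moreover have "stab m \<rho> b \<subseteq> \<psi> ` carrier ?F"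
    proof
      fix d assume "d \<in> stab m \<rho> b"
      then obtain w where w: "d = cl m w" "run m \<rho> b w = b" by (auto simp: stab_def)
      obtain f where f: "f \<in> carrier ?F" "cl m w = \<psi> f \<otimes>\<^bsub>Gamma3 m\<^esub> cl m (g b)"
        using to_free[of w] unfolding w(2) by blast
      have "cl m (g b) = \<one>\<^bsub>Gamma3 m\<^esub>" using gb by (simp add: Gamma3_simps cl_eq_iff)
      then have "d = \<psi> f" using f(2) w(1) \<Gamma>.r_one[OF \<psi>.hom_closed[OF f(1)]] by simp
      then show "d \<in> \<psi> ` carrier ?F" using f(1) by blast
    qed
    ultimately have "bij_betw \<psi> (carrier ?F) (stab m \<rho> b)"
      using in_stab unfolding bij_betw_def by blast
    moreover have "\<psi> \<in> hom ?F (Gamma3 m\<lparr>carrier := stab m \<rho> b\<rparr>)"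
      using in_stab by (intro homI) (simp_all add: \<psi>.hom_mult)
    ultimately show ?thesis by (simp add: iso_def)
  qed
  then have "?F \<cong> Gamma3 m\<lparr>carrier := stab m \<rho> b\<rparr>" unfolding is_iso_def by blast
  moreover have "group (Gamma3 m\<lparr>carrier := stab m \<rho> b\<rparr>)"
    by (rule subgroup.subgroup_is_group[OF sub \<Gamma>.group_axioms])
  ultimately show ?thesis unfolding is_free_group_def by blast
qed

subsection \<open>Counting free subgroups\<close>

text \<open>Taking the stabilizer of \<open>b\<close> maps transitive actions onto free subgroups,
  with all fibers of size \<open>fact (card K - 1)\<close>.\<close>

lemma card_trans_acts:
  assumes K: "finite K" "b \<in> K" and m: "m > 0"
  shows "card (trans_acts m K b) = fact (card K - 1) * card (free_subgroups (Gamma3 m) (card K))"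
proof -
  have fin: "finite (trans_acts m K b)"
    by (rule finite_subset[OF _ finite_acts[OF K(1), of m]]) (auto simp: trans_acts_def)
  let ?stab = "\<lambda>\<rho>. stab m \<rho> b"
  have "?stab ` trans_acts m K b \<subseteq> free_subgroups (Gamma3 m) (card K)"
  proof (rule image_subsetI)
    fix \<rho> assume \<rho>: "\<rho> \<in> trans_acts m K b"
    then have a: "\<rho> \<in> acts m K" by (simp add: trans_acts_def)
    show "stab m \<rho> b \<in> free_subgroups (Gamma3 m) (card K)"
      unfolding free_subgroups_def
      using subgroup_stab[OF a m] card_rcosets_stab[OF \<rho> m] stab_free[OF \<rho> m K(1)] by blast
  qed
  moreover have "free_subgroups (Gamma3 m) (card K) \<subseteq> ?stab ` trans_acts m K b"
    using coset_action_exists[OF _ K m] by blast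
  ultimately have im: "?stab ` trans_acts m K b = free_subgroups (Gamma3 m) (card K)" by (rule subset_antisym)
  have "card (trans_acts m K b) = (\<Sum>H\<in>?stab ` trans_acts m K b. card {\<rho> \<in> trans_acts m K b. stab m \<rho> b = H})"
    using sum.image_gen[OF fin, of "\<lambda>_. 1 :: nat" ?stab] by simp
  also have "\<dots> = (\<Sum>H\<in>?stab ` trans_acts m K b. fact (card K - 1))"
    using card_trans_acts_stab[OF K m] by (intro sum.cong HOL.refl) auto
  finally show ?thesis by (simp add: im)
qed

text \<open>Count the actions on N = 6mn points by the orbit of the point 0. Choosing an orbit with
  6mj points and filling it and its complement produces the common factor (N - 1)!; the left over N
  from N! is the factor 6mn.\<close>

lemma log_derivative_recurrence:
  assumes m: "m > 0" and n: "n > 0"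
  shows "(\<Sum>j=1..n. free_subgroup_number m j * 72 ^ j * (gamma_coeff (n - j) * m ^ (n - j)))
       = 6 * m * n * (gamma_coeff n * m ^ n)"
proof -
  define N where "N = 6 * m * n"
  define X where "X = {..<N}"
  define c where "c j = gamma_coeff j * m ^ j" for j
  let ?f = "free_subgroup_number m"
  let ?t = "\<lambda>K. card (trans_acts m K 0) * card (acts m (X - K))"
  let ?\<K> = "\<lambda>j. {K. 0 \<in> K \<and> K \<subseteq> X \<and> card K = 6 * m * j}"
  have X: "finite X" "0 \<in> X" "card X = 6 * m * n"
    using m n by (auto simp: X_def N_def)
  have N: "N > 0" using m n by (simp add: N_def)
  \<comment> \<open>The point 0 is prescribed, so only \<open>6 * m * j - 1\<close> points are
    chosen.\<close>
  have card_\<K>: "card (?\<K> j) = (N - 1) choose (6 * m * j - 1)" if "j > 0" for j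
  proof -
    let ?\<L> = "{L. L \<subseteq> X - {0} \<and> card L = 6 * m * j - 1}"
    have pos: "6 * m * j > 0" using m that by simp
    have "bij_betw (insert 0) ?\<L> (?\<K> j)"
    proof (rule bij_betw_byWitness[where f' = "\<lambda>K. K - {0}"])
      show "insert 0 ` ?\<L> \<subseteq> ?\<K> j"
      proof (rule image_subsetI)
        fix L assume "L \<in> ?\<L>"
        then have "finite L" "0 \<notin> L" "L \<subseteq> X" "card L = 6 * m * j - 1" using X(1) by (auto intro: finite_subset)
        then show "insert 0 L \<in> ?\<K> j" using X(2) pos by simp
      qed
      show "(\<lambda>K. K - {0}) ` ?\<K> j \<subseteq> ?\<L>" by (auto simp: card_Diff_singleton)
    qed auto
    then have "card (?\<K> j) = card ?\<L>" by (simp add: bij_betw_same_card)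
    also have "\<dots> = card (X - {0}) choose (6 * m * j - 1)" using X(1) by (intro n_subsets) simp
    finally show ?thesis using X by (simp add: N_def)
  qed
  have summand: "72 ^ n * ?t K = fact (6 * m * j - 1) * fact (N - 6 * m * j) * (?f j * 72 ^ j * c (n - j))"
    if K: "K \<in> ?\<K> j" and j: "j \<le> n" for K j
  proof -
    have fK: "finite K" using K X(1) finite_subset by auto
    have "card (X - K) = 6 * m * (n - j)"
      using K X fK by (simp add: card_Diff_subset diff_mult_distrib2)
    then have "72 ^ (n - j) * card (acts m (X - K)) = fact (6 * m * (n - j)) * c (n - j)"
      unfolding c_def using X(1) m by (intro card_acts) auto
    moreover have "6 * m * (n - j) = N - 6 * m * j" by (simp add: N_def diff_mult_distrib2)
    moreover have "card (trans_acts m K 0) = fact (6 * m * j - 1) * ?f j"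
      using card_trans_acts[OF fK _ m] K by (simp add: free_subgroup_number_def)
    moreover have "(72 :: nat) ^ n = 72 ^ j * 72 ^ (n - j)" using j by (simp flip: power_add)
    \<comment> \<open>The power \<open>72 ^ (n - j)\<close> clears the denominator for the
      complement, and \<open>72 ^ j\<close> stays with \<open>?f j\<close>.\<close>
    then have "72 ^ n * ?t K = 72 ^ j * card (trans_acts m K 0) * (72 ^ (n - j) * card (acts m (X - K)))"
      by (simp only: mult_ac)
    ultimately show ?thesis by (simp only: mult_ac)
  qed
  have "{K. 0 \<in> K \<and> K \<subseteq> X} \<subseteq> Pow X" by auto
  then have fin: "finite {K. 0 \<in> K \<and> K \<subseteq> X}" using X(1) finite_subset by auto
  have "fact N = N * fact (N - 1)" using fact_reduce[OF N, where 'a = nat] by simp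
  then have "N * (fact (N - 1) * c n) = 72 ^ n * card (acts m X)"
    using card_acts[OF X(1) m X(3)] by (simp only: c_def N_def mult.assoc)
  also have "\<dots> = (\<Sum>K | 0 \<in> K \<and> K \<subseteq> X. 72 ^ n * ?t K)"
    using card_acts_decompose[OF X(1) m X(2)] by (simp add: sum_distrib_left)
  \<comment> \<open>Sets whose size is not a multiple of 6m carry no regular action and drop
    out.\<close>
  also have "\<dots> = (\<Sum>K\<in>(\<Union>j\<in>{1..n}. ?\<K> j). 72 ^ n * ?t K)"
  proof (rule sum.mono_neutral_right[OF fin])
    show "\<forall>K\<in>{K. 0 \<in> K \<and> K \<subseteq> X} - (\<Union>j\<in>{1..n}. ?\<K> j). 72 ^ n * ?t K = 0"
    proof
      fix K assume K: "K \<in> {K. 0 \<in> K \<and> K \<subseteq> X} - (\<Union>j\<in>{1..n}. ?\<K> j)"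
      then have fK: "finite K" using X(1) finite_subset by auto
      have "\<not> 6 * m dvd card K"
      proof
        assume "6 * m dvd card K"
        then obtain j where j: "card K = 6 * m * j" ..
        have "card K > 0" using K fK by (auto simp: card_gt_0_iff)
        then have "j \<ge> 1" using j by (cases j) auto
        moreover have "card K \<le> card X" using K X(1) by (intro card_mono) auto
        then have "j \<le> n" using j X(3) m by simp
        ultimately show False using K j by auto
      qed
      then have "acts m K = {}" by (rule acts_empty[OF fK m])
      then have "trans_acts m K 0 = {}" by (simp add: trans_acts_def)
      then show "72 ^ n * ?t K = 0" by simp
    qed
  qed auto
  also have "\<dots> = (\<Sum>j=1..n. \<Sum>K\<in>?\<K> j. 72 ^ n * ?t K)"
    using m by (intro sum.UNION_disjoint) (auto intro: finite_subset[OF _ fin])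
  also have "\<dots> = (\<Sum>j=1..n. fact (N - 1) * (?f j * 72 ^ j * c (n - j)))"
  proof (rule sum.cong[OF HOL.refl])
    fix j assume j: "j \<in> {1..n}"
    have le: "6 * m * j - 1 \<le> N - 1" using j by (auto simp: N_def intro!: diff_le_mono)
    have pos: "6 * m * j > 0" using j m by simp
    have "(\<Sum>K\<in>?\<K> j. 72 ^ n * ?t K)
        = (\<Sum>K\<in>?\<K> j. fact (6 * m * j - 1) * fact (N - 6 * m * j) * (?f j * 72 ^ j * c (n - j)))"
      using summand[of _ j] j by (intro sum.cong HOL.refl) auto
    also have "\<dots> = (fact (6 * m * j - 1) * fact (N - 1 - (6 * m * j - 1)) * ((N - 1) choose (6 * m * j - 1)))
        * (?f j * 72 ^ j * c (n - j))"
      using card_\<K>[of j] j pos by (simp add: mult_ac)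
    also have "\<dots> = fact (N - 1) * (?f j * 72 ^ j * c (n - j))"
      by (simp only: binomial_fact_lemma[OF le])
    finally show "(\<Sum>K\<in>?\<K> j. 72 ^ n * ?t K) = fact (N - 1) * (?f j * 72 ^ j * c (n - j))" .
  qed
  also have "\<dots> = fact (N - 1) * (\<Sum>j=1..n. ?f j * 72 ^ j * c (n - j))"
    by (simp add: sum_distrib_left)
  finally have "fact (N - 1) * (N * c n) = fact (N - 1) * (\<Sum>j=1..n. ?f j * 72 ^ j * c (n - j))"
    by (simp only: mult_ac)
  then have "N * c n = (\<Sum>j=1..n. ?f j * 72 ^ j * c (n - j))" by simp
  then show ?thesis by (simp add: N_def c_def)
qed

theorem theorem8:
  fixes m p \<alpha> :: nat
  assumes "m > 0" and "prime p" and "p \<ge> 5" and "\<alpha> > 0"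
  shows "(\<exists>P Q :: int poly. poly Q 0 = 1 \<and>
            (\<forall>n. [fps_nth (fps_of_poly Q * free_subgroup_fps m) n = coeff P n]
                   (mod (int p ^ \<alpha>))))
       \<and> (\<exists>N \<omega>. \<omega> > 0 \<and>
            (\<forall>l\<ge>N. [free_subgroup_number m (l + \<omega>) = free_subgroup_number m l]
                   (mod (p ^ \<alpha>))))"
  using rational_and_periodic_of_log_derivative[OF assms(2,3) log_derivative_recurrence[OF assms(1)], of \<alpha>]
  unfolding free_subgroup_fps_def by (rule conjI)

end
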